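(* Let $L$ be a Leibniz algebra over a field $F$ of characteristic $0$. Then the Frattini subalgebra $\Phi(L)$ is an ideal of $L$.
   Context: A (left) Leibniz algebra is an algebra $L$ over a field $F$ with $a(bc)=(ab)c+b(ac)$ for all $a,b,c\in L$. Ideals are two-sided. The Frattini subalgebra $\Phi(L)$ is the intersection of all maximal (proper) subalgebras of $L$ (taken to be $L$ itself if there are none, so $\Phi(0)=0$).
   Formalization: L is assumed finite-dimensional. Without this the claim fails: let the Heisenberg algebra K (center Fz) act on V = F[t] by d/dt, t and 1; for L = V + K with (v+k)(v'+k') = k.v' + [k,k'], Φ(L) = Fz is not an ideal. *)

theory Defs
  imports Complex_Main
begin

text \<open>The underlying vector space of the algebra is the whole type \<^typ>\<open>'b\<close>; its multiplication
  \<open>mult\<close> is bilinear and satisfies the left Leibniz identity.\<close>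

locale leibniz_algebra = vector_space scale
  for scale :: "'a::field \<Rightarrow> 'b::ab_group_add \<Rightarrow> 'b" (infixr \<open>*s\<close> 75) +
  fixes mult :: "'b \<Rightarrow> 'b \<Rightarrow> 'b" (infixl \<open>\<star>\<close> 70)
  assumes mult_linear_left: "Vector_Spaces.linear scale scale (\<lambda>x. x \<star> y)"
    and mult_linear_right: "Vector_Spaces.linear scale scale (\<lambda>y. x \<star> y)"
    and left_leibniz: "a \<star> (b \<star> c) = (a \<star> b) \<star> c + b \<star> (a \<star> c)"
begin

definition finite_dim :: bool where
  "finite_dim \<longleftrightarrow> (\<exists>B. finite B \<and> span B = UNIV)"

definition subalgebra :: "'b set \<Rightarrow> bool" where
  "subalgebra S \<longleftrightarrow> subspace S \<and> (\<forall>x\<in>S. \<forall>y\<in>S. x \<star> y \<in> S)"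

definition ideal :: "'b set \<Rightarrow> bool" where
  "ideal I \<longleftrightarrow> subspace I \<and> (\<forall>x\<in>I. \<forall>y. x \<star> y \<in> I \<and> y \<star> x \<in> I)"

definition maximal_subalgebra :: "'b set \<Rightarrow> bool" where
  "maximal_subalgebra M \<longleftrightarrow> subalgebra M \<and> M \<noteq> UNIV \<and>
     (\<forall>S. subalgebra S \<longrightarrow> M \<subseteq> S \<longrightarrow> S = M \<or> S = UNIV)"

text \<open>If there are no maximal subalgebras, the intersection of the empty family is \<^term>\<open>UNIV\<close>,
  i.e. the whole algebra.\<close>

definition frattini :: "'b set" where
  "frattini = \<Inter> {M. maximal_subalgebra M}"

end

end

theory Submission
  imports Defs "HOL-Algebra.Algebraic_Closure_Type"
begin

hide_const (open) Polynomials.degree Polynomials.lead_coeff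

text \<open>Over a field of characteristic 0, a subspace stable under all automorphisms of a
  finite-dimensional algebra is stable under all its derivations D. The reason is that the torus
  generated by the semisimple part of D has enough points over the base field. If A is the set of
  eigenvalues of D, choose Galois-equivariant integral weights n(l,a), additive in l up to a
  constant, with \<open>\<Sum>a. n(l,a) a = N l + const\<close>, and let D act on the generalised eigenspace of l by
  \<open>\<Prod>a. (1 + t a) ^ n(l,a)\<close> times the exponential of t N times its nilpotent part. For t in the base
  field this is a polynomial in D over the base field and an automorphism up to a scalar factor, and
  its derivative at t = 0 is N D up to a scalar. Applied to left multiplications, this makes the
  Frattini subalgebra a left ideal.

  For right multiplications, let I be the span of the squares, so that I annihilates the algebra
  from the left, and let M be a maximal subalgebra not containing I. Then \<open>I / (M \<inter> I)\<close> is an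
  irreducible M-module. An element p of the Frattini subalgebra acts nilpotently modulo I since
  Frattini elements are non-generators, and it lies in the span of the products. If p did not act
  nilpotently on \<open>I / (M \<inter> I)\<close>, it would act invertibly, and its semisimple part s would commute
  with M; then \<open>s\<inverse> p\<close> is unipotent of trace \<open>dim (I / (M \<inter> I))\<close>, while its trace vanishes because p
  is a sum of commutators. Hence Engel's theorem applies, and irreducibility forces the Frattini
  subalgebra to act trivially on \<open>I / (M \<inter> I)\<close>.\<close>

subsection \<open>The Galois group of the algebraic closure\<close>

text \<open>The obstacle is that the eigenvalues lie in the algebraic closure while the algebra
  stays over the base field; its scalars are never extended. Instead, a polynomial over the closure
  acts on the scalar sequences \<open>to_ac (f ((D ^^ i) x))\<close>, with \<open>f\<close> a linear
  functional. An identity between products becomes a congruence of two-variable polynomials: X is D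
  on the left factor, Y is D on the right factor, and the Leibniz rule makes X + Y act as D on the
  product. Such congruences are checked for one triple l, u, l + u of eigenvalues at a time. The
  factors 1 + t a stand in for exp (t a) because the family has to be polynomial in t: its
  derivative is then determined by its values at infinitely many t in the base field. Nonnegative
  weights need the constant shift; it turns automorphisms into similitudes, which respect maximal
  subalgebras just as well. Left multiplications are derivations but right multiplications need not
  be, so the two halves of the ideal property need different arguments, the second one using the
  first.\<close>

definition ac_hom :: "('a::field alg_closure \<Rightarrow> 'a alg_closure) \<Rightarrow> bool" where
  "ac_hom \<sigma> \<longleftrightarrow> (\<forall>x y. \<sigma> (x + y) = \<sigma> x + \<sigma> y) \<and> (\<forall>x y. \<sigma> (x * y) = \<sigma> x * \<sigma> y)
     \<and> (\<forall>x. \<sigma> (to_ac x) = to_ac x)"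

text \<open>Partial homomorphisms over the base field are handled as their graphs, so that the union of
  a chain of them needs no gluing.\<close>

definition partial_hom :: "('a::field alg_closure \<times> 'a alg_closure) set \<Rightarrow> bool" where
  "partial_hom r \<longleftrightarrow> (\<forall>c. (to_ac c, to_ac c) \<in> r)
     \<and> (\<forall>x y u v. (x, u) \<in> r \<longrightarrow> (y, v) \<in> r \<longrightarrow> (x + y, u + v) \<in> r \<and> (x * y, u * v) \<in> r)
     \<and> (\<forall>y. (0, y) \<in> r \<longrightarrow> y = 0)"

text \<open>With \<open>r\<close> the graph of a partial homomorphism, \<open>q\<close> is the
  result of applying it to the coefficients of \<open>p\<close>.\<close>

definition poly_rel :: "('b::zero \<times> 'b) set \<Rightarrow> 'b poly \<Rightarrow> 'b poly \<Rightarrow> bool" where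
  "poly_rel r p q \<longleftrightarrow> (\<forall>i. (coeff p i, coeff q i) \<in> r)"

lemma partial_homD:
  assumes "partial_hom r"
  shows "(to_ac c, to_ac c) \<in> r"
    and "(x, u) \<in> r \<Longrightarrow> (y, v) \<in> r \<Longrightarrow> (x + y, u + v) \<in> r"
    and "(x, u) \<in> r \<Longrightarrow> (y, v) \<in> r \<Longrightarrow> (x * y, u * v) \<in> r"
    and "(0, y) \<in> r \<Longrightarrow> y = 0"
  using assms unfolding partial_hom_def by blast+

lemma partial_hom_simps:
  assumes r: "partial_hom r"
  shows "(0, 0) \<in> r" "(1, 1) \<in> r"
    and "(x, u) \<in> r \<Longrightarrow> (- x, - u) \<in> r"
    and "(x, u) \<in> r \<Longrightarrow> (y, v) \<in> r \<Longrightarrow> (x - y, u - v) \<in> r"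
proof -
  show "(0, 0) \<in> r" "(1, 1) \<in> r"
    using partial_homD(1)[OF r, of 0] partial_homD(1)[OF r, of 1] by simp_all
  have neg: "(- x, - u) \<in> r" if "(x, u) \<in> r" for x u
    using partial_homD(3)[OF r partial_homD(1)[OF r, of "-1"] that] by simp
  show "(x, u) \<in> r \<Longrightarrow> (- x, - u) \<in> r" by (rule neg)
  show "(x - y, u - v) \<in> r" if "(x, u) \<in> r" "(y, v) \<in> r"
    using partial_homD(2)[OF r that(1) neg[OF that(2)]] by simp
qed

lemma partial_hom_unique:
  assumes r: "partial_hom r" and "(x, u) \<in> r" "(x, v) \<in> r"
  shows "u = v"
  using partial_hom_simps(4)[OF assms] partial_homD(4)[OF r] by force

lemma partial_hom_sum:
  assumes r: "partial_hom r" and "\<And>i. i \<in> A \<Longrightarrow> (f i, g i) \<in> r"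
  shows "(sum f A, sum g A) \<in> r"
  using assms(2)
  by (induction A rule: infinite_finite_induct)
    (auto simp: partial_hom_simps(1)[OF r] intro: partial_homD(2)[OF r])

lemma partial_hom_power:
  assumes r: "partial_hom r" and "(x, u) \<in> r"
  shows "(x ^ n, u ^ n) \<in> r"
  by (induction n) (auto simp: partial_hom_simps(2)[OF r] intro: partial_homD(3)[OF r] assms)

lemma poly_rel_arith:
  assumes r: "partial_hom r" and p: "poly_rel r p q" "poly_rel r p' q'"
  shows "poly_rel r (p + p') (q + q')" "poly_rel r (p - p') (q - q')" "poly_rel r (p * p') (q * q')"
  using p by (auto simp: poly_rel_def coeff_mult
      intro!: partial_homD(2,3)[OF r] partial_hom_simps(4)[OF r] partial_hom_sum[OF r])

lemma poly_rel_monom: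
  assumes r: "partial_hom r" and "(x, u) \<in> r"
  shows "poly_rel r (monom x n) (monom u n)"
  using assms(2) partial_hom_simps(1)[OF r] by (auto simp: poly_rel_def)

lemma poly_rel_map_to_ac:
  assumes r: "partial_hom r"
  shows "poly_rel r (map_poly to_ac p) (map_poly to_ac p)"
  using partial_homD(1)[OF r] by (auto simp: poly_rel_def coeff_map_poly)

lemma poly_rel_degree:
  assumes r: "partial_hom r" and p: "poly_rel r p q" and monic: "lead_coeff p = 1"
  shows "degree q = degree p" "lead_coeff q = 1"
proof -
  have 1: "coeff q (degree p) = 1"
    using p monic partial_hom_unique[OF r _ partial_hom_simps(2)[OF r]]
    by (auto simp: poly_rel_def) (metis monic)
  have "coeff q i = 0" if "i > degree p" for i
    using p partial_homD(4)[OF r] coeff_eq_0[OF that] unfolding poly_rel_def by metis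
  then have "degree q \<le> degree p" by (intro degree_le) auto
  moreover have "degree p \<le> degree q" using 1 by (intro le_degree) auto
  ultimately show "degree q = degree p" by simp
  then show "lead_coeff q = 1" using 1 by simp
qed

lemma poly_rel_poly:
  assumes r: "partial_hom r" and p: "poly_rel r p q" and x: "(x, y) \<in> r"
  shows "(poly p x, poly q y) \<in> r"
proof -
  define n where "n = max (degree p) (degree q)"
  have "poly p x = (\<Sum>i\<le>n. coeff p i * x ^ i)" if "degree p \<le> n" for p and x :: "'a alg_closure"
    unfolding poly_altdef using that
    by (intro sum.mono_neutral_left) (auto simp: coeff_eq_0)
  then have "poly p x = (\<Sum>i\<le>n. coeff p i * x ^ i)" "poly q y = (\<Sum>i\<le>n. coeff q i * y ^ i)"
    by (simp_all add: n_def)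
  then show ?thesis using p
    by (auto simp: poly_rel_def intro!: partial_hom_sum[OF r] partial_homD(3)[OF r] partial_hom_power[OF r] x)
qed

text \<open>An algebraic relation of least degree for \<open>x\<close> has nonzero constant
  coefficient, since otherwise a factor X could be cancelled; solving it for that coefficient gives
  the inverse. Hence the domain of a partial homomorphism, by definition closed only under ring
  operations, is a field, and polynomials over it can be made monic.\<close>

lemma ac_inverse_poly:
  fixes x :: "'a::field alg_closure"
  assumes "x \<noteq> 0"
  obtains g where "inverse x = poly (map_poly to_ac g) x"
proof -
  obtain p where p: "p \<noteq> 0" "poly (map_poly to_ac p) x = 0" by (rule alg_closure_algebraic)
  define n where "n = degree p"
  from p have "\<exists>p. p \<noteq> 0 \<and> poly (map_poly to_ac p) x = 0" by blast
  then obtain p :: "'a poly" where p: "p \<noteq> 0" "poly (map_poly to_ac p) x = 0"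
    and min: "\<And>q. q \<noteq> 0 \<Longrightarrow> poly (map_poly to_ac q) x = 0 \<Longrightarrow> degree p \<le> degree q"
    using ex_has_least_nat[of "\<lambda>p. p \<noteq> 0 \<and> poly (map_poly to_ac p) x = 0" _ degree] by blast
  obtain c q where pq: "p = pCons c q" by (cases p)
  have *: "to_ac c + x * poly (map_poly to_ac q) x = 0" using p(2) p(1) by (simp add: pq map_poly_pCons)
  have "c \<noteq> 0"
  proof
    assume "c = 0"
    with * assms have "poly (map_poly to_ac q) x = 0" by simp
    moreover have "q \<noteq> 0" using p(1) pq \<open>c = 0\<close> by auto
    ultimately show False using min[of q] by (simp add: pq)
  qed
  have "map_poly to_ac (smult (- inverse c) q) = smult (to_ac (- inverse c)) (map_poly to_ac q)"
    by (rule map_poly_smult) auto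
  moreover have "x * poly (map_poly to_ac q) x = - to_ac c" using * by (simp add: add_eq_0_iff)
  ultimately have "inverse x = poly (map_poly to_ac (smult (- inverse c) q)) x"
    using assms \<open>c \<noteq> 0\<close> by (simp add: field_simps)
  then show ?thesis by (rule that)
qed

lemma partial_hom_monic:
  assumes r: "partial_hom r" and p: "poly_rel r p q" and "p \<noteq> 0"
  obtains p' q' where "poly_rel r p' q'" "lead_coeff p' = 1" "degree p' = degree p"
    "\<And>x. poly p' x = 0 \<longleftrightarrow> poly p x = 0"
proof -
  let ?c = "lead_coeff p" and ?d = "coeff q (degree p)"
  obtain g where g: "inverse ?c = poly (map_poly to_ac g) ?c"
    using \<open>p \<noteq> 0\<close> by (metis ac_inverse_poly leading_coeff_0_iff)
  define e where "e = poly (map_poly to_ac g) ?d"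
  have cd: "(?c, ?d) \<in> r" using p by (auto simp: poly_rel_def)
  have "(inverse ?c, e) \<in> r"
    unfolding g e_def by (rule poly_rel_poly[OF r poly_rel_map_to_ac[OF r] cd])
  then have "poly_rel r (smult (inverse ?c) p) (smult e q)"
    using p by (auto simp: poly_rel_def intro: partial_homD(3)[OF r])
  then show ?thesis
    using \<open>p \<noteq> 0\<close> by (intro that[of "smult (inverse ?c) p" "smult e q"]) auto
qed

text \<open>Here p plays the role of the minimal polynomial of a over the domain of r.\<close>

lemma partial_hom_adjoin:
  assumes r: "partial_hom r" and pq: "poly_rel r p q" and monic: "lead_coeff p = 1"
    and a: "poly p a = 0" and b: "poly q b = 0"
    and min: "\<forall>p' q'. poly_rel r p' q' \<longrightarrow> p' \<noteq> 0 \<longrightarrow> poly p' a = 0 \<longrightarrow> degree p \<le> degree p'"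
  obtains r' where "partial_hom r'" "r \<subseteq> r'" "(a, b) \<in> r'"
proof -
  define r' where "r' = {(poly f a, poly g b) | f g. poly_rel r f g}"
  \<comment> \<open>This makes the extension well defined. Subtracting a multiple of
    \<open>p\<close> from \<open>f\<close> and the matching multiple of \<open>q\<close> from
    \<open>g\<close> preserves the values at \<open>a\<close> and \<open>b\<close> and lowers the
    degree of \<open>f\<close>; minimality of \<open>p\<close> lets this continue until
    \<open>f\<close> is zero.\<close>
  have root: "poly g b = 0" if "poly_rel r f g" "poly f a = 0" for f g
    using that
  proof (induction "degree f" arbitrary: f g rule: less_induct)
    case less
    show ?case
    proof (cases "f = 0")
      case True
      then have "coeff g i = 0" for i
        using less.prems(1) partial_homD(4)[OF r] by (auto simp: poly_rel_def)
      then have "g = 0" by (simp add: poly_eq_iff)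
      then show ?thesis by simp
    next
      case False
      then have le: "degree p \<le> degree f" using min less.prems by blast
      define n where "n = degree f - degree p"
      define f' where "f' = f - monom (lead_coeff f) n * p"
      \<comment> \<open>The coefficient of \<open>g\<close> at the degree of \<open>f\<close>, not
        its leading one: this is the element that \<open>r\<close> relates to the leading
        coefficient of \<open>f\<close>.\<close>
      define g' where "g' = g - monom (coeff g (degree f)) n * q"
      have rel: "poly_rel r f' g'"
        unfolding f'_def g'_def
        by (intro poly_rel_arith[OF r] less.prems(1) pq poly_rel_monom[OF r])
          (use less.prems(1) in \<open>simp add: poly_rel_def\<close>)
      have f'a: "poly f' a = 0" using a less.prems(2) by (simp add: f'_def)
      have "poly g' b = 0"
      proof (cases "f' = 0")
        case True
        then have "coeff g' i = 0" for i
          using rel partial_homD(4)[OF r] by (auto simp: poly_rel_def)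
        then have "g' = 0" by (simp add: poly_eq_iff)
        then show ?thesis by simp
      next
        case f': False
        have "degree (monom (lead_coeff f) n * p) = degree f"
          using False monic le by (subst degree_mult_eq) (auto simp: degree_monom_eq n_def)
        moreover have "coeff (monom (lead_coeff f) n * p) (degree f) = lead_coeff f"
          using monic le by (simp add: coeff_monom_mult n_def)
        ultimately have "degree f' \<le> degree f" "coeff f' (degree f) = 0"
          unfolding f'_def by (auto intro: degree_diff_le)
        then have "degree f' < degree f" using f' by (metis le_neq_implies_less leading_coeff_0_iff)
        then show ?thesis using less.hyps rel f'a by blast
      qed
      then show ?thesis using b by (simp add: g'_def)
    qed
  qed
  have "partial_hom r'"
    unfolding partial_hom_def
  proof (intro conjI allI impI)
    fix c show "(to_ac c, to_ac c) \<in> r'"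
      unfolding r'_def using poly_rel_monom[OF r partial_homD(1)[OF r], of c 0]
      by (auto simp: monom_0 intro!: exI[of _ "[:to_ac c:]"])
  next
    fix x y u v assume "(x, u) \<in> r'" "(y, v) \<in> r'"
    then obtain f g f' g' where *: "poly_rel r f g" "poly_rel r f' g'"
      "x = poly f a" "u = poly g b" "y = poly f' a" "v = poly g' b"
      by (auto simp: r'_def)
    show "(x + y, u + v) \<in> r'" "(x * y, u * v) \<in> r'"
      using poly_rel_arith[OF r *(1,2)] * unfolding r'_def
      by (metis (mono_tags, lifting) mem_Collect_eq poly_add, metis (mono_tags, lifting) mem_Collect_eq poly_mult)
  next
    fix y assume "(0, y) \<in> r'"
    then show "y = 0" using root by (auto simp: r'_def)
  qed
  moreover have "r \<subseteq> r'"
  proof clarify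
    fix x u assume "(x, u) \<in> r"
    from poly_rel_monom[OF r this, of 0] show "(x, u) \<in> r'" unfolding r'_def
      by (intro CollectI exI[of _ "[:x:]"] exI[of _ "[:u:]"] conjI) (auto simp: monom_0)
  qed
  moreover have "(a, b) \<in> r'"
    using poly_rel_monom[OF r partial_hom_simps(2)[OF r], of 1] unfolding r'_def
    by (auto simp: poly_monom intro!: exI[of _ "monom 1 1"])
  ultimately show ?thesis by (rule that)
qed

lemma partial_hom_minpoly:
  assumes r: "partial_hom r"
  obtains p q where "poly_rel r p q" "lead_coeff p = 1" "poly p a = 0"
    "\<forall>p' q'. poly_rel r p' q' \<longrightarrow> p' \<noteq> 0 \<longrightarrow> poly p' a = 0 \<longrightarrow> degree p \<le> degree p'"
proof -
  obtain p where "p \<noteq> 0" "poly (map_poly to_ac p) a = 0" by (rule alg_closure_algebraic)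
  then have "\<exists>p. (\<exists>q. poly_rel r p q) \<and> p \<noteq> 0 \<and> poly p a = 0"
    using poly_rel_map_to_ac[OF r, of p] by (intro exI[of _ "map_poly to_ac p"]) (auto simp: map_poly_eq_0_iff)
  then obtain p q where p: "poly_rel r p q" "p \<noteq> 0" "poly p a = 0"
    and min: "\<forall>p' q'. poly_rel r p' q' \<longrightarrow> p' \<noteq> 0 \<longrightarrow> poly p' a = 0 \<longrightarrow> degree p \<le> degree p'"
    using ex_has_least_nat[of "\<lambda>p. (\<exists>q. poly_rel r p q) \<and> p \<noteq> 0 \<and> poly p a = 0" _ degree] by metis
  obtain p' q' where "poly_rel r p' q'" "lead_coeff p' = 1" "degree p' = degree p"
    "\<And>x. poly p' x = 0 \<longleftrightarrow> poly p x = 0"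
    using partial_hom_monic[OF r p(1,2)] by metis
  then show ?thesis using p(3) min by (intro that[of p' q']) auto
qed

text \<open>By Zorn's lemma there is a maximal extension. It is total: the conjugate of the minimal
  polynomial of any element has a root in the algebraically closed field, and the element can be
  sent to that root.\<close>

lemma partial_hom_extend:
  assumes r: "partial_hom r"
  obtains \<sigma> where "ac_hom \<sigma>" "\<And>x y. (x, y) \<in> r \<Longrightarrow> \<sigma> x = y"
proof -
  have "\<exists>M\<in>{s. partial_hom s \<and> r \<subseteq> s}. \<forall>Y\<in>{s. partial_hom s \<and> r \<subseteq> s}. M \<subseteq> Y \<longrightarrow> Y = M"
  proof (rule subset_Zorn_nonempty)
    show "{s. partial_hom s \<and> r \<subseteq> s} \<noteq> {}" using r by blast
    fix C assume ne: "C \<noteq> {}" and "subset.chain {s. partial_hom s \<and> r \<subseteq> s} C"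
    then have sub: "C \<subseteq> {s. partial_hom s \<and> r \<subseteq> s}"
      and chain: "\<And>s t. s \<in> C \<Longrightarrow> t \<in> C \<Longrightarrow> s \<subseteq> t \<or> t \<subseteq> s"
      by (auto simp only: subset_chain_def)
    have C: "\<And>s. s \<in> C \<Longrightarrow> partial_hom s" "\<And>s. s \<in> C \<Longrightarrow> r \<subseteq> s" using sub by auto
    have "partial_hom (\<Union>C)"
      unfolding partial_hom_def
    proof (intro conjI allI impI)
      fix c show "(to_ac c, to_ac c) \<in> \<Union>C" using ne partial_homD(1)[OF C(1)] by blast
    next
      fix x y u v assume "(x, u) \<in> \<Union>C" "(y, v) \<in> \<Union>C"
      then obtain s t where "s \<in> C" "(x, u) \<in> s" "t \<in> C" "(y, v) \<in> t" by blast
      then obtain s where "s \<in> C" "(x, u) \<in> s" "(y, v) \<in> s" using chain[of s t] by blast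
      then show "(x + y, u + v) \<in> \<Union>C" "(x * y, u * v) \<in> \<Union>C"
        using partial_homD(2,3)[OF C(1)] by blast+
    next
      fix y assume "(0, y) \<in> \<Union>C"
      then show "y = 0" using partial_homD(4)[OF C(1)] by blast
    qed
    then show "\<Union>C \<in> {s. partial_hom s \<and> r \<subseteq> s}" using ne C by blast
  qed
  then obtain M where M: "partial_hom M" "r \<subseteq> M"
    and max: "\<And>Y. partial_hom Y \<Longrightarrow> M \<subseteq> Y \<Longrightarrow> Y = M" by auto
  have dom: "\<exists>b. (a, b) \<in> M" for a
  proof -
    obtain p q where pq: "poly_rel M p q" "lead_coeff p = 1" "poly p a = 0"
      and min: "\<forall>p' q'. poly_rel M p' q' \<longrightarrow> p' \<noteq> 0 \<longrightarrow> poly p' a = 0 \<longrightarrow> degree p \<le> degree p'"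
      by (rule partial_hom_minpoly[OF M(1)])
    have "degree p \<noteq> 0" using pq by (metis degree_0_id lead_coeff_pCons(2) one_neq_zero poly_0_coeff_0 poly_const_conv degree_eq_zeroE poly_pCons mult_zero_right add.right_neutral poly_0)
    then have "degree q > 0" "lead_coeff q = 1" using poly_rel_degree[OF M(1) pq(1,2)] by auto
    then obtain b where "poly q b = 0" using alg_closed_imp_poly_has_root[of q] by auto
    then obtain r' where "partial_hom r'" "M \<subseteq> r'" "(a, b) \<in> r'"
      using partial_hom_adjoin[OF M(1) pq _ min] by metis
    then show ?thesis using max by metis
  qed
  define \<sigma> where "\<sigma> x = (THE y. (x, y) \<in> M)" for x
  have \<sigma>: "\<sigma> x = y \<longleftrightarrow> (x, y) \<in> M" for x y
  proof -
    have "\<exists>!y. (x, y) \<in> M" using dom partial_hom_unique[OF M(1)] by blast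
    from theI'[OF this] show ?thesis using partial_hom_unique[OF M(1)] unfolding \<sigma>_def by blast
  qed
  then have "(x, \<sigma> x) \<in> M" for x by blast
  then have "ac_hom \<sigma>" using partial_homD(1-3)[OF M(1)] unfolding ac_hom_def \<sigma> by blast
  then show ?thesis using \<sigma> M(2) by (intro that) auto
qed

text \<open>If the minimal polynomial p of \<open>a\<close> has degree above 1, write p = (X - a) g
  and send \<open>a\<close> to a root of g. As \<open>a\<close> is fixed, this root is
  \<open>a\<close> itself, so \<open>a\<close> is a double root and a root of the derivative, which
  in characteristic 0 is nonzero and of smaller degree.\<close>

theorem ac_hom_fixed:
  fixes a :: "'a::field_char_0 alg_closure"
  assumes fixed: "\<And>\<sigma>. ac_hom \<sigma> \<Longrightarrow> \<sigma> a = a"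
  shows "a \<in> range to_ac"
proof -
  \<comment> \<open>The graph of the identity on the base field: related polynomials are equal and
    have coefficients from there.\<close>
  define r :: "('a alg_closure \<times> 'a alg_closure) set" where "r = range (\<lambda>c. (to_ac c, to_ac c))"
  have r: "partial_hom r"
    unfolding partial_hom_def r_def
    by (auto simp: image_iff) (metis to_ac_add, metis to_ac_mult)
  obtain p q where pq: "poly_rel r p q" "lead_coeff p = 1" "poly p a = 0"
    and min: "\<forall>p' q'. poly_rel r p' q' \<longrightarrow> p' \<noteq> 0 \<longrightarrow> poly p' a = 0 \<longrightarrow> degree p \<le> degree p'"
    by (rule partial_hom_minpoly[OF r])
  have "p = q" using pq(1) by (auto simp: poly_rel_def r_def poly_eq_iff image_iff) (metis)
  have "p \<noteq> 0" using pq(2) by auto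
  from pq(3) obtain g where g: "p = [:- a, 1:] * g" by (auto simp: poly_eq_0_iff_dvd elim: dvdE)
  have "g \<noteq> 0" using g \<open>p \<noteq> 0\<close> by auto
  then have dg: "degree p = Suc (degree g)" unfolding g by (subst degree_mult_eq) auto
  have lg: "lead_coeff g = 1" using pq(2) unfolding g
    by (metis lead_coeff_mult lead_coeff_pCons(1) lead_coeff_1 mult_1 one_pCons pCons_0_0 one_neq_zero)
  show ?thesis
  proof (cases "degree g = 0")
    case True
    then have "g = 1" using lg
      by (metis degree_eq_zeroE lead_coeff_pCons(2) one_pCons)
    then have "coeff p 0 = - a" by (simp add: g)
    moreover have "coeff p 0 \<in> range to_ac" using pq(1) by (auto simp: poly_rel_def r_def)
    ultimately obtain c where "- a = to_ac c" by auto
    then have "a = to_ac (- c)" by (metis minus_minus to_ac_minus)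
    then show ?thesis by blast
  next
    case False
    then obtain b where b: "poly g b = 0" using alg_closed_imp_poly_has_root[of g] by auto
    then have "poly q b = 0" using \<open>p = q\<close> g by (metis mult_zero_right poly_mult)
    then obtain r' where r': "partial_hom r'" "(a, b) \<in> r'"
      using partial_hom_adjoin[OF r pq _ min] by metis
    obtain \<sigma> where "ac_hom \<sigma>" "\<sigma> a = b" using partial_hom_extend[OF r'(1)] r'(2) by metis
    then have "a = b" using fixed by metis
    then have "poly g a = 0" using b by simp
    moreover have "pderiv p = [:- a, 1:] * pderiv g + g * pderiv [:- a, 1:]"
      unfolding g by (rule pderiv_mult)
    ultimately have "poly (pderiv p) a = 0" by (simp only: poly_add poly_mult) simp
    moreover have "poly_rel r (pderiv p) (pderiv p)"
      unfolding poly_rel_def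
    proof
      fix i
      obtain c where "coeff p (Suc i) = to_ac c" using pq(1) by (auto simp: poly_rel_def r_def)
      then have "coeff (pderiv p) i = to_ac (of_nat (Suc i) * c)" by (simp add: coeff_pderiv)
      then show "(coeff (pderiv p) i, coeff (pderiv p) i) \<in> r"
        unfolding r_def by (intro range_eqI[of _ _ "of_nat (Suc i) * c"]) (simp only: Pair_inject)
    qed
    moreover have "pderiv p \<noteq> 0" "degree (pderiv p) < degree p"
      using dg by (simp_all add: pderiv_eq_0_iff degree_pderiv)
    ultimately have False using min by (meson linorder_not_less)
    then show ?thesis ..
  qed
qed

subsection \<open>Equivariant integral weights\<close>

lemma additive_of_int:
  fixes \<sigma> :: "'k::ring_1 \<Rightarrow> 'k"
  assumes add: "\<And>x y. \<sigma> (x + y) = \<sigma> x + \<sigma> y"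
  shows "\<sigma> (of_int z * x) = of_int z * \<sigma> x"
proof -
  have 0: "\<sigma> 0 = 0" using add[of 0 0] by simp
  have neg: "\<sigma> (- x) = - \<sigma> x" for x using add[of x "- x"] 0 by (simp add: eq_neg_iff_add_eq_0 add.commute)
  have nat: "\<sigma> (of_nat n * x) = of_nat n * \<sigma> x" for n x
    by (induction n) (auto simp: 0 add distrib_right)
  show ?thesis
    by (cases z rule: int_cases2) (simp_all add: nat neg)
qed

text \<open>These are coordinates with respect to a basis \<open>B\<close> of the rational span of
  \<open>A\<close>, chosen inside \<open>A\<close> and multiplied by a common denominator
  \<open>N\<close>; they are zero at elements outside \<open>B\<close>.\<close>

lemma integral_coordinates:
  fixes A :: "'k::field_char_0 set"
  assumes A: "finite A"
  obtains N :: nat and m :: "'k \<Rightarrow> 'k \<Rightarrow> int" where "N > 0"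
    and "\<forall>l\<in>A. \<forall>u\<in>A. l + u \<in> A \<longrightarrow> (\<forall>a. m (l + u) a = m l a + m u a)"
    and "\<forall>l\<in>A. (\<Sum>a\<in>A. of_int (m l a) * a) = of_nat N * l"
proof -
  interpret Q: vector_space "\<lambda>q x. of_rat q * x :: 'k"
    by standard (auto simp: algebra_simps of_rat_add of_rat_mult)
  obtain B where B: "B \<subseteq> A" "\<not> Q.dependent B" "A \<subseteq> Q.span B"
    using Q.maximal_independent_subset[of A] by metis
  have finB: "finite B" using B A finite_subset by blast
  define r where "r = Q.representation B"
  define N where "N = (\<Prod>l\<in>A. \<Prod>b\<in>B. snd (quotient_of (r l b)))"
  have den: "snd (quotient_of q) > 0" for q using quotient_of_denom_pos' .
  have N: "N > 0" unfolding N_def by (intro prod_pos den ballI)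
  have int: "\<exists>z. rat_of_int z = rat_of_int N * r l b" if "l \<in> A" "b \<in> B" for l b
  proof -
    have "snd (quotient_of (r l b)) dvd N"
      unfolding N_def using that A finB by (meson dvd_prodI dvd_trans)
    then obtain k where k: "N = k * snd (quotient_of (r l b))" by (metis dvdE mult.commute)
    have "r l b = rat_of_int (fst (quotient_of (r l b))) / rat_of_int (snd (quotient_of (r l b)))"
      by (rule quotient_of_div) simp
    then have "rat_of_int N * r l b = rat_of_int (k * fst (quotient_of (r l b)))"
      using den[of "r l b"] by (subst k) (simp add: field_simps)
    then show ?thesis by metis
  qed
  \<comment> \<open>The floor only changes the type: on \<open>A\<close> and \<open>B\<close> the
    argument is already an integer.\<close>
  define m where "m l a = (if a \<in> B then \<lfloor>rat_of_int N * r l a\<rfloor> else 0)" for l a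
  have m: "rat_of_int (m l b) = rat_of_int N * r l b" if "l \<in> A" "b \<in> B" for l b
    using int[OF that] that(2) unfolding m_def by (metis floor_of_int)
  show ?thesis
  proof (rule that[of "nat N" m])
    show "nat N > 0" using N by simp
  next
    show "\<forall>l\<in>A. \<forall>u\<in>A. l + u \<in> A \<longrightarrow> (\<forall>a. m (l + u) a = m l a + m u a)"
    proof (intro ballI impI allI)
      fix l u a assume l: "l \<in> A" "u \<in> A" "l + u \<in> A"
      show "m (l + u) a = m l a + m u a"
      proof (cases "a \<in> B")
        case True
        have "r (l + u) = (\<lambda>b. r l b + r u b)"
          unfolding r_def using B(2,3) l by (intro Q.representation_add) auto
        then have "rat_of_int (m (l + u) a) = rat_of_int (m l a + m u a)"
          using m[OF _ True] l by (simp add: distrib_left)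
        then show ?thesis by (simp only: of_int_eq_iff)
      qed (simp add: m_def)
    qed
  next
    show "\<forall>l\<in>A. (\<Sum>a\<in>A. of_int (m l a) * a) = of_nat (nat N) * l"
    proof
      fix l assume l: "l \<in> A"
      have "(\<Sum>a\<in>A. of_int (m l a) * a) = (\<Sum>a\<in>B. of_int (m l a) * a)"
        using B(1) A by (intro sum.mono_neutral_right) (auto simp: m_def)
      also have "\<dots> = (\<Sum>a\<in>B. of_rat (rat_of_int N * r l a) * a)"
        using m[OF l] by (intro sum.cong refl) (metis of_rat_of_int_eq)
      also have "\<dots> = of_int N * (\<Sum>a\<in>B. of_rat (r l a) * a)"
        by (simp add: sum_distrib_left of_rat_mult mult.assoc)
      also have "(\<Sum>a\<in>B. of_rat (r l a) * a) = l"
        unfolding r_def using B l by (intro Q.sum_representation_eq finB) auto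
      finally show "(\<Sum>a\<in>A. of_int (m l a) * a) = of_nat (nat N) * l" using N by simp
    qed
  qed
qed

text \<open>The coordinates are made equivariant by averaging over the finite set of permutations of A
  induced by G; the shift by C makes them nonnegative.\<close>

lemma equivariant_weights:
  fixes A :: "'k::field_char_0 set" and G :: "('k \<Rightarrow> 'k) set"
  assumes A: "finite A" and ne: "G \<noteq> {}"
    and add: "\<And>\<sigma> x y. \<sigma> \<in> G \<Longrightarrow> \<sigma> (x + y) = \<sigma> x + \<sigma> y"
    and inj: "\<And>\<sigma>. \<sigma> \<in> G \<Longrightarrow> inj \<sigma>"
    and GA: "\<And>\<sigma> x. \<sigma> \<in> G \<Longrightarrow> x \<in> A \<Longrightarrow> \<sigma> x \<in> A"
    and comp: "\<And>\<sigma> \<tau>. \<sigma> \<in> G \<Longrightarrow> \<tau> \<in> G \<Longrightarrow> \<sigma> \<circ> \<tau> \<in> G"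
  obtains N C :: nat and n :: "'k \<Rightarrow> 'k \<Rightarrow> nat" where "N > 0"
    and "\<forall>l\<in>A. \<forall>u\<in>A. l + u \<in> A \<longrightarrow> (\<forall>a\<in>A. n l a + n u a = C + n (l + u) a)"
    and "\<forall>l\<in>A. (\<Sum>a\<in>A. of_nat (n l a) * a) = of_nat C * \<Sum>A + of_nat N * l"
    and "\<forall>\<sigma>\<in>G. \<forall>l\<in>A. \<forall>a\<in>A. n (\<sigma> l) (\<sigma> a) = n l a"
proof -
  obtain N0 :: nat and m0 :: "'k \<Rightarrow> 'k \<Rightarrow> int" where N0: "N0 > 0"
    and m0_add: "\<forall>l\<in>A. \<forall>u\<in>A. l + u \<in> A \<longrightarrow> (\<forall>a. m0 (l + u) a = m0 l a + m0 u a)"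
    and m0_sum: "\<forall>l\<in>A. (\<Sum>a\<in>A. of_int (m0 l a) * a) = of_nat N0 * l"
    by (rule integral_coordinates[OF A])
  have surj: "\<sigma> ` A = A" if "\<sigma> \<in> G" for \<sigma>
    using that inj GA A by (intro endo_inj_surj) (auto intro: inj_on_subset)
  \<comment> \<open>Restricting to \<open>A\<close> leaves finitely many maps even when
    \<open>G\<close> is infinite, so the average is a finite sum.\<close>
  define P where "P = (\<lambda>\<sigma>. restrict \<sigma> A) ` G"
  have "P \<subseteq> A \<rightarrow>\<^sub>E A" using GA by (auto simp: P_def)
  then have finP: "finite P" using A finite_PiE[of A "\<lambda>_. A"] finite_subset by blast
  define m where "m l a = (\<Sum>\<pi>\<in>P. m0 (\<pi> l) (\<pi> a))" for l a
  define N where "N = card P * N0"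
  have N: "N > 0" using N0 finP ne by (auto simp: N_def P_def card_gt_0_iff)
  have m_add: "m (l + u) a = m l a + m u a" if "l \<in> A" "u \<in> A" "l + u \<in> A" for l u a
  proof -
    have "m0 (\<pi> (l + u)) (\<pi> a) = m0 (\<pi> l) (\<pi> a) + m0 (\<pi> u) (\<pi> a)" if "\<pi> \<in> P" for \<pi>
    proof -
      from that obtain \<sigma> where \<sigma>: "\<sigma> \<in> G" "\<pi> = restrict \<sigma> A" by (auto simp: P_def)
      have "\<pi> (l + u) = \<pi> l + \<pi> u"
        using \<open>l \<in> A\<close> \<open>u \<in> A\<close> \<open>l + u \<in> A\<close> add[OF \<sigma>(1)] by (simp add: \<sigma>(2))
      moreover have "\<pi> x \<in> A" if "x \<in> A" for x using that GA[OF \<sigma>(1)] by (simp add: \<sigma>(2))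
      ultimately show ?thesis
        using m0_add \<open>l \<in> A\<close> \<open>u \<in> A\<close> \<open>l + u \<in> A\<close> by metis
    qed
    then show ?thesis by (simp add: m_def sum.distrib)
  qed
  have m_equi: "m (\<sigma> l) (\<sigma> a) = m l a" if \<sigma>: "\<sigma> \<in> G" and "l \<in> A" "a \<in> A" for \<sigma> l a
  proof -
    \<comment> \<open>Precomposition with \<sigma> permutes \<open>P\<close>; it is injective
      because \<sigma> maps \<open>A\<close> onto \<open>A\<close>. This reindexes the
      average.\<close>
    define \<phi> where "\<phi> \<pi> = restrict (\<pi> \<circ> \<sigma>) A" for \<pi> :: "'k \<Rightarrow> 'k"
    have "\<phi> ` P \<subseteq> P"
    proof clarify
      fix \<pi> assume "\<pi> \<in> P"
      then obtain \<tau> where \<tau>: "\<tau> \<in> G" "\<pi> = restrict \<tau> A" by (auto simp: P_def)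
      then have "\<phi> \<pi> = restrict (\<tau> \<circ> \<sigma>) A" using GA[OF \<sigma>] by (auto simp: \<phi>_def)
      then show "\<phi> \<pi> \<in> P" using comp[OF \<tau>(1) \<sigma>] by (auto simp: P_def)
    qed
    moreover have "inj_on \<phi> P"
    proof (rule inj_onI)
      fix \<pi> \<rho> assume *: "\<pi> \<in> P" "\<rho> \<in> P" "\<phi> \<pi> = \<phi> \<rho>"
      have "\<pi> (\<sigma> x) = \<rho> (\<sigma> x)" if "x \<in> A" for x
        using fun_cong[OF *(3), of x] that by (simp add: \<phi>_def)
      then have "\<pi> x = \<rho> x" if "x \<in> A" for x using surj[OF \<sigma>] that by (metis imageE)
      then show "\<pi> = \<rho>" using *(1,2) by (auto simp: P_def restrict_def fun_eq_iff)
    qed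
    ultimately have bij: "bij_betw \<phi> P P"
      using finP by (simp add: bij_betw_def endo_inj_surj)
    have "m l a = (\<Sum>\<pi>\<in>P. m0 (\<phi> \<pi> l) (\<phi> \<pi> a))"
      unfolding m_def by (rule sum.reindex_bij_betw[OF bij, symmetric])
    also have "\<dots> = m (\<sigma> l) (\<sigma> a)" using that by (simp add: m_def \<phi>_def)
    finally show ?thesis ..
  qed
  have m_sum: "(\<Sum>a\<in>A. of_int (m l a) * a) = of_nat N * l" if l: "l \<in> A" for l
  proof -
    have "(\<Sum>a\<in>A. of_int (m0 (\<pi> l) (\<pi> a)) * a) = of_nat N0 * l" if "\<pi> \<in> P" for \<pi>
    proof -
      from that obtain \<sigma> where \<sigma>: "\<sigma> \<in> G" "\<pi> = restrict \<sigma> A" by (auto simp: P_def)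
      note lin = additive_of_int[of \<sigma>, OF add[OF \<sigma>(1)]]
      have sum: "\<sigma> (sum f S) = (\<Sum>x\<in>S. \<sigma> (f x))" if "finite S" for f :: "'k \<Rightarrow> 'k" and S
        using that lin[of 0 0] by (induction S) (auto simp: add[OF \<sigma>(1)])
      \<comment> \<open>Applying \<sigma> to the sum turns it into the known sum for \<sigma> l, and
        injectivity takes \<sigma> away again.\<close>
      have "\<sigma> (\<Sum>a\<in>A. of_int (m0 (\<pi> l) (\<pi> a)) * a) = (\<Sum>a\<in>A. of_int (m0 (\<sigma> l) (\<sigma> a)) * \<sigma> a)"
        using l A by (simp add: sum lin \<sigma>(2))
      also have "\<dots> = (\<Sum>b\<in>\<sigma> ` A. of_int (m0 (\<sigma> l) b) * b)"
        using inj[OF \<sigma>(1)] by (subst sum.reindex) (auto intro: inj_on_subset)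
      also have "\<dots> = of_nat N0 * \<sigma> l" using m0_sum GA[OF \<sigma>(1) l] surj[OF \<sigma>(1)] by simp
      also have "\<dots> = \<sigma> (of_nat N0 * l)" using lin[of "int N0" l] by simp
      finally show ?thesis using inj[OF \<sigma>(1)] by (simp add: inj_eq)
    qed
    then have "(\<Sum>\<pi>\<in>P. \<Sum>a\<in>A. of_int (m0 (\<pi> l) (\<pi> a)) * a) = of_nat N * l"
      by (simp add: N_def)
    then show ?thesis
      by (subst (asm) sum.swap) (simp add: m_def sum_distrib_right)
  qed
  define C where "C = (\<Sum>l\<in>A. \<Sum>a\<in>A. nat \<bar>m l a\<bar>)"
  have C: "\<bar>m l a\<bar> \<le> int C" if "l \<in> A" "a \<in> A" for l a
  proof -
    have "nat \<bar>m l a\<bar> \<le> (\<Sum>a\<in>A. nat \<bar>m l a\<bar>)" using that A by (intro member_le_sum) auto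
    also have "\<dots> \<le> C" unfolding C_def using that(1) A
      by (intro member_le_sum[of l A "\<lambda>l. \<Sum>a\<in>A. nat \<bar>m l a\<bar>"]) auto
    finally show ?thesis by linarith
  qed
  define n where "n l a = nat (m l a + int C)" for l a
  have n: "int (n l a) = m l a + int C" if "l \<in> A" "a \<in> A" for l a
    using C[OF that] by (simp add: n_def)
  show ?thesis
  proof (rule that[OF N, of n C]; intro ballI impI)
    fix l u a assume "l \<in> A" "u \<in> A" "l + u \<in> A" "a \<in> A"
    then have "int (n l a + n u a) = int (C + n (l + u) a)" using m_add by (simp add: n)
    then show "n l a + n u a = C + n (l + u) a" by linarith
  next
    fix l assume l: "l \<in> A"
    have "of_nat (n l a) = (of_int (m l a) + of_nat C :: 'k)" if "a \<in> A" for a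
      using n[OF l that] by (metis of_int_add of_int_of_nat_eq)
    then have "(\<Sum>a\<in>A. of_nat (n l a) * a) = (\<Sum>a\<in>A. (of_int (m l a) + of_nat C) * a)"
      by (intro sum.cong) auto
    also have "\<dots> = of_nat C * \<Sum>A + of_nat N * l"
      using m_sum[OF l] by (simp add: distrib_right sum.distrib sum_distrib_left)
    finally show "(\<Sum>a\<in>A. of_nat (n l a) * a) = of_nat C * \<Sum>A + of_nat N * l" .
  next
    fix \<sigma> l a assume "\<sigma> \<in> G" "l \<in> A" "a \<in> A"
    then show "n (\<sigma> l) (\<sigma> a) = n l a" by (simp add: n_def m_equi)
  qed
qed

subsection \<open>Interpolation\<close>

lemma prod_linear_power_dvd:
  fixes p :: "'k::field poly"
  assumes "finite A" and "\<And>a. a \<in> A \<Longrightarrow> [:-a, 1:] ^ k dvd p"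
  shows "(\<Prod>a\<in>A. [:-a, 1:] ^ k) dvd p"
  using assms
proof (induction A)
  case (insert a A)
  then obtain q where q: "p = (\<Prod>a\<in>A. [:-a, 1:] ^ k) * q" by (auto elim: dvdE)
  have nz: "poly (\<Prod>a\<in>A. [:-a, 1:] ^ k) a \<noteq> 0" using insert.hyps by (auto simp: poly_prod)
  have "[:-a, 1:] ^ k dvd q"
  proof (cases "q = 0")
    case False
    then have "p \<noteq> 0" unfolding q using nz by (metis mult_eq_0_iff poly_0)
    then have "k \<le> order a p" using insert.prems[of a] by (simp add: order_divides)
    also have "order a p = order a q"
      using \<open>p \<noteq> 0\<close> nz unfolding q by (subst order_mult) (auto simp: order_0I)
    finally show ?thesis by (simp add: order_divides)
  qed simp
  then show ?case using insert.hyps q by (auto simp: mult.commute intro: mult_dvd_mono)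
qed simp

text \<open>Idempotents modulo the k-th powers of the linear factors. The closed form makes their
  equivariance under automorphisms permuting A evident.\<close>

definition idem :: "'k::field set \<Rightarrow> nat \<Rightarrow> 'k \<Rightarrow> 'k poly" where
  "idem A k l = 1 - (1 - (\<Prod>u\<in>A - {l}. smult (1 / (l - u)) [:-u, 1:]) ^ k) ^ k"

text \<open>For finite \<open>A\<close> the product in \<open>idem\<close> is the Lagrange
  polynomial of \<open>l\<close>, with value 1 at \<open>l\<close> and 0 at the rest of
  \<open>A\<close>. The outer power gives the congruence at \<open>l\<close>, the inner one those at
  the other points.\<close>

lemma idem_same: "[:-l, 1:] ^ k dvd idem A k l - 1"
proof -
  let ?p = "(\<Prod>u\<in>A - {l}. smult (1 / (l - u)) [:-u, 1:]) ^ k"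
  have "poly (smult (1 / (l - u)) [:-u, 1:]) l = 1" if "u \<in> A - {l}" for u
    using that by (auto simp flip: diff_divide_distrib)
  then have "poly ?p l = 1" by (simp add: poly_prod poly_power del: smult_pCons)
  then have "[:-l, 1:] dvd 1 - ?p" by (simp add: poly_eq_0_iff_dvd[symmetric])
  then have "[:-l, 1:] ^ k dvd (1 - ?p) ^ k" by (rule dvd_power_same)
  then show ?thesis unfolding idem_def by (simp add: dvd_minus_iff)
qed

lemma idem_other:
  assumes "finite A" "u \<in> A" "u \<noteq> l"
  shows "[:-u, 1:] ^ k dvd idem A k l"
proof -
  let ?q = "\<Prod>u\<in>A - {l}. smult (1 / (l - u)) [:-u, 1:]"
  have "smult (1 / (l - u)) [:-u, 1:] dvd ?q" using assms by (intro dvd_prodI) auto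
  then have "[:-u, 1:] dvd ?q" by (rule smult_dvd_cancel)
  then have "[:-u, 1:] ^ k dvd ?q ^ k" by (rule dvd_power_same)
  also have "?q ^ k dvd 1 - (1 - ?q ^ k) ^ k"
  proof -
    have "1 - (1 - ?q ^ k) dvd 1 ^ k - (1 - ?q ^ k) ^ k"
      using power_diff_sumr2[of 1 k "1 - ?q ^ k"] by simp
    then show ?thesis by simp
  qed
  finally show ?thesis by (simp add: idem_def)
qed

text \<open>An explicit Chinese remainder theorem: modulo the k-th power of x - l the idempotent of
  \<open>l\<close> is 1 and all others vanish.\<close>

lemma interpolation:
  assumes "finite A" "l \<in> A"
  shows "[:-l, 1:] ^ k dvd (\<Sum>u\<in>A. idem A k u * H u) - H l"
proof -
  have "(\<Sum>u\<in>A. idem A k u * H u) - H l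
      = (idem A k l - 1) * H l + (\<Sum>u\<in>A - {l}. idem A k u * H u)"
    using assms by (subst sum.remove[of A l]) (auto simp: left_diff_distrib)
  moreover have "[:-l, 1:] ^ k dvd (\<Sum>u\<in>A - {l}. idem A k u * H u)"
    using assms by (intro dvd_sum dvd_mult2 idem_other) auto
  ultimately show ?thesis using dvd_add[OF dvd_mult2[OF idem_same]] by simp
qed

lemma idem_sum:
  assumes "finite A"
  shows "(\<Prod>a\<in>A. [:-a, 1:] ^ k) dvd (\<Sum>u\<in>A. idem A k u) - 1"
  using assms interpolation[OF assms, of _ k "\<lambda>_. 1"] by (intro prod_linear_power_dvd) auto

lemma idem_mult:
  assumes "finite A" "l \<in> A"
  shows "(\<Prod>a\<in>A. [:-a, 1:] ^ k) dvd idem A k l * [:-l, 1:] ^ k"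
proof (rule prod_linear_power_dvd[OF assms(1)])
  show "[:-a, 1:] ^ k dvd idem A k l * [:-l, 1:] ^ k" if "a \<in> A" for a
    using idem_other[OF assms(1) that, of l k] by (cases "a = l") auto
qed

subsection \<open>Equivariance\<close>

definition field_hom :: "('k::field \<Rightarrow> 'k) \<Rightarrow> bool" where
  "field_hom \<sigma> \<longleftrightarrow> (\<forall>x y. \<sigma> (x + y) = \<sigma> x + \<sigma> y) \<and> (\<forall>x y. \<sigma> (x * y) = \<sigma> x * \<sigma> y) \<and> \<sigma> 1 = 1"

lemma field_homD:
  assumes "field_hom \<sigma>"
  shows "\<sigma> (x + y) = \<sigma> x + \<sigma> y" "\<sigma> (x * y) = \<sigma> x * \<sigma> y" "\<sigma> 1 = 1" "\<sigma> 0 = 0"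
    "\<sigma> (- x) = - \<sigma> x" "\<sigma> (x - y) = \<sigma> x - \<sigma> y" "\<sigma> (x ^ n) = \<sigma> x ^ n" "\<sigma> (of_nat n) = of_nat n"
    "\<sigma> (x / y) = \<sigma> x / \<sigma> y" "inj \<sigma>" "\<sigma> (prod f S) = (\<Prod>i\<in>S. \<sigma> (f i))" "\<sigma> (sum f S) = (\<Sum>i\<in>S. \<sigma> (f i))"
proof -
  note h = assms[unfolded field_hom_def]
  have add: "\<sigma> (x + y) = \<sigma> x + \<sigma> y" and mult: "\<sigma> (x * y) = \<sigma> x * \<sigma> y" and one: "\<sigma> 1 = 1" for x y
    using h by blast+
  have 0: "\<sigma> 0 = 0" using add[of 0 0] by (metis add.right_neutral add_left_cancel)
  have neg: "\<sigma> (- x) = - \<sigma> x" for x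
    using add[of x "- x"] 0 by (simp add: eq_neg_iff_add_eq_0 add.commute)
  have diff: "\<sigma> (x - y) = \<sigma> x - \<sigma> y" for x y using add[of x "- y"] neg by simp
  have nz: "\<sigma> x \<noteq> 0" if "x \<noteq> 0" for x
    using mult[of x "inverse x"] that one by auto
  show "\<sigma> (x + y) = \<sigma> x + \<sigma> y" "\<sigma> (x * y) = \<sigma> x * \<sigma> y" "\<sigma> 1 = 1" "\<sigma> 0 = 0"
    "\<sigma> (- x) = - \<sigma> x" "\<sigma> (x - y) = \<sigma> x - \<sigma> y"
    using add mult one 0 neg diff by blast+
  show "\<sigma> (x ^ n) = \<sigma> x ^ n" by (induction n) (auto simp: one mult)
  show "\<sigma> (of_nat n) = of_nat n" by (induction n) (auto simp: 0 one add)
  show "\<sigma> (x / y) = \<sigma> x / \<sigma> y"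
  proof (cases "y = 0")
    case False
    then have "\<sigma> (x / y) * \<sigma> y = \<sigma> x" using mult[of "x / y" y] by simp
    then show ?thesis using nz[OF False] by (simp add: field_simps)
  qed (simp add: 0)
  show "inj \<sigma>" by (rule injI) (metis diff nz right_minus_eq)
  show "\<sigma> (prod f S) = (\<Prod>i\<in>S. \<sigma> (f i))"
    by (induction S rule: infinite_finite_induct) (auto simp: one mult)
  show "\<sigma> (sum f S) = (\<Sum>i\<in>S. \<sigma> (f i))"
    by (induction S rule: infinite_finite_induct) (auto simp: 0 add)
qed

lemma field_hom_map_poly:
  assumes s: "field_hom \<sigma>"
  shows "map_poly \<sigma> (p + q) = map_poly \<sigma> p + map_poly \<sigma> q"
    and "map_poly \<sigma> (p - q) = map_poly \<sigma> p - map_poly \<sigma> q"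
    and "map_poly \<sigma> (p * q) = map_poly \<sigma> p * map_poly \<sigma> q"
    and "map_poly \<sigma> 1 = 1"
    and "map_poly \<sigma> (p ^ n) = map_poly \<sigma> p ^ n"
    and "map_poly \<sigma> (smult c p) = smult (\<sigma> c) (map_poly \<sigma> p)"
    and "map_poly \<sigma> [:a, b:] = [:\<sigma> a, \<sigma> b:]"
    and "map_poly \<sigma> (prod f S) = (\<Prod>i\<in>S. map_poly \<sigma> (f i))"
    and "map_poly \<sigma> (sum f S) = (\<Sum>i\<in>S. map_poly \<sigma> (f i))"
proof -
  note h = field_homD[OF s]
  have add: "map_poly \<sigma> (p + q) = map_poly \<sigma> p + map_poly \<sigma> q" for p q
    by (simp add: poly_eq_iff coeff_map_poly h)
  have mult: "map_poly \<sigma> (p * q) = map_poly \<sigma> p * map_poly \<sigma> q" for p q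
    by (simp add: poly_eq_iff coeff_map_poly coeff_mult h)
  have one: "map_poly \<sigma> 1 = 1" by (simp add: h)
  show "map_poly \<sigma> (p + q) = map_poly \<sigma> p + map_poly \<sigma> q"
    "map_poly \<sigma> (p - q) = map_poly \<sigma> p - map_poly \<sigma> q"
    "map_poly \<sigma> (p * q) = map_poly \<sigma> p * map_poly \<sigma> q"
    "map_poly \<sigma> (smult c p) = smult (\<sigma> c) (map_poly \<sigma> p)"
    "map_poly \<sigma> [:a, b:] = [:\<sigma> a, \<sigma> b:]" "map_poly \<sigma> 1 = 1"
    by (simp_all add: poly_eq_iff coeff_map_poly coeff_mult h add mult coeff_pCons split: nat.split)
  show "map_poly \<sigma> (p ^ n) = map_poly \<sigma> p ^ n" by (induction n) (auto simp: one mult)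
  show "map_poly \<sigma> (prod f S) = (\<Prod>i\<in>S. map_poly \<sigma> (f i))"
    by (induction S rule: infinite_finite_induct) (auto simp: one mult)
  show "map_poly \<sigma> (sum f S) = (\<Sum>i\<in>S. map_poly \<sigma> (f i))"
    by (induction S rule: infinite_finite_induct) (auto simp: add)
qed

lemma idem_equivariant:
  assumes s: "field_hom \<sigma>" and A: "\<sigma> ` A = A"
  shows "map_poly \<sigma> (idem A k l) = idem A k (\<sigma> l)"
proof -
  have inj: "inj \<sigma>" by (rule field_homD[OF s])
  have "A - {\<sigma> l} = \<sigma> ` (A - {l})" using A inj by (auto simp: inj_eq)
  then have "(\<Prod>u\<in>A - {\<sigma> l}. smult (1 / (\<sigma> l - u)) [:-u, 1:])
      = (\<Prod>u\<in>A - {l}. smult (1 / (\<sigma> l - \<sigma> u)) [:-\<sigma> u, 1:])"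
    using inj by (simp add: prod.reindex inj_on_subset)
  then show ?thesis
    by (simp add: idem_def field_hom_map_poly[OF s] field_homD[OF s])
qed

lemma interpolation_equivariant:
  assumes s: "field_hom \<sigma>" and A: "\<sigma> ` A = A"
    and H: "\<And>l. l \<in> A \<Longrightarrow> map_poly \<sigma> (H l) = H (\<sigma> l)"
  shows "map_poly \<sigma> (\<Sum>l\<in>A. idem A k l * H l) = (\<Sum>l\<in>A. idem A k l * H l)"
proof -
  have "map_poly \<sigma> (\<Sum>l\<in>A. idem A k l * H l) = (\<Sum>l\<in>A. idem A k (\<sigma> l) * H (\<sigma> l))"
    by (simp add: field_hom_map_poly[OF s] idem_equivariant[OF s A] H)
  also have "\<dots> = (\<Sum>l\<in>\<sigma> ` A. idem A k l * H l)"
    using field_homD(10)[OF s] by (simp add: sum.reindex inj_on_subset)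
  finally show ?thesis by (simp add: A)
qed

subsection \<open>Ideals in two variables\<close>

definition is_ideal :: "'r::comm_ring_1 set \<Rightarrow> bool" where
  "is_ideal J \<longleftrightarrow> 0 \<in> J \<and> (\<forall>x\<in>J. \<forall>y\<in>J. x + y \<in> J) \<and> (\<forall>x\<in>J. \<forall>r. r * x \<in> J)"

lemma is_idealD:
  assumes "is_ideal J"
  shows "0 \<in> J" "x \<in> J \<Longrightarrow> y \<in> J \<Longrightarrow> x + y \<in> J" "x \<in> J \<Longrightarrow> r * x \<in> J" "x \<in> J \<Longrightarrow> x * r \<in> J"
    "x \<in> J \<Longrightarrow> - x \<in> J" "x \<in> J \<Longrightarrow> y \<in> J \<Longrightarrow> x - y \<in> J" "x \<in> J \<Longrightarrow> x dvd y \<Longrightarrow> y \<in> J"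
    "(\<And>i. i \<in> S \<Longrightarrow> f i \<in> J) \<Longrightarrow> sum f S \<in> J"
proof -
  have 0: "0 \<in> J" and add: "x \<in> J \<Longrightarrow> y \<in> J \<Longrightarrow> x + y \<in> J" and mult: "x \<in> J \<Longrightarrow> r * x \<in> J" for x y r
    using assms unfolding is_ideal_def by blast+
  have neg: "x \<in> J \<Longrightarrow> - x \<in> J" for x using mult[of x "-1"] by simp
  show "0 \<in> J" "x \<in> J \<Longrightarrow> y \<in> J \<Longrightarrow> x + y \<in> J" "x \<in> J \<Longrightarrow> r * x \<in> J" "x \<in> J \<Longrightarrow> - x \<in> J"
    using 0 add mult neg by blast+
  show "x \<in> J \<Longrightarrow> x * r \<in> J" using mult[of x r] by (simp add: mult.commute)
  show "x \<in> J \<Longrightarrow> y \<in> J \<Longrightarrow> x - y \<in> J" using add[of x "- y"] neg by simp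
  show "x \<in> J \<Longrightarrow> x dvd y \<Longrightarrow> y \<in> J" using mult by (auto simp: mult.commute elim!: dvdE)
  show "(\<And>i. i \<in> S \<Longrightarrow> f i \<in> J) \<Longrightarrow> sum f S \<in> J"
    by (induction S rule: infinite_finite_induct) (auto simp: 0 add)
qed

lemma is_ideal_adjoin:
  assumes J: "is_ideal J"
  shows "is_ideal {j + a * r | j r. j \<in> J}" (is "is_ideal ?I")
  unfolding is_ideal_def
proof (intro conjI ballI allI)
  have I: "j + a * r \<in> ?I" if "j \<in> J" for j r using that by blast
  show "0 \<in> ?I" using I[OF is_idealD(1)[OF J], of 0] by simp
  fix x assume "x \<in> ?I"
  then obtain j r where x: "x = j + a * r" "j \<in> J" by blast
  show "s * x \<in> ?I" for s
    using I[OF is_idealD(3)[OF J x(2), of s], of "s * r"] by (simp add: x algebra_simps)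
  fix y assume "y \<in> ?I"
  then obtain j' r' where y: "y = j' + a * r'" "j' \<in> J" by blast
  show "x + y \<in> ?I"
    using I[OF is_idealD(2)[OF J x(2) y(2)], of "r + r'"] by (simp add: x y algebra_simps)
qed

lemma is_ideal_nilpotent_add:
  assumes J: "is_ideal J" and "x ^ k \<in> J" "y ^ l \<in> J"
  shows "(x + y) ^ (k + l) \<in> J"
proof -
  have "of_nat (k + l choose i) * x ^ i * y ^ (k + l - i) \<in> J" if "i \<le> k + l" for i
  proof (cases "k \<le> i")
    case True
    then have "x ^ i \<in> J" using is_idealD(7)[OF J assms(2)] by (simp add: le_imp_power_dvd)
    then show ?thesis using is_idealD(3,4)[OF J] by (metis mult.assoc)
  next
    case False
    then have "l \<le> k + l - i" by simp
    then have "y ^ (k + l - i) \<in> J" using is_idealD(7)[OF J assms(3)] by (simp add: le_imp_power_dvd)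
    then show ?thesis using is_idealD(3)[OF J] by simp
  qed
  then show ?thesis unfolding binomial_ring by (intro is_idealD(8)[OF J]) auto
qed

section \<open>Evaluating one-variable polynomials in the two-variable ring, and localisation
  there\<close>

definition cst :: "'k::comm_ring_1 \<Rightarrow> 'k poly poly" where
  "cst c = [:[:c:]:]"

text \<open>The value p(x) in the two-variable ring. It is used at X, Y and X + Y, which later stand
  for a derivation acting on the left factor, the right factor and the whole of a product.\<close>

definition ev :: "'k::comm_ring_1 poly poly \<Rightarrow> 'k poly \<Rightarrow> 'k poly poly" where
  "ev x p = poly (map_poly cst p) x"

lemma cst_simps:
  "cst 0 = 0" "cst 1 = 1" "cst (a + b) = cst a + cst b" "cst (a * b) = cst a * cst b"
  "cst (- a) = - cst a" "cst (a - b) = cst a - cst b"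
  by (simp_all add: cst_def one_pCons)

lemma ev_pCons: "ev x (pCons c p) = cst c + x * ev x p"
  by (simp add: ev_def map_poly_pCons cst_simps)

lemma ev_0: "ev x 0 = 0"
  by (simp add: ev_def)

lemma ev_add: "ev x (p + q) = ev x p + ev x q"
proof -
  have "map_poly cst (p + q) = map_poly cst p + map_poly cst q"
    by (simp add: poly_eq_iff[of "map_poly cst (p + q)"] coeff_map_poly cst_simps)
  then show ?thesis by (simp add: ev_def)
qed

lemma ev_smult: "ev x (smult c p) = cst c * ev x p"
  by (induction p) (auto simp: ev_pCons ev_0 cst_simps algebra_simps)

lemma ev_mult: "ev x (p * q) = ev x p * ev x q"
  by (induction p) (auto simp: ev_pCons ev_0 ev_add ev_smult cst_simps algebra_simps)

lemma ev_1: "ev x 1 = 1"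
  by (simp add: one_pCons ev_pCons ev_0 cst_simps)

lemma ev_diff: "ev x (p - q) = ev x p - ev x q"
  using ev_add[of x "p - q" q] by (simp add: algebra_simps)

lemma ev_power: "ev x (p ^ n) = ev x p ^ n"
  by (induction n) (auto simp: ev_1 ev_mult)

lemma ev_sum: "ev x (sum f S) = (\<Sum>i\<in>S. ev x (f i))"
  by (induction S rule: infinite_finite_induct) (auto simp: ev_0 ev_add)

lemma ev_dvd: "p dvd q \<Longrightarrow> ev x p dvd ev x q"
  by (auto simp: ev_mult elim!: dvdE)

text \<open>Modulo \<open>J\<close> the idempotents \<open>idem A k a\<close>, evaluated at
  \<open>x\<close>, sum to 1, and each is annihilated by the k-th power of x - a. So membership in
  \<open>J\<close> may be tested after adjoining one such power.\<close>

lemma ideal_local: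
  fixes G :: "'k::field poly poly"
  assumes A: "finite A" and J: "is_ideal J" and P: "ev x (\<Prod>a\<in>A. [:-a, 1:] ^ k) \<in> J"
    and loc: "\<And>a I. a \<in> A \<Longrightarrow> is_ideal I \<Longrightarrow> J \<subseteq> I \<Longrightarrow> ev x ([:-a, 1:] ^ k) \<in> I \<Longrightarrow> G \<in> I"
  shows "G \<in> J"
proof -
  let ?P = "\<Prod>a\<in>A. [:-a, 1:] ^ k"
  have "ev x (idem A k a) * G \<in> J" if a: "a \<in> A" for a
  proof -
    let ?I = "{j + ev x ([:-a, 1:] ^ k) * r | j r. j \<in> J}"
    have "G \<in> ?I"
    proof (rule loc[OF a is_ideal_adjoin[OF J]])
      show "J \<subseteq> ?I"
      proof
        fix j assume "j \<in> J"
        then show "j \<in> ?I" by (intro CollectI exI[of _ j] exI[of _ 0]) simp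
      qed
      show "ev x ([:-a, 1:] ^ k) \<in> ?I"
        by (intro CollectI exI[of _ 0] exI[of _ 1]) (simp add: is_idealD(1)[OF J])
    qed
    then obtain j r where j: "j \<in> J" "G = j + ev x ([:-a, 1:] ^ k) * r" by blast
    have "ev x (idem A k a * [:-a, 1:] ^ k) \<in> J"
      using is_idealD(7)[OF J P] ev_dvd[OF idem_mult[OF A a]] by blast
    then show ?thesis unfolding j(2) distrib_left
      using is_idealD(2,3,4)[OF J] j(1) by (simp add: ev_mult mult.assoc[symmetric])
  qed
  then have "(\<Sum>a\<in>A. ev x (idem A k a) * G) \<in> J" by (intro is_idealD(8)[OF J])
  moreover have "ev x ((\<Sum>a\<in>A. idem A k a) - 1) * G \<in> J"
    using is_idealD(4,7)[OF J] P ev_dvd[OF idem_sum[OF A]] by blast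
  ultimately have "(\<Sum>a\<in>A. ev x (idem A k a) * G) - ev x ((\<Sum>a\<in>A. idem A k a) - 1) * G \<in> J"
    by (rule is_idealD(6)[OF J])
  also have "(\<Sum>a\<in>A. ev x (idem A k a) * G) - ev x ((\<Sum>a\<in>A. idem A k a) - 1) * G = G"
    by (simp add: ev_diff ev_sum ev_1 left_diff_distrib sum_distrib_right)
  finally show ?thesis .
qed

text \<open>Eigenvalues add: after localising \<open>x\<close>, \<open>y\<close> and
  \<open>x + y\<close> at a, b and d, only the case d = a + b is left to check, because every other
  combination produces the unit ideal.\<close>

lemma ideal_local_sum:
  fixes G :: "'k::field poly poly"
  assumes fin: "finite A" "finite B" "finite D" and J: "is_ideal J"
    and P: "ev x (\<Prod>a\<in>A. [:-a, 1:] ^ k) \<in> J" "ev y (\<Prod>a\<in>B. [:-a, 1:] ^ k) \<in> J"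
      "ev (x + y) (\<Prod>a\<in>D. [:-a, 1:] ^ k) \<in> J"
    and loc: "\<And>a b I. a \<in> A \<Longrightarrow> b \<in> B \<Longrightarrow> a + b \<in> D \<Longrightarrow> is_ideal I \<Longrightarrow> J \<subseteq> I \<Longrightarrow> ev x [:-a, 1:] ^ k \<in> I
      \<Longrightarrow> ev y [:-b, 1:] ^ k \<in> I \<Longrightarrow> ev (x + y) [:-(a + b), 1:] ^ k \<in> I \<Longrightarrow> G \<in> I"
  shows "G \<in> J"
proof (rule ideal_local[OF fin(1) J P(1)])
  fix a I assume a: "a \<in> A" and I: "is_ideal I" "J \<subseteq> I" "ev x ([:-a, 1:] ^ k) \<in> I"
  show "G \<in> I"
  proof (rule ideal_local[OF fin(2) I(1)])
    show "ev y (\<Prod>a\<in>B. [:-a, 1:] ^ k) \<in> I" using I P by blast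
    fix b I' assume b: "b \<in> B" and I': "is_ideal I'" "I \<subseteq> I'" "ev y ([:-b, 1:] ^ k) \<in> I'"
    show "G \<in> I'"
    proof (rule ideal_local[OF fin(3) I'(1)])
      show "ev (x + y) (\<Prod>a\<in>D. [:-a, 1:] ^ k) \<in> I'" using I I' P by blast
      fix d K assume d: "d \<in> D" and K: "is_ideal K" "I' \<subseteq> K" "ev (x + y) ([:-d, 1:] ^ k) \<in> K"
      have ab: "ev x [:-a, 1:] ^ k \<in> K" "ev y [:-b, 1:] ^ k \<in> K"
        using I I' K by (auto simp: ev_power)
      show "G \<in> K"
      proof (cases "d = a + b")
        case True
        then show ?thesis using loc[OF a b _ K(1) _ ab] d I I' K by (auto simp: ev_power)
      next
        case False
        \<comment> \<open>This nonzero constant equals (x - a) + (y - b) - (x + y - d), a sum of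
          three elements nilpotent modulo \<open>K\<close>; hence \<open>K\<close> is the whole
          ring.\<close>
        let ?c = "d - (a + b)"
        have "(ev (x + y) [:-d, 1:]) ^ k \<in> K" using K by (simp add: ev_power)
        then have "(- ev (x + y) [:-d, 1:]) ^ k \<in> K"
          using is_idealD(3)[OF K(1), of _ "(-1) ^ k"] by (metis mult_minus1 power_mult_distrib)
        from is_ideal_nilpotent_add[OF K(1) is_ideal_nilpotent_add[OF K(1) ab] this]
        have "(ev x [:-a, 1:] + ev y [:-b, 1:] + - ev (x + y) [:-d, 1:]) ^ (k + k + k) \<in> K" .
        also have "ev x [:-a, 1:] + ev y [:-b, 1:] + - ev (x + y) [:-d, 1:] = cst ?c"
          by (simp add: ev_pCons ev_0 cst_simps)
        finally have *: "cst ?c ^ (k + k + k) \<in> K" .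
        have "cst (1 / ?c) * cst ?c = 1" using False by (simp add: cst_simps(2) flip: cst_simps(4))
        then have "(cst (1 / ?c) ^ (k + k + k)) * (cst ?c ^ (k + k + k)) = 1"
          by (simp add: power_mult_distrib[symmetric])
        then have "1 \<in> K" using is_idealD(3)[OF K(1) *, of "cst (1 / ?c) ^ (k + k + k)"] by simp
        then show ?thesis using is_idealD(3)[OF K(1), of 1 G] by simp
      qed
    qed
  qed
qed

subsection \<open>The one-parameter family\<close>

text \<open>No root has multiplicity above the degree, so a single exponent serves all
  roots.\<close>

lemma root_product_dvd:
  fixes p :: "'k::alg_closed_field poly"
  assumes "p \<noteq> 0"
  shows "p dvd (\<Prod>a | poly p a = 0. [:-a, 1:] ^ degree p)"
proof -
  let ?R = "{a. poly p a = 0}"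
  obtain M where M: "size M = degree p" "p = smult (lead_coeff p) (\<Prod>x\<in>#M. [:-x, 1:])"
    using alg_closed_imp_factorization[OF assms] by blast
  have fin: "finite ?R" using assms poly_roots_finite by blast
  have "(\<Prod>x\<in>#L. [:-x, 1:]) dvd (\<Prod>a\<in>?R. [:-a, 1:]) ^ size L" if "set_mset L \<subseteq> ?R" for L
    using that
  proof (induction L)
    case (add x L)
    then show ?case using fin
      by (auto intro!: mult_dvd_mono dvd_prodI simp del: mult_pCons_left)
  qed simp
  moreover have "set_mset M \<subseteq> ?R"
  proof
    fix x assume "x \<in># M"
    then have "[:-x, 1:] dvd (\<Prod>x\<in>#M. [:-x, 1:])" by (intro dvd_prod_mset) auto
    then have "[:-x, 1:] dvd p" using M(2) by (metis dvd_smult)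
    then show "x \<in> ?R" by (simp add: poly_eq_0_iff_dvd)
  qed
  ultimately have "(\<Prod>x\<in>#M. [:-x, 1:]) dvd (\<Prod>a\<in>?R. [:-a, 1:]) ^ degree p" using M(1) by metis
  then show ?thesis using assms M(2)
    by (metis leading_coeff_0_iff prod_power_distrib smult_dvd)
qed

text \<open>At each \<open>l\<close> the quotient z = q / q(l) is 1 up to a multiple of x - l, so 1
  - (1 - z)^k is a multiple of \<open>q\<close> congruent to 1; the resulting local inverses are
  glued by interpolation.\<close>

lemma local_unit:
  fixes q :: "'k::field poly"
  assumes A: "finite A" and q: "\<And>l. l \<in> A \<Longrightarrow> poly q l \<noteq> 0"
  obtains u where "(\<Prod>a\<in>A. [:-a, 1:] ^ k) dvd u * q - 1"
proof -
  have "\<exists>v. [:-l, 1:] ^ k dvd v * q - 1" if "l \<in> A" for l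
  proof -
    let ?z = "smult (1 / poly q l) q"
    have "poly (1 - ?z) l = 0" using q[OF that] by simp
    then have "[:-l, 1:] ^ k dvd (1 - ?z) ^ k"
      by (intro dvd_power_same) (simp only: poly_eq_0_iff_dvd)
    moreover have "1 - (1 - ?z) dvd 1 ^ k - (1 - ?z) ^ k"
      unfolding power_diff_sumr2 by (rule dvd_triv_left)
    then have "?z dvd 1 - (1 - ?z) ^ k" by simp
    then have "q dvd 1 - (1 - ?z) ^ k" by (rule smult_dvd_cancel)
    then obtain v where "1 - (1 - ?z) ^ k = v * q"
      by (metis dvdE mult.commute)
    then have "v * q - 1 = - ((1 - ?z) ^ k)" by (simp add: algebra_simps)
    ultimately have "[:-l, 1:] ^ k dvd v * q - 1" by (simp only: dvd_minus_iff)
    then show ?thesis ..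
  qed
  then obtain v where v: "\<And>l. l \<in> A \<Longrightarrow> [:-l, 1:] ^ k dvd v l * q - 1" by metis
  have "[:-l, 1:] ^ k dvd (\<Sum>u\<in>A. idem A k u * v u) * q - 1" if "l \<in> A" for l
  proof -
    have "(\<Sum>u\<in>A. idem A k u * v u) * q - 1
        = ((\<Sum>u\<in>A. idem A k u * v u) - v l) * q + (v l * q - 1)" by (simp add: algebra_simps)
    then show ?thesis
      using dvd_add[OF dvd_mult2[OF interpolation[OF A that, of k v], of q] v[OF that]] by argo
  qed
  then show ?thesis by (intro that prod_linear_power_dvd A)
qed

definition texp :: "nat \<Rightarrow> 'k::field_char_0 \<Rightarrow> 'k poly \<Rightarrow> 'k poly" where
  "texp M s p = (\<Sum>i<M. smult (s ^ i / fact i) (p ^ i))"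

text \<open>For equivariant weights as above this is multiplicative in \<open>l\<close> up to the
  factor \<Prod>a\<in>A. (1 + t a)^C, and to first order in \<open>t\<close> it is 1 + t (N l +
  const): a polynomial substitute for exp (t N l).\<close>

definition psi :: "'k::field set \<Rightarrow> ('k \<Rightarrow> 'k \<Rightarrow> nat) \<Rightarrow> 'k \<Rightarrow> 'k \<Rightarrow> 'k" where
  "psi A n t l = (\<Prod>a\<in>A. (1 + t * a) ^ n l a)"

text \<open>Modulo the k-th power of x - l this is psi(l) exp(t N (x - l)): on the generalised eigenspace
  for l of a derivation D it acts as psi(l) times the exponential of t N times the nilpotent part.\<close>

definition sim_poly ::
    "'k::field_char_0 set \<Rightarrow> nat \<Rightarrow> ('k \<Rightarrow> 'k \<Rightarrow> nat) \<Rightarrow> nat \<Rightarrow> 'k \<Rightarrow> 'k poly" where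
  "sim_poly A k n N t = (\<Sum>l\<in>A. idem A k l *
     smult (psi A n t l) (texp (2 * k) (t * of_nat N) [:-l, 1:]))"

lemma ev_texp: "ev x (texp M s p) = (\<Sum>i<M. cst (s ^ i / fact i) * ev x p ^ i)"
  by (simp add: texp_def ev_sum ev_smult ev_power)

lemma cst_of_nat: "cst (of_nat m) = of_nat m"
  by (induction m) (auto simp: cst_simps)

text \<open>Cutting the exponential series at 2k terms is what makes it work: the terms of the
  product missing from the exponential of the sum have i + j \<ge> 2k, so one of the two exponents
  is at least k.\<close>

lemma truncated_exp_add:
  fixes s :: "'k::field_char_0"
  assumes I: "is_ideal I" and xy: "x ^ k \<in> I" "y ^ k \<in> I"
  defines "T \<equiv> \<lambda>z. \<Sum>i<2 * k. cst (s ^ i / fact i) * z ^ i"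
  shows "T x * T y - T (x + y) \<in> I"
proof -
  define f where "f i z = cst (s ^ i / fact i) * z ^ i" for i z
  let ?S = "{..<2 * k} \<times> {..<2 * k}" and ?D = "{(i, j). i + j < 2 * k}"
  have "T (x + y) = (\<Sum>m<2 * k. \<Sum>i\<le>m. f i x * f (m - i) y)"
    unfolding T_def
  proof (intro sum.cong refl)
    fix m
    have "cst (s ^ m / fact m) * (of_nat (m choose i) * x ^ i * y ^ (m - i)) = f i x * f (m - i) y"
      if "i \<le> m" for i
    proof -
      have "s ^ m / fact m * of_nat (m choose i) = (s ^ i / fact i) * (s ^ (m - i) / fact (m - i))"
        using that by (simp add: binomial_fact field_simps flip: power_add)
      then have "cst (s ^ m / fact m) * of_nat (m choose i) = cst (s ^ i / fact i) * cst (s ^ (m - i) / fact (m - i))"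
        by (metis cst_of_nat cst_simps(4))
      then show ?thesis by (simp add: f_def mult.assoc[symmetric])
    qed
    then show "cst (s ^ m / fact m) * (x + y) ^ m = (\<Sum>i\<le>m. f i x * f (m - i) y)"
      unfolding binomial_ring sum_distrib_left by (intro sum.cong) auto
  qed
  also have "\<dots> = (\<Sum>(i, j)\<in>?D. f i x * f j y)"
    by (rule sum.triangle_reindex[symmetric])
  finally have T: "T (x + y) = (\<Sum>(i, j)\<in>?D. f i x * f j y)" .
  have "T x * T y = (\<Sum>(i, j)\<in>?S. f i x * f j y)"
    by (simp add: T_def f_def sum_product sum.cartesian_product)
  also have "\<dots> = (\<Sum>(i, j)\<in>?S - ?D. f i x * f j y) + (\<Sum>(i, j)\<in>?D. f i x * f j y)"
    by (intro sum.subset_diff) auto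
  finally have "T x * T y - T (x + y) = (\<Sum>(i, j)\<in>?S - ?D. f i x * f j y)" unfolding T by simp
  also have "\<dots> \<in> I"
  proof (rule is_idealD(8)[OF I])
    fix p assume "p \<in> ?S - ?D"
    then obtain i j where p: "p = (i, j)" "\<not> i + j < 2 * k" by blast
    then have "k \<le> i \<or> k \<le> j" by linarith
    then have "x ^ i \<in> I \<or> y ^ j \<in> I"
      using is_idealD(7)[OF I] xy by (metis le_imp_power_dvd)
    then have "f i x \<in> I \<or> f j y \<in> I" using is_idealD(3)[OF I] by (auto simp: f_def)
    then show "(case p of (i, j) \<Rightarrow> f i x * f j y) \<in> I"
      using is_idealD(3,4)[OF I] by (auto simp: p(1))
  qed
  finally show ?thesis .
qed

lemma sim_poly_local:
  assumes "finite A" "l \<in> A"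
  shows "[:-l, 1:] ^ k dvd sim_poly A k n N t - smult (psi A n t l) (texp (2 * k) (t * of_nat N) [:-l, 1:])"
  unfolding sim_poly_def by (rule interpolation[OF assms])

lemma sim_poly_root:
  assumes "finite A" "l \<in> A" "k > 0"
  shows "poly (sim_poly A k n N t) l = psi A n t l"
proof -
  have "[:-l, 1:] dvd [:-l, 1:] ^ k" using assms(3) by (simp add: dvd_power)
  then have "[:-l, 1:] dvd sim_poly A k n N t - smult (psi A n t l) (texp (2 * k) (t * of_nat N) [:-l, 1:])"
    using sim_poly_local[OF assms(1,2)] dvd_trans by blast
  then have "poly (sim_poly A k n N t) l = psi A n t l * poly (texp (2 * k) (t * of_nat N) [:-l, 1:]) l"
    by (simp add: poly_eq_0_iff_dvd[symmetric])
  also have "poly (texp (2 * k) (t * of_nat N) [:-l, 1:]) l = (\<Sum>i<2 * k. if i = 0 then 1 else 0)"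
    unfolding texp_def poly_sum by (intro sum.cong) (auto simp: poly_power power_0_left)
  also have "\<dots> = 1" using assms(3) by simp
  finally show ?thesis by simp
qed

text \<open>At eigenvalues l, u and l + u all three factors are explicit: the scalars match by the
  additivity of the weights, the exponentials by \<open>truncated_exp_add\<close>. Read with X and Y
  as a derivation D on the two factors of a product, this says that \<open>sim_poly\<close> of D is
  a similitude with factor \<Prod>a\<in>A. (1 + t a)^C.\<close>

lemma sim_poly_mult:
  assumes A: "finite A" and J: "is_ideal J"
    and P: "ev x (\<Prod>a\<in>A. [:-a, 1:] ^ k) \<in> J" "ev y (\<Prod>a\<in>A. [:-a, 1:] ^ k) \<in> J"
      "ev (x + y) (\<Prod>a\<in>A. [:-a, 1:] ^ k) \<in> J"
    and n: "\<forall>l\<in>A. \<forall>u\<in>A. l + u \<in> A \<longrightarrow> (\<forall>a\<in>A. n l a + n u a = C + n (l + u) a)"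
  shows "ev x (sim_poly A k n N t) * ev y (sim_poly A k n N t)
    - cst (\<Prod>a\<in>A. (1 + t * a) ^ C) * ev (x + y) (sim_poly A k n N t) \<in> J"
proof (rule ideal_local_sum[OF A A A J P])
  fix l u I
  let ?c = "\<Prod>a\<in>A. (1 + t * a) ^ C" and ?Q = "sim_poly A k n N t"
  assume l: "l \<in> A" "u \<in> A" "l + u \<in> A" and I: "is_ideal I" and "J \<subseteq> I"
    and xy: "ev x [:-l, 1:] ^ k \<in> I" "ev y [:-u, 1:] ^ k \<in> I" "ev (x + y) [:-(l + u), 1:] ^ k \<in> I"
  define T where "T z = (\<Sum>i<2 * k. cst ((t * of_nat N) ^ i / fact i) * z ^ i)" for z :: "'a poly poly"
  have loc: "ev z ?Q - cst (psi A n t v) * T (ev z [:-v, 1:]) \<in> I"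
    if "v \<in> A" "ev z [:-v, 1:] ^ k \<in> I" for z v
  proof -
    have "ev z ([:-v, 1:] ^ k) \<in> I" using that by (simp add: ev_power)
    from is_idealD(7)[OF I this ev_dvd[OF sim_poly_local[OF A that(1)]]]
    show ?thesis by (simp add: ev_diff ev_smult ev_texp T_def)
  qed
  let ?X = "ev x [:-l, 1:]" and ?Y = "ev y [:-u, 1:]"
  have Z: "ev (x + y) [:-(l + u), 1:] = ?X + ?Y" by (simp add: ev_pCons ev_0 cst_simps)
  have psi: "psi A n t l * psi A n t u = ?c * psi A n t (l + u)"
    unfolding psi_def prod.distrib[symmetric] using n l
    by (intro prod.cong) (auto simp flip: power_add)
  let ?a = "ev x ?Q" and ?b = "ev y ?Q" and ?d = "ev (x + y) ?Q"
    and ?a' = "cst (psi A n t l) * T ?X" and ?b' = "cst (psi A n t u) * T ?Y"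
    and ?d' = "cst (psi A n t (l + u)) * T (?X + ?Y)"
  \<comment> \<open>Telescoping replaces each value by its local form, with an error in
    \<open>I\<close> each time.\<close>
  have "?a * ?b - cst ?c * ?d = (?a - ?a') * ?b + ?a' * (?b - ?b') - cst ?c * (?d - ?d')
      + (?a' * ?b' - cst ?c * ?d')"
    by (simp add: algebra_simps)
  also have "?a' * ?b' = cst (psi A n t l * psi A n t u) * (T ?X * T ?Y)"
    by (simp add: cst_simps(4) mult_ac)
  also have "cst ?c * ?d' = cst (psi A n t l * psi A n t u) * T (?X + ?Y)"
    unfolding psi by (simp only: cst_simps(4) mult.assoc)
  finally have "?a * ?b - cst ?c * ?d = (?a - ?a') * ?b + ?a' * (?b - ?b') - cst ?c * (?d - ?d')
      + cst (psi A n t l * psi A n t u) * (T ?X * T ?Y - T (?X + ?Y))"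
    by (simp only: right_diff_distrib[of "cst (psi A n t l * psi A n t u)"])
  also have "\<dots> \<in> I"
  proof (intro is_idealD(2,6)[OF I])
    show "(?a - ?a') * ?b \<in> I" by (intro is_idealD(4)[OF I] loc l xy)
    show "?a' * (?b - ?b') \<in> I" by (intro is_idealD(3)[OF I] loc l xy)
    show "cst ?c * (?d - ?d') \<in> I"
      using loc[OF l(3) xy(3)] unfolding Z by (rule is_idealD(3)[OF I])
    show "cst (psi A n t l * psi A n t u) * (T ?X * T ?Y - T (?X + ?Y)) \<in> I"
      unfolding T_def by (intro is_idealD(3)[OF I] truncated_exp_add[OF I] xy)
  qed
  finally show "?a * ?b - cst ?c * ?d \<in> I" .
qed

lemma sim_poly_equivariant:
  assumes s: "field_hom \<sigma>" and A: "\<sigma> ` A = A" and t: "\<sigma> t = t"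
    and n: "\<forall>l\<in>A. \<forall>a\<in>A. n (\<sigma> l) (\<sigma> a) = n l a"
  shows "map_poly \<sigma> (sim_poly A k n N t) = sim_poly A k n N t"
  unfolding sim_poly_def
proof (rule interpolation_equivariant[OF s A])
  fix l assume l: "l \<in> A"
  note h = field_homD[OF s]
  have "psi A n t (\<sigma> l) = (\<Prod>a\<in>\<sigma> ` A. (1 + t * a) ^ n (\<sigma> l) a)" by (simp add: psi_def A)
  also have "\<dots> = (\<Prod>a\<in>A. (1 + t * \<sigma> a) ^ n (\<sigma> l) (\<sigma> a))"
    using h(10) by (subst prod.reindex) (auto intro: inj_on_subset)
  also have "\<dots> = \<sigma> (psi A n t l)" using n l t by (simp add: psi_def h)
  finally have psi: "\<sigma> (psi A n t l) = psi A n t (\<sigma> l)" ..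
  have fact: "\<sigma> (fact i) = fact i" for i
    using h(8)[of "fact i"] by simp
  show "map_poly \<sigma> (smult (psi A n t l) (texp (2 * k) (t * of_nat N) [:- l, 1:]))
    = smult (psi A n t (\<sigma> l)) (texp (2 * k) (t * of_nat N) [:- \<sigma> l, 1:])"
    by (simp add: field_hom_map_poly[OF s] texp_def h t psi fact)
qed

text \<open>The same family with the parameter t as an (outer) polynomial variable.\<close>

definition sim_biv ::
    "'k::field_char_0 set \<Rightarrow> nat \<Rightarrow> ('k \<Rightarrow> 'k \<Rightarrow> nat) \<Rightarrow> nat \<Rightarrow> 'k poly poly" where
  "sim_biv A k n N = (\<Sum>l\<in>A. smult (idem A k l) ((\<Prod>a\<in>A. [:1, [:a:]:] ^ n l a)
     * (\<Sum>i<2 * k. monom (smult (of_nat N ^ i / fact i) ([:-l, 1:] ^ i)) i)))"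

lemma poly_sim_biv: "poly (sim_biv A k n N) [:t:] = sim_poly A k n N t"
proof -
  have const: "[:c:] ^ i = [:c ^ i:]" for c :: 'a and i
    by (induction i) (auto simp: one_pCons)
  have constp: "(\<Prod>a\<in>A. [:f a:]) = [:\<Prod>a\<in>A. f a:]" for f :: "'a \<Rightarrow> 'a"
    by (induction A rule: infinite_finite_induct) (auto simp: one_pCons)
  show ?thesis
    unfolding sim_biv_def sim_poly_def poly_sum poly_smult poly_mult poly_prod psi_def texp_def
  proof (intro sum.cong refl arg_cong2[of _ _ _ _ "(*)"])
    fix l
    have "(\<Prod>a\<in>A. poly ([:1, [:a:]:] ^ n l a) [:t:]) = [:\<Prod>a\<in>A. (1 + t * a) ^ n l a:]"
      by (simp add: poly_power const one_pCons mult.commute[of t] flip: constp)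
    moreover have "poly (monom (smult (of_nat N ^ i / fact i) ([:-l, 1:] ^ i)) i) [:t:]
        = smult ((t * of_nat N) ^ i / fact i) ([:-l, 1:] ^ i)" for i
      by (simp add: poly_monom const power_mult_distrib mult.commute)
    ultimately show "(\<Prod>a\<in>A. poly ([:1, [:a:]:] ^ n l a) [:t:]) *
        (\<Sum>i<2 * k. poly (monom (smult (of_nat N ^ i / fact i) ([:-l, 1:] ^ i)) i) [:t:]) =
        smult (\<Prod>a\<in>A. (1 + t * a) ^ n l a) (\<Sum>i<2 * k. smult ((t * of_nat N) ^ i / fact i) ([:-l, 1:] ^ i))"
      by simp
  qed
qed

lemma coeff_prod_power_1:
  fixes f :: "'i \<Rightarrow> 'r::comm_ring_1 poly"
  assumes "\<And>i. i \<in> S \<Longrightarrow> coeff (f i) 0 = 1"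
  shows "coeff (\<Prod>i\<in>S. f i ^ m i) 0 = 1" "coeff (\<Prod>i\<in>S. f i ^ m i) 1 = (\<Sum>i\<in>S. of_nat (m i) * coeff (f i) 1)"
proof -
  have mult: "coeff (p * q) 0 = coeff p 0 * coeff q 0"
    "coeff (p * q) 1 = coeff p 0 * coeff q 1 + coeff p 1 * coeff q 0" for p q :: "'r poly"
    by (simp_all add: coeff_mult)
  have pow: "coeff (p ^ j) 0 = 1 \<and> coeff (p ^ j) 1 = of_nat j * coeff p 1" if "coeff p 0 = 1" for p :: "'r poly" and j
    by (induction j) (use that in \<open>auto simp: mult algebra_simps simp del: coeff_mult_0 One_nat_def\<close>)
  have "coeff (\<Prod>i\<in>S. f i ^ m i) 0 = 1 \<and> coeff (\<Prod>i\<in>S. f i ^ m i) 1 = (\<Sum>i\<in>S. of_nat (m i) * coeff (f i) 1)"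
    using assms
    by (induction S rule: infinite_finite_induct)
      (use pow in \<open>auto simp: mult simp del: One_nat_def\<close>)
  then show "coeff (\<Prod>i\<in>S. f i ^ m i) 0 = 1"
    "coeff (\<Prod>i\<in>S. f i ^ m i) 1 = (\<Sum>i\<in>S. of_nat (m i) * coeff (f i) 1)" by blast+
qed

text \<open>The first-order term in t is C \<Sum>A + N l from the weights plus N (x - l) from the
  exponential. The eigenvalue l cancels, which leaves the same factor C \<Sum>A + N x on every
  component.\<close>

lemma sim_biv_linear_coeff:
  assumes k: "k > 0" and n: "\<forall>l\<in>A. (\<Sum>a\<in>A. of_nat (n l a) * a) = of_nat C * \<Sum>A + of_nat N * l"
  shows "coeff (sim_biv A k n N) 1 = (\<Sum>l\<in>A. idem A k l) * [:of_nat C * \<Sum>A, of_nat N:]"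
proof -
  have "coeff ((\<Prod>a\<in>A. [:1, [:a:]:] ^ n l a) * (\<Sum>i<2 * k. monom (smult (of_nat N ^ i / fact i) ([:-l, 1:] ^ i)) i)) 1
      = [:of_nat C * \<Sum>A, of_nat N:]" if l: "l \<in> A" for l
  proof -
    let ?p = "\<Prod>a\<in>A. [:1, [:a:]:] ^ n l a"
    let ?q = "\<Sum>i<2 * k. monom (smult (of_nat N ^ i / fact i) ([:-l, 1:] ^ i)) i"
    have "coeff ?q j = smult (of_nat N ^ j / fact j) ([:-l, 1:] ^ j)" if "j < 2 * k" for j
      using that by (simp add: coeff_sum coeff_monom if_distrib[of "smult _"] sum.delta' cong: if_cong)
    from this[of 0] this[of 1] have q: "coeff ?q 0 = 1" "coeff ?q 1 = [:- of_nat N * l, of_nat N:]"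
      using k by auto
    have "(\<Sum>a\<in>S. of_nat (n l a) * [:a:]) = [:\<Sum>a\<in>S. of_nat (n l a) * a:]" for S
      by (induction S rule: infinite_finite_induct) (auto simp: of_nat_poly)
    then have p: "coeff ?p 0 = 1" "coeff ?p 1 = [:\<Sum>a\<in>A. of_nat (n l a) * a:]"
      using coeff_prod_power_1[of A "\<lambda>a. [:1, [:a:]:]" "n l"] by auto
    have "coeff (?p * ?q) 1 = coeff ?p 0 * coeff ?q 1 + coeff ?p 1 * coeff ?q 0"
      by (simp add: coeff_mult)
    also have "\<dots> = [:of_nat C * \<Sum>A, of_nat N:]" using n l unfolding p q by simp
    finally show ?thesis .
  qed
  then show ?thesis by (simp add: sim_biv_def coeff_sum sum_distrib_right del: mult_pCons_right)
qed

subsection \<open>Polynomials over the base field and its closure\<close>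

lemma ac_hom_field_hom: "ac_hom \<sigma> \<Longrightarrow> field_hom \<sigma>"
  unfolding ac_hom_def field_hom_def by (metis to_ac_1)

lemma ac_hom_image_roots:
  assumes s: "ac_hom \<sigma>" and "m \<noteq> 0"
  shows "\<sigma> ` {x. poly (map_poly to_ac m) x = 0} = {x. poly (map_poly to_ac m) x = 0}"
proof (rule endo_inj_surj)
  note h = field_homD[OF ac_hom_field_hom[OF s]]
  have m: "map_poly to_ac m \<noteq> 0" using assms(2) by (auto simp: map_poly_eq_0_iff)
  then show "finite {x. poly (map_poly to_ac m) x = 0}" by (rule poly_roots_finite)
  have "\<sigma> (poly (map_poly to_ac m) x) = poly (map_poly to_ac m) (\<sigma> x)" for x
  proof (induction m)
    case (pCons c m)
    then show ?case using s by (simp add: map_poly_pCons h ac_hom_def)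
  qed (simp add: h)
  then have "poly (map_poly to_ac m) (\<sigma> x) = 0" if "poly (map_poly to_ac m) x = 0" for x
    using that h(4) by metis
  then show "\<sigma> ` {x. poly (map_poly to_ac m) x = 0} \<subseteq> {x. poly (map_poly to_ac m) x = 0}"
    by blast
  show "inj_on \<sigma> {x. poly (map_poly to_ac m) x = 0}"
    using h(10) inj_on_subset by blast
qed

lemma rational_poly:
  fixes p :: "'a::field_char_0 alg_closure poly"
  assumes "\<And>\<sigma>. ac_hom \<sigma> \<Longrightarrow> map_poly \<sigma> p = p"
  obtains q where "p = map_poly to_ac q"
proof -
  have "coeff p i \<in> range to_ac" for i
  proof (rule ac_hom_fixed)
    fix \<sigma> :: "'a alg_closure \<Rightarrow> 'a alg_closure" assume s: "ac_hom \<sigma>"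
    then show "\<sigma> (coeff p i) = coeff p i"
      using assms[OF s] field_homD(4)[OF ac_hom_field_hom[OF s]] by (metis coeff_map_poly)
  qed
  then have "p = map_poly to_ac (map_poly of_ac p)"
    by (intro poly_eqI) (simp add: coeff_map_poly to_ac_of_ac)
  then show ?thesis by (rule that)
qed

lemma map_poly_to_ac:
  "map_poly to_ac (p + q) = map_poly to_ac p + map_poly to_ac q"
  "map_poly to_ac (p * q) = map_poly to_ac p * map_poly to_ac q"
  "map_poly to_ac (p - q) = map_poly to_ac p - map_poly to_ac q"
  "map_poly to_ac (smult c p) = smult (to_ac c) (map_poly to_ac p)"
  by (simp_all add: poly_eq_iff coeff_map_poly coeff_mult to_ac_sum)

subsection \<open>Actions of polynomials\<close>

text \<open>The linear functional on polynomials that sends x^i to \<open>s i\<close>. With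
  \<open>s i\<close> = f (D^i v) it is the value under f of p(D) v, which makes sense for
  \<open>p\<close> over the closure although D acts over the base field.\<close>

definition polyseq :: "'k::comm_ring_1 poly \<Rightarrow> (nat \<Rightarrow> 'k) \<Rightarrow> 'k" where
  "polyseq p s = (\<Sum>i\<le>degree p. coeff p i * s i)"

lemma polyseq_bound: "degree p \<le> n \<Longrightarrow> polyseq p s = (\<Sum>i\<le>n. coeff p i * s i)"
  unfolding polyseq_def by (intro sum.mono_neutral_left) (auto simp: coeff_eq_0)

lemma polyseq_0 [simp]: "polyseq 0 s = 0"
  by (simp add: polyseq_def)

lemma polyseq_pCons: "polyseq (pCons c p) s = c * s 0 + polyseq p (\<lambda>i. s (Suc i))"
proof -
  have "polyseq (pCons c p) s = (\<Sum>i\<le>Suc (degree p). coeff (pCons c p) i * s i)"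
    by (rule polyseq_bound) (rule degree_pCons_le)
  also have "\<dots> = c * s 0 + (\<Sum>i\<le>degree p. coeff p i * s (Suc i))"
    by (subst sum.atMost_Suc_shift) simp
  finally show ?thesis by (simp add: polyseq_def)
qed

lemma polyseq_add: "polyseq (p + q) s = polyseq p s + polyseq q s"
proof -
  let ?n = "max (degree p) (degree q)"
  have "polyseq (p + q) s = (\<Sum>i\<le>?n. coeff (p + q) i * s i)"
    by (rule polyseq_bound) (rule degree_add_le_max)
  then show ?thesis
    by (simp add: polyseq_bound[of p ?n] polyseq_bound[of q ?n] distrib_right sum.distrib)
qed

lemma polyseq_smult: "polyseq (smult c p) s = c * polyseq p s"
  by (induction p arbitrary: s) (auto simp: polyseq_pCons algebra_simps)

lemma polyseq_diff: "polyseq (p - q) s = polyseq p s - polyseq q s"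
  using polyseq_add[of "p - q" q s] by simp

lemma polyseq_lincomb: "polyseq p (\<lambda>i. c * s i + s' i) = c * polyseq p s + polyseq p s'"
  by (simp add: polyseq_def sum_distrib_left sum.distrib algebra_simps)

text \<open>Exhibits the tested value as a polynomial in \<open>t\<close>, which vanishes
  identically once it has infinitely many zeros.\<close>

lemma polyseq_biv:
  "polyseq (poly q [:t:]) s = poly (map_poly (\<lambda>p. polyseq p s) q) t"
proof (induction q)
  case (pCons p q)
  have "polyseq ([:t:] * poly q [:t:]) s = t * polyseq (poly q [:t:]) s" by (simp add: polyseq_smult)
  then show ?case using pCons by (simp add: map_poly_pCons polyseq_add)
qed simp

definition bivseq :: "'k::comm_ring_1 poly poly \<Rightarrow> (nat \<Rightarrow> nat \<Rightarrow> 'k) \<Rightarrow> 'k" where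
  "bivseq g s = (\<Sum>j\<le>degree g. polyseq (coeff g j) (\<lambda>i. s i j))"

lemma bivseq_bound: "degree g \<le> n \<Longrightarrow> bivseq g s = (\<Sum>j\<le>n. polyseq (coeff g j) (\<lambda>i. s i j))"
  unfolding bivseq_def by (intro sum.mono_neutral_left) (auto simp: coeff_eq_0)

lemma bivseq_0 [simp]: "bivseq 0 s = 0"
  by (simp add: bivseq_def)

lemma bivseq_pCons: "bivseq (pCons p g) s = polyseq p (\<lambda>i. s i 0) + bivseq g (\<lambda>i j. s i (Suc j))"
proof -
  have "bivseq (pCons p g) s = (\<Sum>j\<le>Suc (degree g). polyseq (coeff (pCons p g) j) (\<lambda>i. s i j))"
    by (rule bivseq_bound) (rule degree_pCons_le)
  also have "\<dots> = polyseq p (\<lambda>i. s i 0) + (\<Sum>j\<le>degree g. polyseq (coeff g j) (\<lambda>i. s i (Suc j)))"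
    by (subst sum.atMost_Suc_shift) simp
  finally show ?thesis by (simp add: bivseq_def)
qed

lemma bivseq_add: "bivseq (g + h) s = bivseq g s + bivseq h s"
proof -
  let ?n = "max (degree g) (degree h)"
  have "bivseq (g + h) s = (\<Sum>j\<le>?n. polyseq (coeff (g + h) j) (\<lambda>i. s i j))"
    by (rule bivseq_bound) (rule degree_add_le_max)
  then show ?thesis
    by (simp add: bivseq_bound[of g ?n] bivseq_bound[of h ?n] polyseq_add sum.distrib)
qed

lemma bivseq_lincomb: "bivseq g (\<lambda>i j. c * s i j + s' i j) = c * bivseq g s + bivseq g s'"
  by (simp add: bivseq_def polyseq_lincomb sum_distrib_left sum.distrib)

abbreviation varX :: "'k::comm_ring_1 poly poly" where "varX \<equiv> [:[:0, 1:]:]"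
abbreviation varY :: "'k::comm_ring_1 poly poly" where "varY \<equiv> [:0, 1:]"

lemma bivseq_cst: "bivseq (cst c * g) s = c * bivseq g s"
  unfolding cst_def by (induction g arbitrary: s) (auto simp: bivseq_pCons polyseq_smult algebra_simps)

lemma bivseq_varX: "bivseq (varX * g) s = bivseq g (\<lambda>i j. s (Suc i) j)"
  by (induction g arbitrary: s) (auto simp: bivseq_pCons polyseq_pCons)

lemma bivseq_varY: "bivseq (varY * g) s = bivseq g (\<lambda>i j. s i (Suc j))"
  by (simp add: bivseq_pCons)

lemma bivseq_diff: "bivseq (g - h) s = bivseq g s - bivseq h s"
  using bivseq_add[of "g - h" h s] by simp

text \<open>Multiplication by X or Y shifts the sequence in one index, so the annihilator of a set
  of sequences closed under both shifts is an ideal.\<close>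

lemma is_ideal_bivseq:
  fixes S :: "(nat \<Rightarrow> nat \<Rightarrow> 'k::comm_ring_1) set"
  assumes X: "\<And>s. s \<in> S \<Longrightarrow> (\<lambda>i j. s (Suc i) j) \<in> S"
    and Y: "\<And>s. s \<in> S \<Longrightarrow> (\<lambda>i j. s i (Suc j)) \<in> S"
  shows "is_ideal {g. \<forall>s\<in>S. bivseq g s = 0}" (is "is_ideal ?J")
proof -
  have add: "g + h \<in> ?J" if "g \<in> ?J" "h \<in> ?J" for g h using that by (simp add: bivseq_add)
  have inner: "smult p g \<in> ?J" if "g \<in> ?J" for p g
  proof (induction p)
    case (pCons c p)
    have "smult (pCons c p) g = cst c * g + varX * smult p g"
      by (simp add: cst_def poly_eq_iff[of "smult (pCons c p) g"])
    moreover have "varX * smult p g \<in> ?J" using pCons X unfolding bivseq_varX mem_Collect_eq by simp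
    moreover have "cst c * g \<in> ?J" using that by (simp add: bivseq_cst)
    ultimately show ?case using add by simp
  qed simp
  have "r * g \<in> ?J" if "g \<in> ?J" for r g
  proof (induction r)
    case (pCons p r)
    have "pCons p r * g = smult p g + varY * (r * g)" by simp
    moreover have "varY * (r * g) \<in> ?J" using pCons Y unfolding bivseq_varY mem_Collect_eq by simp
    ultimately show ?case using add inner[OF that] by simp
  qed simp
  then show ?thesis using add unfolding is_ideal_def by auto
qed

section \<open>Polynomials in a linear operator\<close>

locale poly_action = vector_space scale
  for scale :: "'a::field \<Rightarrow> 'b::ab_group_add \<Rightarrow> 'b" (infixr \<open>*s\<close> 75)
begin

abbreviation lin :: "('b \<Rightarrow> 'b) \<Rightarrow> bool" where
  "lin \<equiv> Vector_Spaces.linear scale scale"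

lemma lin_simps:
  assumes "lin f"
  shows "f (x + y) = f x + f y" "f (x - y) = f x - f y" "f (c *s x) = c *s f x" "f 0 = 0"
    "f (- x) = - f x" "f (sum g S) = (\<Sum>i\<in>S. f (g i))"
proof -
  have add: "f (x + y) = f x + f y" and scale: "f (c *s x) = c *s f x" for x y c
    using assms unfolding Vector_Spaces.linear_iff by blast+
  show "f (x + y) = f x + f y" "f (c *s x) = c *s f x" by (fact add, fact scale)
  show 0: "f 0 = 0" using scale[of 0 0] by simp
  have neg: "f (- x) = - f x" for x using scale[of "-1" x] by simp
  then show "f (- x) = - f x" .
  show "f (x - y) = f x - f y" using add[of x "- y"] neg by simp
  show "f (sum g S) = (\<Sum>i\<in>S. f (g i))"
    by (induction S rule: infinite_finite_induct) (simp_all add: 0 add)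
qed

definition polyop :: "('b \<Rightarrow> 'b) \<Rightarrow> 'a poly \<Rightarrow> 'b \<Rightarrow> 'b" where
  "polyop D p x = (\<Sum>i\<le>degree p. scale (coeff p i) ((D ^^ i) x))"

lemma polyop_bound: "degree p \<le> n \<Longrightarrow> polyop D p x = (\<Sum>i\<le>n. scale (coeff p i) ((D ^^ i) x))"
  unfolding polyop_def by (intro sum.mono_neutral_left) (auto simp: coeff_eq_0)

lemma polyop_0 [simp]: "polyop D 0 x = 0"
  by (simp add: polyop_def)

lemma polyop_pCons: "polyop D (pCons c p) x = scale c x + polyop D p (D x)"
proof -
  have "polyop D (pCons c p) x = (\<Sum>i\<le>Suc (degree p). scale (coeff (pCons c p) i) ((D ^^ i) x))"
    by (rule polyop_bound) (rule degree_pCons_le)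
  also have "\<dots> = scale c x + (\<Sum>i\<le>degree p. scale (coeff p i) ((D ^^ i) (D x)))"
    by (subst sum.atMost_Suc_shift) (simp add: funpow_swap1)
  finally show ?thesis by (simp add: polyop_def)
qed

lemma polyop_1 [simp]: "polyop D 1 x = x"
  by (simp add: polyop_def)

lemma polyop_add: "polyop D (p + q) x = polyop D p x + polyop D q x"
proof -
  let ?n = "max (degree p) (degree q)"
  have "polyop D (p + q) x = (\<Sum>i\<le>?n. scale (coeff (p + q) i) ((D ^^ i) x))"
    by (rule polyop_bound) (rule degree_add_le_max)
  then show ?thesis
    by (simp add: polyop_bound[of p ?n] polyop_bound[of q ?n] scale_left_distrib sum.distrib)
qed

lemma polyop_smult: "polyop D (smult c p) x = scale c (polyop D p x)"
  by (induction p arbitrary: x) (auto simp: polyop_pCons scale_right_distrib)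

lemma polyop_diff: "polyop D (p - q) x = polyop D p x - polyop D q x"
  using polyop_add[of D "p - q" q x] by (simp add: algebra_simps)

lemma polyop_monom: "polyop D (monom 1 n) x = (D ^^ n) x"
proof (induction n arbitrary: x)
  case (Suc n)
  then show ?case by (simp add: monom_Suc polyop_pCons funpow_swap1)
qed (simp add: monom_0 polyop_pCons)

context
  fixes D :: "'b \<Rightarrow> 'b"
  assumes D: "Vector_Spaces.linear scale scale D"
begin

lemma polyop_linear: "Vector_Spaces.linear scale scale (polyop D p)"
proof -
  have "polyop D p (x + y) = polyop D p x + polyop D p y \<and> polyop D p (scale c x) = scale c (polyop D p x)" for x y c
    by (induction p arbitrary: x y)
      (auto simp: polyop_pCons lin_simps[OF D] scale_right_distrib scale_left_commute)
  then show ?thesis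
    unfolding Vector_Spaces.linear_iff using vector_space_axioms by blast
qed

lemma polyop_commute: "polyop D p (D x) = D (polyop D p x)"
  by (induction p arbitrary: x) (auto simp: polyop_pCons lin_simps[OF D])

lemma polyop_mult: "polyop D (p * q) x = polyop D p (polyop D q x)"
proof (induction p arbitrary: x)
  case (pCons c p)
  then show ?case by (simp add: polyop_pCons polyop_add polyop_smult polyop_commute)
qed simp

lemma polyop_power: "polyop D (p ^ n) x = (polyop D p ^^ n) x"
  by (induction n arbitrary: x) (auto simp: polyop_mult)

lemma polyop_in:
  assumes "subspace S" "D ` S \<subseteq> S" "x \<in> S"
  shows "polyop D p x \<in> S"
  using assms(3) by (induction p arbitrary: x)
    (use assms(1,2) in \<open>auto simp: polyop_pCons subspace_0 intro!: subspace_add subspace_scale\<close>)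

lemma annihilator_vector:
  assumes fin: "finite B" "span B = UNIV"
  obtains p where "p \<noteq> 0" "polyop D p x = 0"
proof -
  let ?V = "\<lambda>j. (\<lambda>i. (D ^^ i) x) ` {..<j}"
  have "\<exists>j. (D ^^ j) x \<in> span (?V j)"
  proof (rule ccontr)
    assume no: "\<nexists>j. (D ^^ j) x \<in> span (?V j)"
    have "independent (?V j) \<and> card (?V j) = j" for j
    proof (induction j)
      case (Suc j)
      have V: "?V (Suc j) = insert ((D ^^ j) x) (?V j)" by (auto simp: lessThan_Suc)
      have nj: "(D ^^ j) x \<notin> span (?V j)" using no by simp
      have "(D ^^ j) x \<notin> ?V j" using nj span_base[of "(D ^^ j) x" "?V j"] by argo
      then have "card (?V (Suc j)) = Suc j" unfolding V using Suc by (subst card_insert_disjoint) auto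
      then show ?case using Suc independent_insertI[OF nj] unfolding V by blast
    qed (simp add: dependent_def)
    from this[of "Suc (card B)"] show False
      using independent_span_bound[OF fin(1), of "?V (Suc (card B))"] fin(2) by auto
  qed
  then obtain j where j: "(D ^^ j) x \<in> span (?V j)" by blast
  let ?U = "{polyop D p x | p. \<forall>i\<ge>j. coeff p i = 0}"
  have "subspace ?U"
  proof (rule subspaceI)
    show "0 \<in> ?U" by (rule CollectI, rule exI[of _ 0]) simp
  next
    fix u v assume "u \<in> ?U" "v \<in> ?U"
    then obtain p q where "u = polyop D p x" "v = polyop D q x" "\<forall>i\<ge>j. coeff p i = 0" "\<forall>i\<ge>j. coeff q i = 0" by blast
    then show "u + v \<in> ?U" by (intro CollectI exI[of _ "p + q"]) (simp add: polyop_add)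
  next
    fix c u assume "u \<in> ?U"
    then obtain p where "u = polyop D p x" "\<forall>i\<ge>j. coeff p i = 0" by blast
    then show "scale c u \<in> ?U" by (intro CollectI exI[of _ "smult c p"]) (simp add: polyop_smult)
  qed
  moreover have "?V j \<subseteq> ?U"
  proof clarify
    fix i assume "i < j"
    then show "\<exists>p. (D ^^ i) x = polyop D p x \<and> (\<forall>i\<ge>j. coeff p i = 0)"
      by (intro exI[of _ "monom 1 i"]) (simp add: polyop_monom)
  qed
  ultimately have "(D ^^ j) x \<in> ?U" using j span_minimal by blast
  then obtain p where p: "(D ^^ j) x = polyop D p x" "\<forall>i\<ge>j. coeff p i = 0" by blast
  have "coeff (monom 1 j - p) j = 1" using p(2) by simp
  then have "monom 1 j - p \<noteq> 0" by (metis coeff_0 zero_neq_one)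
  moreover have "polyop D (monom 1 j - p) x = 0" using p(1) by (simp add: polyop_diff polyop_monom)
  ultimately show ?thesis by (rule that)
qed

text \<open>Polynomials in D commute, so the product of annihilators of the members of a finite
  spanning set kills the whole set.\<close>

lemma annihilator:
  assumes fin: "finite B" "span B = UNIV"
  obtains p where "p \<noteq> 0" "\<forall>x. polyop D p x = 0"
proof -
  have "\<exists>p. p \<noteq> 0 \<and> polyop D p x = 0" for x using annihilator_vector[OF fin] by metis
  then obtain p where p: "\<And>x. p x \<noteq> 0" "\<And>x. polyop D (p x) x = 0" by metis
  let ?m = "\<Prod>b\<in>B. p b"
  have "polyop D ?m b = 0" if "b \<in> B" for b
  proof -
    have "?m = (\<Prod>c\<in>B - {b}. p c) * p b" using fin(1) that by (simp add: prod.remove mult.commute)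
    then show ?thesis using polyop_linear p(2)
      by (metis mult.commute polyop_mult Vector_Spaces.linear_iff scale_zero_left)
  qed
  moreover have "subspace {x. polyop D ?m x = 0}"
    using polyop_linear[of ?m] by (auto simp: subspace_def Vector_Spaces.linear_iff)
      (metis scale_zero_left)+
  ultimately have "span B \<subseteq> {x. polyop D ?m x = 0}" by (intro span_minimal) auto
  then show ?thesis using fin p(1) by (intro that[of ?m]) auto
qed

end

lemma separating_functional:
  assumes W: "subspace W" and x: "x \<notin> W"
  obtains f where "Vector_Spaces.linear scale (*) f" "\<forall>w\<in>W. f w = 0" "f x \<noteq> 0"
proof -
  interpret F: vector_space "(*) :: 'a \<Rightarrow> 'a \<Rightarrow> 'a" by standard (auto simp: algebra_simps)
  interpret pair: vector_space_pair scale "(*) :: 'a \<Rightarrow> 'a \<Rightarrow> 'a" ..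
  obtain B where B: "B \<subseteq> W" "independent B" "W \<subseteq> span B" using maximal_independent_subset by metis
  have sp: "span B = W" using B W by (metis span_subspace)
  then have ind: "independent (insert x B)" using x B(2) by (simp add: independent_insertI)
  obtain f where f: "Vector_Spaces.linear scale (*) f" "\<forall>b\<in>insert x B. f b = (if b = x then 1 else 0)"
    using pair.linear_independent_extend[OF ind, of "\<lambda>b. if b = x then 1 else 0"] by blast
  have "subspace {w. f w = 0}" using f(1) by (auto simp: subspace_def Vector_Spaces.linear_iff)
      (metis mult_zero_left scale_zero_left)+
  moreover have "B \<subseteq> {w. f w = 0}" using f(2) B(1) x by auto
  ultimately have "W \<subseteq> {w. f w = 0}" using sp span_minimal by blast
  then show ?thesis using f by (intro that[of f]) auto
qed

end

subsection \<open>Derivations and similitudes\<close>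

locale fd_leibniz = leibniz_algebra scale mult + poly_action scale
  for scale :: "'a::field_char_0 \<Rightarrow> 'b::ab_group_add \<Rightarrow> 'b" (infixr \<open>*s\<close> 75)
    and mult :: "'b \<Rightarrow> 'b \<Rightarrow> 'b" (infixl \<open>\<star>\<close> 70) +
  assumes fd: finite_dim
begin

abbreviation linf :: "('b \<Rightarrow> 'a) \<Rightarrow> bool" where
  "linf \<equiv> Vector_Spaces.linear scale (*)"

definition derivation :: "('b \<Rightarrow> 'b) \<Rightarrow> bool" where
  "derivation D \<longleftrightarrow> lin D \<and> (\<forall>x y. D (x \<star> y) = D x \<star> y + x \<star> D y)"

lemma finite_basis:
  obtains B where "finite B" "independent B" "span B = UNIV"
proof -
  obtain S where S: "finite S" "span S = UNIV" using fd by (auto simp: finite_dim_def)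
  obtain B where B: "B \<subseteq> S" "independent B" "S \<subseteq> span B" by (rule maximal_independent_subset)
  have "span B = UNIV" using S(2) B(3) span_mono[of S "span B"] by (simp add: span_span) blast
  then show ?thesis using that B finite_subset[OF B(1) S(1)] by blast
qed

lemma linear_inj_surj:
  assumes "lin f" "inj f"
  shows "surj f"
proof -
  obtain B where "finite B" "independent B" "span B = UNIV" by (rule finite_basis)
  then interpret V: finite_dimensional_vector_space scale B by unfold_locales
  show ?thesis using assms by (rule V.linear_inj_imp_surj)
qed

lemma linf_simps:
  assumes "linf f"
  shows "f (x + y) = f x + f y" "f (x - y) = f x - f y" "f (c *s x) = c * f x" "f 0 = 0"
proof -
  have add: "f (x + y) = f x + f y" and scale: "f (c *s x) = c * f x" for x y c
    using assms unfolding Vector_Spaces.linear_iff by blast+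
  show "f (x + y) = f x + f y" "f (c *s x) = c * f x" by (fact add, fact scale)
  show "f 0 = 0" using scale[of 0 0] by simp
  show "f (x - y) = f x - f y" using add[of x "(-1) *s y"] scale[of "-1" y] by simp
qed

lemma linI:
  assumes "\<And>x y. f (x + y) = f x + f y" "\<And>c x. f (c *s x) = c *s f x"
  shows "lin f"
  unfolding Vector_Spaces.linear_iff using assms vector_space_axioms by blast

lemma lin_funpow: "lin f \<Longrightarrow> lin (f ^^ n)"
  by (rule linI; induction n) (auto simp: lin_simps)

lemma mult_simps [simp]:
  "(x + y) \<star> z = x \<star> z + y \<star> z" "z \<star> (x + y) = z \<star> x + z \<star> y"
  "(x - y) \<star> z = x \<star> z - y \<star> z" "z \<star> (x - y) = z \<star> x - z \<star> y"
  "(c *s x) \<star> z = c *s (x \<star> z)" "z \<star> (c *s x) = c *s (z \<star> x)"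
  "0 \<star> z = 0" "z \<star> 0 = 0" "(- x) \<star> z = - (x \<star> z)" "z \<star> (- x) = - (z \<star> x)"
  using lin_simps[OF mult_linear_left] lin_simps[OF mult_linear_right] by simp_all

lemma left_mult_derivation: "derivation (\<lambda>y. x \<star> y)"
  unfolding derivation_def using mult_linear_right left_leibniz by blast

text \<open>The doubly indexed sequence on which X and Y act, through \<open>bivseq\<close>, as D on
  \<open>x\<close> and as D on \<open>y\<close>.\<close>

definition form :: "('b \<Rightarrow> 'a) \<Rightarrow> ('b \<Rightarrow> 'b) \<Rightarrow> 'b \<Rightarrow> 'b \<Rightarrow> nat \<Rightarrow> nat \<Rightarrow> 'a alg_closure" where
  "form f D x y = (\<lambda>i j. to_ac (f ((D ^^ i) x \<star> (D ^^ j) y)))"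

lemma form_shift:
  "(\<lambda>i j. form f D x y (Suc i) j) = form f D (D x) y"
  "(\<lambda>i j. form f D x y i (Suc j)) = form f D x (D y)"
  by (simp_all add: form_def funpow_swap1)

lemma is_ideal_form:
  assumes "D ` P \<subseteq> P" "D ` Q \<subseteq> Q"
  shows "is_ideal {g. \<forall>s\<in>{form f D x y | x y. x \<in> P \<and> y \<in> Q}. bivseq g s = 0}"
proof (rule is_ideal_bivseq)
  fix s assume "s \<in> {form f D x y | x y. x \<in> P \<and> y \<in> Q}"
  then obtain x y where s: "s = form f D x y" "x \<in> P" "y \<in> Q" by blast
  have "D x \<in> P" "D y \<in> Q" using s assms by blast+
  then show "(\<lambda>i j. s (Suc i) j) \<in> {form f D x y | x y. x \<in> P \<and> y \<in> Q}"
    "(\<lambda>i j. s i (Suc j)) \<in> {form f D x y | x y. x \<in> P \<and> y \<in> Q}"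
    unfolding s(1) form_shift using s by blast+
qed

context
  fixes D :: "'b \<Rightarrow> 'b" and f :: "'b \<Rightarrow> 'a"
  assumes D: "lin D" and f: "linf f"
begin

lemma form_lincomb:
  "form f D (c *s x + x') y = (\<lambda>i j. to_ac c * form f D x y i j + form f D x' y i j)"
  "form f D x (c *s y + y') = (\<lambda>i j. to_ac c * form f D x y i j + form f D x y' i j)"
  unfolding form_def by (simp_all add: lin_simps[OF lin_funpow[OF D]] linf_simps[OF f])

lemma bivseq_evX:
  "bivseq (ev varX (map_poly to_ac p) * g) (form f D x y) = bivseq g (form f D (polyop D p x) y)"
proof (induction p arbitrary: x)
  case 0
  have "form f D 0 y = (\<lambda>i j. 0)" by (simp add: form_def lin_simps[OF lin_funpow[OF D]] linf_simps[OF f])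
  then show ?case using bivseq_lincomb[of g 0 "\<lambda>i j. 0" "\<lambda>i j. 0"]
    by (simp add: ev_0 bivseq_def polyseq_def)
next
  case (pCons c p)
  have "bivseq (ev varX (map_poly to_ac (pCons c p)) * g) (form f D x y)
      = to_ac c * bivseq g (form f D x y) + bivseq (ev varX (map_poly to_ac p) * g) (form f D (D x) y)"
    unfolding map_poly_pCons[of to_ac, OF to_ac_0] ev_pCons distrib_right bivseq_add bivseq_cst mult.assoc bivseq_varX form_shift ..
  then show ?case by (simp add: pCons.IH polyop_pCons form_lincomb bivseq_lincomb)
qed

lemma bivseq_evY:
  "bivseq (ev varY (map_poly to_ac p) * g) (form f D x y) = bivseq g (form f D x (polyop D p y))"
proof (induction p arbitrary: y)
  case 0
  have "form f D x 0 = (\<lambda>i j. 0)" by (simp add: form_def lin_simps[OF lin_funpow[OF D]] linf_simps[OF f])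
  then show ?case by (simp add: ev_0 bivseq_def polyseq_def)
next
  case (pCons c p)
  have "bivseq (ev varY (map_poly to_ac (pCons c p)) * g) (form f D x y)
      = to_ac c * bivseq g (form f D x y) + bivseq (ev varY (map_poly to_ac p) * g) (form f D x (D y))"
    unfolding map_poly_pCons[of to_ac, OF to_ac_0] ev_pCons distrib_right bivseq_add bivseq_cst mult.assoc bivseq_varY form_shift ..
  then show ?case by (simp add: pCons.IH polyop_pCons form_lincomb bivseq_lincomb)
qed

lemma bivseq_1: "bivseq 1 (form f D x y) = to_ac (f (x \<star> y))"
  by (simp add: bivseq_def polyseq_def form_def)

text \<open>The Leibniz rule says exactly that X + Y acts as D on the product.\<close>

lemma bivseq_evZ:
  assumes Leib: "\<And>x y. D (x \<star> y) = D x \<star> y + x \<star> D y"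
  shows "bivseq (ev (varX + varY) (map_poly to_ac p)) (form f D x y) = to_ac (f (polyop D p (x \<star> y)))"
proof (induction p arbitrary: x y)
  case (pCons c p)
  let ?e = "ev (varX + varY) (map_poly to_ac p)"
  have "bivseq (ev (varX + varY) (map_poly to_ac (pCons c p))) (form f D x y)
      = bivseq (cst (to_ac c) * 1 + (varX * ?e + varY * ?e)) (form f D x y)"
    by (simp add: map_poly_pCons ev_pCons distrib_right)
  also have "\<dots> = to_ac c * to_ac (f (x \<star> y))
      + (bivseq ?e (form f D (D x) y) + bivseq ?e (form f D x (D y)))"
    unfolding bivseq_add bivseq_cst bivseq_varX bivseq_varY form_shift bivseq_1 ..
  also have "\<dots> = to_ac (f (polyop D (pCons c p) (x \<star> y)))"
    unfolding pCons.IH by (simp add: polyop_pCons Leib linf_simps[OF f] lin_simps[OF polyop_linear[OF D]])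
  finally show ?case .
qed (simp add: ev_0 linf_simps[OF f])

text \<open>A factor with coefficients in the base field may be moved onto the vector; in
  particular, multiples of an annihilating polynomial evaluate to zero.\<close>

lemma polyseq_map_poly:
  "polyseq (g * map_poly to_ac p) (\<lambda>i. to_ac (f ((D ^^ i) x))) = polyseq g (\<lambda>i. to_ac (f ((D ^^ i) (polyop D p x))))"
proof (induction p arbitrary: x)
  case 0
  then show ?case by (simp add: lin_simps[OF lin_funpow[OF D]] linf_simps[OF f] polyseq_def)
next
  case (pCons c p)
  have "g * map_poly to_ac (pCons c p) = smult (to_ac c) g + pCons 0 (g * map_poly to_ac p)"
    by (simp add: map_poly_pCons)
  then show ?case
    by (simp add: polyseq_add polyseq_smult polyseq_pCons polyop_pCons lin_simps[OF lin_funpow[OF D]] linf_simps[OF f]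
        polyseq_lincomb pCons.IH[of "D x", symmetric] funpow_swap1)
qed

end

lemma functional_eqI:
  assumes "\<And>f. linf f \<Longrightarrow> f x = f y"
  shows "x = y"
proof (rule ccontr)
  assume "x \<noteq> y"
  then have "x - y \<notin> {0}" by simp
  with subspace_single_0 obtain f where "linf f" "f (x - y) \<noteq> 0"
    by (metis separating_functional)
  then show False using assms[of f] by (simp add: linf_simps)
qed

text \<open>With no root of \<open>q\<close> among the eigenvalues, \<open>q\<close> is invertible
  modulo \<open>m\<close> over the closure. The inverse need not be rational, so it is used only
  under functionals, where it yields injectivity; finite dimension gives the rest.\<close>

lemma bij_polyop:
  assumes D: "lin D" and A: "finite A" and m: "\<forall>x. polyop D m x = 0"
    and mA: "map_poly to_ac m dvd (\<Prod>a\<in>A. [:-a, 1:] ^ k)"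
    and q: "\<And>a. a \<in> A \<Longrightarrow> poly (map_poly to_ac q) a \<noteq> 0"
  shows "inj (polyop D q)" "surj (polyop D q)"
proof -
  note lq = polyop_linear[OF D, of q]
  obtain u where "(\<Prod>a\<in>A. [:-a, 1:] ^ k) dvd u * map_poly to_ac q - 1"
    by (rule local_unit[OF A q])
  with mA have "map_poly to_ac m dvd u * map_poly to_ac q - 1" by (rule dvd_trans)
  then obtain v where "u * map_poly to_ac q - 1 = map_poly to_ac m * v" by (rule dvdE)
  then have v: "u * map_poly to_ac q - 1 = v * map_poly to_ac m" by (simp only: mult.commute)
  have "x = 0" if x: "polyop D q x = 0" for x
  proof (rule functional_eqI)
    fix f assume f: "linf f"
    let ?s = "\<lambda>i. to_ac (f ((D ^^ i) x))"
    have zero: "polyseq g (\<lambda>i. to_ac (f ((D ^^ i) 0))) = 0" for g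
      by (simp add: lin_simps[OF lin_funpow[OF D]] linf_simps[OF f] polyseq_def)
    have "polyseq 1 ?s = polyseq (u * map_poly to_ac q - v * map_poly to_ac m) ?s" by (simp flip: v)
    also have "\<dots> = 0" unfolding polyseq_diff polyseq_map_poly[OF D f] x m[rule_format] zero by simp
    finally show "f x = f 0" by (simp add: polyseq_def linf_simps[OF f])
  qed
  then show inj: "inj (polyop D q)" by (intro injI) (metis lin_simps(2)[OF lq] right_minus_eq)
  show "surj (polyop D q)" by (rule linear_inj_surj[OF lq inj])
qed

text \<open>A substitute for the fact that a subspace stable under the automorphism group is stable under
  its Lie algebra: there are enough similitudes, polynomials in D, that are rational over the base
  field.\<close>

theorem derivation_invariant:
  assumes D: "derivation D" and W: "subspace W"
    and inv: "\<And>\<alpha> c. lin \<alpha> \<Longrightarrow> inj \<alpha> \<Longrightarrow> surj \<alpha> \<Longrightarrow> c \<noteq> 0 \<Longrightarrow>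
      (\<And>x y. \<alpha> x \<star> \<alpha> y = c *s \<alpha> (x \<star> y)) \<Longrightarrow> \<alpha> ` W \<subseteq> W"
  shows "D ` W \<subseteq> W"
proof -
  have linD: "lin D" and Leib: "\<And>x y. D (x \<star> y) = D x \<star> y + x \<star> D y"
    using D by (auto simp: derivation_def)
  obtain B where B: "finite B" "span B = UNIV" by (rule finite_basis)
  obtain m where m: "m \<noteq> 0" "\<forall>x. polyop D m x = 0" by (rule annihilator[OF linD B])
  let ?m = "map_poly to_ac m"
  have m0: "?m \<noteq> 0" using m(1) by (auto simp: map_poly_eq_0_iff)
  define A where "A = {x. poly ?m x = 0}"
  \<comment> \<open>At least every multiplicity, and positive, as the value of
    \<open>sim_poly\<close> at a root and its linear coefficient in t require.\<close>
  define k where "k = Suc (degree ?m)"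
  let ?P = "\<Prod>a\<in>A. [:-a, 1:] ^ k"
  have A: "finite A" unfolding A_def by (rule poly_roots_finite[OF m0])
  have "?m dvd (\<Prod>a\<in>A. [:-a, 1:] ^ degree ?m)" unfolding A_def by (rule root_product_dvd[OF m0])
  also have "\<dots> dvd ?P" unfolding k_def by (intro prod_dvd_prod le_imp_power_dvd) simp
  finally have mP: "?m dvd ?P" .
  let ?G = "Collect ac_hom :: ('a alg_closure \<Rightarrow> 'a alg_closure) set"
  have hom: "field_hom \<sigma>" "\<sigma> ` A = A" if "ac_hom \<sigma>" for \<sigma>
    unfolding A_def using that ac_hom_field_hom ac_hom_image_roots[OF _ m(1)] by blast+
  obtain N C :: nat and n where N: "N > 0"
    and n_add: "\<forall>l\<in>A. \<forall>u\<in>A. l + u \<in> A \<longrightarrow> (\<forall>a\<in>A. n l a + n u a = C + n (l + u) a)"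
    and n_sum: "\<forall>l\<in>A. (\<Sum>a\<in>A. of_nat (n l a) * a) = of_nat C * \<Sum>A + of_nat N * l"
    and n_eq: "\<forall>\<sigma>\<in>?G. \<forall>l\<in>A. \<forall>a\<in>A. n (\<sigma> l) (\<sigma> a) = n l a"
  proof (rule equivariant_weights[OF A, of ?G])
    have "ac_hom (\<lambda>x. x)" by (simp add: ac_hom_def)
    then show "?G \<noteq> {}" by blast
    show "\<sigma> \<in> ?G \<Longrightarrow> \<sigma> (x + y) = \<sigma> x + \<sigma> y" for \<sigma> x y by (simp add: ac_hom_def)
    show "\<sigma> \<in> ?G \<Longrightarrow> inj \<sigma>" for \<sigma> using field_homD(10) hom by blast
    show "\<sigma> \<in> ?G \<Longrightarrow> x \<in> A \<Longrightarrow> \<sigma> x \<in> A" for \<sigma> x using hom by blast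
    show "\<sigma> \<in> ?G \<Longrightarrow> \<tau> \<in> ?G \<Longrightarrow> \<sigma> \<circ> \<tau> \<in> ?G" for \<sigma> \<tau> by (simp add: ac_hom_def)
  qed
  let ?Q = "\<lambda>t. sim_poly A k n N (to_ac t)"
  \<comment> \<open>The parameters at which no factor of \<open>psi\<close> vanishes, so that the
    similitude is invertible; only the finitely many t = -1/a are lost.\<close>
  define T where "T = {t :: 'a. \<forall>a\<in>A. 1 + to_ac t * a \<noteq> 0}"
  have rational: "\<exists>q. ?Q t = map_poly to_ac q \<and> polyop D q ` W \<subseteq> W" if t: "t \<in> T" for t
  proof -
    have "map_poly \<sigma> (?Q t) = ?Q t" if "ac_hom \<sigma>" for \<sigma>
      using that n_eq by (intro sim_poly_equivariant hom) (auto simp: ac_hom_def)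
    then obtain q where q: "?Q t = map_poly to_ac q" by (rule rational_poly)
    let ?c = "\<Prod>a\<in>A. (1 + to_ac t * a) ^ C"
    have "?c \<in> range to_ac"
    proof (rule ac_hom_fixed)
      fix \<sigma> :: "'a alg_closure \<Rightarrow> 'a alg_closure" assume s: "ac_hom \<sigma>"
      note h = field_homD[OF hom(1)[OF s]]
      have "\<sigma> (to_ac t) = to_ac t" using s by (simp add: ac_hom_def)
      then have "\<sigma> ?c = (\<Prod>a\<in>A. (1 + to_ac t * \<sigma> a) ^ C)" by (simp add: h)
      also have "\<dots> = (\<Prod>a\<in>\<sigma> ` A. (1 + to_ac t * a) ^ C)"
        using h(10) by (subst prod.reindex) (auto intro: inj_on_subset)
      finally show "\<sigma> ?c = ?c" using hom(2)[OF s] by simp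
    qed
    then obtain c where c: "?c = to_ac c" by blast
    have "?c \<noteq> 0" using t A by (simp add: T_def)
    then have c0: "c \<noteq> 0" using c by auto
    have sim: "polyop D q x \<star> polyop D q y = c *s polyop D q (x \<star> y)" for x y
    proof (rule functional_eqI)
      fix f assume f: "linf f"
      \<comment> \<open>The polynomials in X and Y that annihilate all f (D^i x \<star> D^j y). They
        include \<open>m\<close> evaluated at X, Y and X + Y, so \<open>sim_poly_mult\<close> yields
        the similitude law tested by f.\<close>
      let ?J = "{g. \<forall>s\<in>{form f D x y | x y. x \<in> UNIV \<and> y \<in> UNIV}. bivseq g s = 0}"
      have J: "is_ideal ?J" by (rule is_ideal_form) auto
      have "ev varX ?m \<in> ?J" "ev varY ?m \<in> ?J" "ev (varX + varY) ?m \<in> ?J"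
        using bivseq_evX[OF linD f, of m 1] bivseq_evY[OF linD f, of m 1] bivseq_evZ[OF linD f Leib, of m]
        by (auto simp: m(2) bivseq_1[OF linD f] linf_simps[OF f])
      then have P: "ev varX ?P \<in> ?J" "ev varY ?P \<in> ?J" "ev (varX + varY) ?P \<in> ?J"
        using is_idealD(7)[OF J] ev_dvd[OF mP] by blast+
      have "ev varX (?Q t) * ev varY (?Q t) - cst ?c * ev (varX + varY) (?Q t) \<in> ?J"
        by (rule sim_poly_mult[OF A J P n_add])
      then have "bivseq (ev varX (?Q t) * (ev varY (?Q t) * 1)) (form f D x y)
          = bivseq (cst ?c * ev (varX + varY) (?Q t)) (form f D x y)"
        by (auto simp: bivseq_diff)
      then have "to_ac (f (polyop D q x \<star> polyop D q y)) = to_ac c * to_ac (f (polyop D q (x \<star> y)))"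
        unfolding q c bivseq_evX[OF linD f] bivseq_evY[OF linD f] bivseq_cst bivseq_evZ[OF linD f Leib]
          bivseq_1[OF linD f] .
      then show "f (polyop D q x \<star> polyop D q y) = f (c *s polyop D q (x \<star> y))"
        by (simp add: linf_simps[OF f] flip: to_ac_mult)
    qed
    have nz: "poly (map_poly to_ac q) a \<noteq> 0" if "a \<in> A" for a
    proof -
      have "poly (?Q t) a = psi A n (to_ac t) a" by (rule sim_poly_root[OF A that]) (simp add: k_def)
      moreover have "psi A n (to_ac t) a \<noteq> 0" using t A by (simp add: psi_def T_def)
      ultimately show ?thesis unfolding q by simp
    qed
    have "polyop D q ` W \<subseteq> W"
      by (rule inv[OF polyop_linear[OF linD] bij_polyop[OF linD A m(2) mP nz] c0 sim])
    then show ?thesis using q by blast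
  qed
  have "infinite T"
  proof
    assume "finite T"
    moreover have "finite (- T)"
    proof (rule finite_subset)
      show "finite ((\<lambda>a. of_ac (- 1 / a)) ` A)" using A by simp
      show "- T \<subseteq> (\<lambda>a. of_ac (- 1 / a)) ` A"
      proof
        fix t assume "t \<in> - T"
        then obtain a where a: "a \<in> A" "1 + to_ac t * a = 0" by (auto simp: T_def)
        then have "a \<noteq> 0" by auto
        then have "to_ac t = - 1 / a" using a(2) by (simp add: field_simps eq_neg_iff_add_eq_0)
        then have "t = of_ac (- 1 / a)" by (metis of_ac_to_ac)
        then show "t \<in> (\<lambda>a. of_ac (- 1 / a)) ` A" using a(1) by blast
      qed
    qed
    ultimately have "finite (T \<union> - T)" by blast
    then show False using infinite_UNIV_char_0[where 'a = 'a] by simp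
  qed
  then have infT: "infinite (to_ac ` T)" using finite_imageD[OF _ inj_on_subset[OF inj_to_ac subset_UNIV]] by blast
  show ?thesis
  proof (rule ccontr)
    assume "\<not> D ` W \<subseteq> W"
    then obtain w where w: "w \<in> W" "D w \<notin> W" by blast
    obtain f where f: "linf f" "\<forall>v\<in>W. f v = 0" "f (D w) \<noteq> 0"
      by (rule separating_functional[OF W w(2)])
    let ?s = "\<lambda>i. to_ac (f ((D ^^ i) w))"
    \<comment> \<open>As a polynomial in t this vanishes on the infinite set \<open>T\<close>,
      because the similitudes preserve \<open>W\<close>; so its linear coefficient, the derivative
      at 0, is zero.\<close>
    define R where "R = map_poly (\<lambda>p. polyseq p ?s) (sim_biv A k n N)"
    have "poly R (to_ac t) = 0" if t: "t \<in> T" for t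
    proof -
      obtain q where q: "?Q t = map_poly to_ac q" "polyop D q ` W \<subseteq> W" using rational[OF t] by blast
      have "poly R (to_ac t) = polyseq (1 * map_poly to_ac q) ?s"
        by (simp add: R_def poly_sim_biv q(1) flip: polyseq_biv)
      also have "\<dots> = to_ac (f (polyop D q w))"
        unfolding polyseq_map_poly[OF linD f(1)] by (simp add: polyseq_def)
      also have "f (polyop D q w) = 0" using f(2) q(2) w(1) by blast
      finally show ?thesis by simp
    qed
    then have "to_ac ` T \<subseteq> {x. poly R x = 0}" by blast
    then have "infinite {x. poly R x = 0}" using infT finite_subset by blast
    then have "R = 0" using poly_roots_finite by blast
    then have "coeff R 1 = 0" by simp
    then have "polyseq (coeff (sim_biv A k n N) 1) ?s = 0" by (simp add: R_def coeff_map_poly)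
    then have *: "polyseq ((\<Sum>l\<in>A. idem A k l) * [:of_nat C * \<Sum>A, of_nat N:]) ?s = 0"
      by (subst (asm) sim_biv_linear_coeff[OF _ n_sum]) (simp_all add: k_def)
    let ?r = "[:of_nat C * \<Sum>A, of_nat N:]"
    \<comment> \<open>The idempotents sum to 1 modulo \<open>m\<close> and drop out. What remains is
      C \<Sum>A f(w) + N f(D w), and f(w) = 0.\<close>
    have "?m dvd ((\<Sum>l\<in>A. idem A k l) - 1) * ?r"
      using dvd_trans[OF mP idem_sum[OF A]] dvd_mult2 by blast
    then obtain g where "((\<Sum>l\<in>A. idem A k l) - 1) * ?r = ?m * g" by (rule dvdE)
    then have g: "((\<Sum>l\<in>A. idem A k l) - 1) * ?r = g * ?m" by (simp only: mult.commute[of ?m])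
    have "polyseq (g * ?m) ?s = 0"
      unfolding polyseq_map_poly[OF linD f(1)] m(2)[rule_format]
      by (simp add: lin_simps[OF lin_funpow[OF linD]] linf_simps[OF f(1)] polyseq_def)
    moreover have r: "?r = (\<Sum>l\<in>A. idem A k l) * ?r - g * ?m"
      unfolding g[symmetric] by (simp only: left_diff_distrib mult_1) simp
    have "polyseq ?r ?s = polyseq ((\<Sum>l\<in>A. idem A k l) * ?r) ?s - polyseq (g * ?m) ?s"
      using arg_cong[OF r, of "\<lambda>p. polyseq p ?s"] unfolding polyseq_diff .
    ultimately have "polyseq ?r ?s = 0" using * by (simp only: diff_self)
    then have "of_nat N * to_ac (f (D w)) = 0" using f(2) w(1) by (simp add: polyseq_pCons)
    then show False using N f(3) by simp
  qed
qed

subsection \<open>The Frattini subalgebra is a left ideal\<close>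

lemma dim_less:
  assumes "subspace S" "subspace T" "S \<subset> T"
  shows "dim S < dim T"
proof -
  obtain B where "finite B" "independent B" "span B = UNIV" by (rule finite_basis)
  then interpret V: finite_dimensional_vector_space scale B by unfold_locales
  have "span S \<subset> span T" using assms by (simp add: span_eq_iff[THEN iffD2])
  then show ?thesis by (rule V.dim_psubset)
qed

lemma dim_bounded:
  obtains n where "\<forall>S. dim S \<le> n"
proof -
  obtain B where "finite B" "independent B" "span B = UNIV" by (rule finite_basis)
  then interpret V: finite_dimensional_vector_space scale B by unfold_locales
  show ?thesis using V.dim_subset[OF subset_UNIV] by (intro that[of "dim UNIV"]) blast
qed

lemma maximal_dim_exists:
  assumes "P S"
  obtains T where "P T" "\<forall>R. P R \<longrightarrow> dim R \<le> dim T"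
proof -
  obtain n where n: "\<forall>S. dim S \<le> n" by (rule dim_bounded)
  have "\<forall>y. P y \<longrightarrow> dim y < Suc n" using n by (simp add: less_Suc_eq_le)
  from ex_has_greatest_nat[OF assms this] show ?thesis using that by blast
qed

lemma subalgebraD:
  assumes "subalgebra S"
  shows "subspace S" "x \<in> S \<Longrightarrow> y \<in> S \<Longrightarrow> x \<star> y \<in> S"
  using assms by (auto simp: subalgebra_def)

lemma maximal_subalgebraD:
  assumes "maximal_subalgebra M"
  shows "subalgebra M" "M \<noteq> UNIV" "subalgebra S \<Longrightarrow> M \<subseteq> S \<Longrightarrow> S \<noteq> M \<Longrightarrow> S = UNIV"
  using assms by (auto simp: maximal_subalgebra_def)

lemma proper_subalgebra_in_maximal:
  assumes P: "subalgebra P" "P \<noteq> UNIV"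
  obtains M where "maximal_subalgebra M" "P \<subseteq> M"
proof -
  obtain M where M: "subalgebra M \<and> M \<noteq> UNIV \<and> P \<subseteq> M"
    and max: "\<forall>R. subalgebra R \<and> R \<noteq> UNIV \<and> P \<subseteq> R \<longrightarrow> dim R \<le> dim M"
    using maximal_dim_exists[of "\<lambda>S. subalgebra S \<and> S \<noteq> UNIV \<and> P \<subseteq> S" P] P by blast
  have "S = M \<or> S = UNIV" if S: "subalgebra S" "M \<subseteq> S" for S
  proof (rule ccontr)
    assume *: "\<not> (S = M \<or> S = UNIV)"
    then have "dim M < dim S" using S M by (intro dim_less) (auto simp: subalgebra_def)
    moreover have "dim S \<le> dim M" using max S M * by blast
    ultimately show False by simp
  qed
  then show ?thesis using M by (intro that[of M]) (auto simp: maximal_subalgebra_def)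
qed

lemma frattini_in_maximal: "maximal_subalgebra M \<Longrightarrow> frattini \<subseteq> M"
  by (auto simp: frattini_def)

lemma subalgebra_frattini: "subalgebra frattini"
  unfolding subalgebra_def frattini_def
  by (auto simp: maximal_subalgebra_def subalgebra_def intro!: subspace_Inter)

lemma frattini_nongenerator:
  assumes P: "subalgebra P" and gen: "\<forall>x. \<exists>p\<in>P. \<exists>q\<in>frattini. x = p + q"
  shows "P = UNIV"
proof (rule ccontr)
  assume "P \<noteq> UNIV"
  then obtain M where M: "maximal_subalgebra M" "P \<subseteq> M" by (rule proper_subalgebra_in_maximal[OF P])
  have "x \<in> M" for x
  proof -
    obtain p q where "p \<in> P" "q \<in> frattini" "x = p + q" using gen by blast
    then show ?thesis using M frattini_in_maximal[OF M(1)]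
      by (auto simp: maximal_subalgebra_def subalgebra_def intro!: subspace_add)
  qed
  then show False using maximal_subalgebraD(2)[OF M(1)] by blast
qed

text \<open>A similitude with factor \<open>c\<close> is \<open>c\<close> times an automorphism, and
  subspaces do not notice the scalar.\<close>

lemma maximal_subalgebra_vimage:
  assumes M: "maximal_subalgebra M" and \<alpha>: "lin \<alpha>" "inj \<alpha>" "surj \<alpha>" and c: "c \<noteq> 0"
    and sim: "\<And>x y. \<alpha> x \<star> \<alpha> y = c *s \<alpha> (x \<star> y)"
  shows "maximal_subalgebra (\<alpha> -` M)"
proof -
  note s = lin_simps[OF \<alpha>(1)] and MD = maximal_subalgebraD[OF M]
  have subM: "subspace M" by (rule subalgebraD[OF MD(1)])
  have "subspace (\<alpha> -` M)" using subM by (auto simp: subspace_def s)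
  moreover have "x \<star> y \<in> \<alpha> -` M" if "x \<in> \<alpha> -` M" "y \<in> \<alpha> -` M" for x y
  proof -
    have "(1 / c) *s (\<alpha> x \<star> \<alpha> y) \<in> M"
      using that subalgebraD[OF MD(1)] by (intro subspace_scale[OF subM]) auto
    then show ?thesis using c by (simp add: sim)
  qed
  ultimately have "subalgebra (\<alpha> -` M)" by (simp add: subalgebra_def)
  moreover have "\<alpha> -` M \<noteq> UNIV"
  proof
    assume "\<alpha> -` M = UNIV"
    then have "M = UNIV" using \<alpha>(3) by (metis surj_image_vimage_eq)
    then show False using MD(2) by contradiction
  qed
  moreover have "S = \<alpha> -` M \<or> S = UNIV" if S: "subalgebra S" "\<alpha> -` M \<subseteq> S" for S
  proof -
    have subS: "subspace S" by (rule subalgebraD[OF S(1)])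
    have "subspace (\<alpha> ` S)" unfolding subspace_def
    proof (intro conjI ballI allI)
      show "0 \<in> \<alpha> ` S" using subspace_0[OF subS] s(4) by (metis imageI)
      show "x + y \<in> \<alpha> ` S" if "x \<in> \<alpha> ` S" "y \<in> \<alpha> ` S" for x y
        using that subspace_add[OF subS] by (auto simp flip: s(1))
      show "a *s x \<in> \<alpha> ` S" if "x \<in> \<alpha> ` S" for a x
        using that subspace_scale[OF subS] by (auto simp flip: s(3))
    qed
    moreover have "x \<star> y \<in> \<alpha> ` S" if xy: "x \<in> \<alpha> ` S" "y \<in> \<alpha> ` S" for x y
    proof -
      obtain u v where "u \<in> S" "v \<in> S" "x = \<alpha> u" "y = \<alpha> v" using xy by blast
      then show ?thesis using subspace_scale[OF subS, of "u \<star> v" c] subalgebraD(2)[OF S(1)]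
        by (auto simp: sim simp flip: s(3))
    qed
    ultimately have "subalgebra (\<alpha> ` S)" by (simp add: subalgebra_def)
    moreover have "M \<subseteq> \<alpha> ` S" using S(2) \<alpha>(3) by (metis image_mono surj_image_vimage_eq)
    ultimately have "\<alpha> ` S = M \<or> \<alpha> ` S = UNIV" using MD(3) by blast
    then show ?thesis
    proof
      assume "\<alpha> ` S = M"
      then show ?thesis using inj_vimage_image_eq[OF \<alpha>(2)] by blast
    next
      assume "\<alpha> ` S = UNIV"
      then have "S = \<alpha> -` UNIV" using inj_vimage_image_eq[OF \<alpha>(2)] by metis
      then show ?thesis by simp
    qed
  qed
  ultimately show ?thesis by (simp add: maximal_subalgebra_def)
qed

lemma frattini_left:
  assumes "x \<in> frattini"
  shows "y \<star> x \<in> frattini"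
proof -
  have "(\<lambda>x. y \<star> x) ` frattini \<subseteq> frattini"
  proof (rule derivation_invariant[OF left_mult_derivation subalgebraD(1)[OF subalgebra_frattini]])
    fix \<alpha> c assume \<alpha>: "lin \<alpha>" "inj \<alpha>" "surj \<alpha>" "c \<noteq> 0" "\<And>x y. \<alpha> x \<star> \<alpha> y = c *s \<alpha> (x \<star> y)"
    show "\<alpha> ` frattini \<subseteq> frattini"
    proof
      fix z assume "z \<in> \<alpha> ` frattini"
      then obtain w where w: "w \<in> frattini" "z = \<alpha> w" by blast
      have "z \<in> M" if "maximal_subalgebra M" for M
        using frattini_in_maximal[OF maximal_subalgebra_vimage[OF that \<alpha>]] w by blast
      then show "z \<in> frattini" by (simp add: frattini_def)
    qed
  qed
  then show ?thesis using assms by blast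
qed

text \<open>The kernel of a nonzero functional that vanishes on all products is a subalgebra of
  codimension 1, hence maximal; an element outside the span of the products would be missed by one
  of these.\<close>

lemma frattini_in_products: "frattini \<subseteq> span {x \<star> y | x y. True}"
proof (rule ccontr)
  let ?L2 = "span {x \<star> y | x y. True}"
  assume "\<not> frattini \<subseteq> ?L2"
  then obtain z where z: "z \<in> frattini" "z \<notin> ?L2" by blast
  obtain f where f: "linf f" "\<forall>w\<in>?L2. f w = 0" "f z \<noteq> 0"
    by (rule separating_functional[OF subspace_span z(2)])
  note s = linf_simps[OF f(1)]
  let ?H = "{x. f x = 0}"
  have mult: "f (x \<star> y) = 0" for x y by (rule bspec[OF f(2) span_base]) blast
  have "subspace ?H" by (auto simp: subspace_def s)
  then have "subalgebra ?H" by (auto simp: subalgebra_def mult)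
  moreover have "?H \<noteq> UNIV" using f(3) by blast
  moreover have "S = ?H \<or> S = UNIV" if S: "subalgebra S" "?H \<subseteq> S" for S
  proof (cases "S = ?H")
    case False
    have subS: "subspace S" by (rule subalgebraD[OF S(1)])
    obtain u where u: "u \<in> S" "f u \<noteq> 0" using False S(2) by blast
    have "x \<in> S" for x
    proof -
      have "f (x - (f x / f u) *s u) = 0" using u(2) by (simp add: s)
      then have "x - (f x / f u) *s u \<in> S" using S(2) by blast
      then have "x - (f x / f u) *s u + (f x / f u) *s u \<in> S"
        using u(1) by (intro subspace_add[OF subS] subspace_scale[OF subS])
      then show ?thesis by simp
    qed
    then show ?thesis by blast
  qed simp
  ultimately have "maximal_subalgebra ?H" by (simp add: maximal_subalgebra_def)
  then have "z \<in> ?H" using frattini_in_maximal z(1) by blast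
  then show False using f(3) by simp
qed

section \<open>The Leibniz kernel, and nilpotency of Frattini elements modulo it\<close>

definition leib :: "'b set" where
  "leib = span {x \<star> x | x. True}"

lemma subspace_leib: "subspace leib"
  by (simp add: leib_def)

text \<open>The Leibniz identity for x, x, y reads x(xy) = (xx)y + x(xy).\<close>

lemma leib_left_zero:
  assumes "i \<in> leib"
  shows "i \<star> y = 0"
proof -
  have "leib \<subseteq> {i. i \<star> y = 0}"
    unfolding leib_def
  proof (rule span_minimal)
    show "{x \<star> x |x. True} \<subseteq> {i. i \<star> y = 0}" using left_leibniz by auto (metis add_cancel_left_left)
    show "subspace {i. i \<star> y = 0}" by (auto simp: subspace_def)
  qed
  then show ?thesis using assms by blast
qed

text \<open>Polarisation of the squares: modulo \<open>leib\<close> the product is anticommutative.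
  This is the bridge from left to right multiplication.\<close>

lemma leib_symmetric: "x \<star> y + y \<star> x \<in> leib"
proof -
  have sq: "z \<star> z \<in> leib" for z unfolding leib_def by (intro span_base) blast
  have "(x + y) \<star> (x + y) - x \<star> x - y \<star> y \<in> leib" by (intro subspace_diff[OF subspace_leib] sq)
  then show ?thesis by (simp add: algebra_simps)
qed

lemma leib_ideal:
  assumes "i \<in> leib"
  shows "y \<star> i \<in> leib"
proof -
  have "leib \<subseteq> {i. y \<star> i \<in> leib}"
  proof (subst (1) leib_def, rule span_minimal)
    have "y \<star> (x \<star> x) \<in> leib" for x by (subst left_leibniz) (rule leib_symmetric)
    then show "{x \<star> x |x. True} \<subseteq> {i. y \<star> i \<in> leib}" by blast
    show "subspace {i. y \<star> i \<in> leib}"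
      by (rule subspaceI)
        (simp_all add: subspace_0[OF subspace_leib] subspace_add[OF subspace_leib]
          subspace_scale[OF subspace_leib])
  qed
  then show ?thesis using assms by blast
qed

lemma left_mult_lin: "lin (\<lambda>y. x \<star> y)"
  by (rule mult_linear_right)

lemma funpow_in:
  assumes "\<And>x. x \<in> S \<Longrightarrow> g x \<in> S" "x \<in> S"
  shows "(g ^^ n) x \<in> S"
  by (induction n) (use assms in auto)

text \<open>Write an annihilating polynomial as X^j q with q = c + X r and c nonzero. Then x = q(D)x
  / c - D r(D)x / c, and D^j kills the first term.\<close>

lemma fitting:
  assumes D: "lin D"
  obtains j u v where "x = u + D v" "(D ^^ j) u = 0"
proof -
  obtain B where B: "finite B" "span B = UNIV" by (rule finite_basis)
  obtain p where p: "p \<noteq> 0" "\<forall>x. polyop D p x = 0" by (rule annihilator[OF D B])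
  obtain q where q: "p = [:- 0, 1:] ^ order 0 p * q" "\<not> [:- 0, 1:] dvd q"
    using order_decomp[OF p(1)] by blast
  obtain c r where qc: "q = pCons c r" by (cases q)
  have "[:- 0, 1:] dvd q" if "c = 0" by (rule dvdI[of _ _ r]) (simp add: qc that)
  with q(2) have c: "c \<noteq> 0" by blast
  let ?u = "(1 / c) *s polyop D q x" and ?v = "- (1 / c) *s polyop D r x"
  have X: "[:- 0, 1:] ^ i = monom (1 :: 'a) i" for i by (simp add: monom_altdef)
  have "(D ^^ order 0 p) (polyop D q x) = polyop D p x"
    using arg_cong[OF q(1), of "\<lambda>r. polyop D r x"] unfolding X polyop_mult[OF D] polyop_monom by simp
  then have "(D ^^ order 0 p) ?u = 0" using p(2) by (simp add: lin_simps[OF lin_funpow[OF D]])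
  moreover have "x = ?u + D ?v"
    using c by (simp add: qc polyop_pCons polyop_commute[OF D] lin_simps[OF D] scale_right_distrib)
  ultimately show ?thesis by (intro that)
qed

text \<open>Expand by the Leibniz rule until one factor has received its i or j derivatives: the
  product is then in \<open>S\<close>, which D preserves. The separate domains allow one proof for
  the algebra modulo \<open>leib\<close> and for \<open>M\<close> acting on \<open>leib\<close>
  modulo \<open>M \<inter> leib\<close>.\<close>

lemma derivation_funpow_mult:
  assumes Leib: "\<And>x y. D (x \<star> y) = D x \<star> y + x \<star> D y" and "lin D"
    and S: "subspace S" "\<And>x. x \<in> S \<Longrightarrow> D x \<in> S"
    and P: "\<And>x y. x \<in> P \<Longrightarrow> y \<in> V \<Longrightarrow> x \<star> y \<in> S" and Q: "\<And>x y. x \<in> U \<Longrightarrow> y \<in> Q \<Longrightarrow> x \<star> y \<in> S"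
    and inv: "\<And>x. x \<in> U \<Longrightarrow> D x \<in> U" "\<And>x. x \<in> V \<Longrightarrow> D x \<in> V"
    and "x \<in> U" "y \<in> V" "(D ^^ i) x \<in> P" "(D ^^ j) y \<in> Q"
  shows "(D ^^ (i + j)) (x \<star> y) \<in> S"
  using assms(9-12)
proof (induction "i + j" arbitrary: i j x y)
  case 0
  then show ?case using P by simp
next
  case (Suc n)
  show ?case
  proof (cases "i = 0 \<or> j = 0")
    case True
    then have "x \<star> y \<in> S" using Suc.prems P Q by auto
    then show ?thesis using S(2) by (rule funpow_in[rotated])
  next
    case False
    then obtain i' j' where ij: "i = Suc i'" "j = Suc j'" using not0_implies_Suc by blast
    have "(D ^^ (i' + j)) (D x \<star> y) \<in> S"
      using Suc.prems inv Suc.hyps(2) by (intro Suc.hyps(1)) (auto simp: ij funpow_swap1)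
    moreover have "(D ^^ (i + j')) (x \<star> D y) \<in> S"
      using Suc.prems inv Suc.hyps(2) by (intro Suc.hyps(1)) (auto simp: ij funpow_swap1)
    moreover have "(D ^^ (i + j)) (x \<star> y) = (D ^^ (i' + j)) (D x \<star> y) + (D ^^ (i + j')) (x \<star> D y)"
    proof -
      have "(D ^^ (i + j)) (x \<star> y) = (D ^^ (i' + j)) (D (x \<star> y))" by (simp add: ij funpow_swap1)
      also have "\<dots> = (D ^^ (i' + j)) (D x \<star> y) + (D ^^ (i' + j)) (x \<star> D y)"
        unfolding Leib by (rule lin_simps(1)[OF lin_funpow[OF \<open>lin D\<close>]])
      also have "i' + j = i + j'" by (simp add: ij)
      finally show ?thesis by (simp add: ij)
    qed
    ultimately show ?thesis using subspace_add[OF S(1)] by simp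
  qed
qed

text \<open>The Fitting null component of left multiplication by p, the Leibniz kernel and the
  non-generators together fill the algebra.\<close>

lemma frattini_nilpotent:
  assumes p: "p \<in> frattini"
  shows "\<exists>n. ((\<lambda>y. p \<star> y) ^^ n) x \<in> leib"
proof -
  let ?D = "\<lambda>y. p \<star> y"
  let ?K = "{x. \<exists>n. (?D ^^ n) x \<in> leib}"
  note lD = lin_funpow[OF left_mult_lin[of p]]
  have mono: "(?D ^^ m) x \<in> leib" if "(?D ^^ n) x \<in> leib" "n \<le> m" for n m x
  proof -
    have "(?D ^^ m) x = (?D ^^ (m - n)) ((?D ^^ n) x)" using that(2)
      by (metis comp_apply funpow_add le_add_diff_inverse2)
    then show ?thesis using funpow_in[OF leib_ideal that(1)] by simp
  qed
  have "subspace ?K"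
  proof (rule subspaceI)
    show "0 \<in> ?K" using subspace_0[OF subspace_leib] lin_simps(4)[OF lD] by auto
    show "x + y \<in> ?K" if xy: "x \<in> ?K" "y \<in> ?K" for x y
    proof -
      obtain n m where "(?D ^^ n) x \<in> leib" "(?D ^^ m) y \<in> leib" using xy by blast
      then have "(?D ^^ (max n m)) x + (?D ^^ (max n m)) y \<in> leib"
        using mono by (intro subspace_add[OF subspace_leib]) auto
      then show ?thesis unfolding lin_simps(1)[OF lD, symmetric] by blast
    qed
    show "c *s x \<in> ?K" if "x \<in> ?K" for c x
      using that subspace_scale[OF subspace_leib] by (auto simp: lin_simps(3)[OF lD])
  qed
  moreover have "x \<star> y \<in> ?K" if xy: "x \<in> ?K" "y \<in> ?K" for x y
  proof -
    obtain i j where "(?D ^^ i) x \<in> leib" "(?D ^^ j) y \<in> leib" using xy by blast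
    moreover have "u \<star> v \<in> leib" if "u \<in> leib" for u v
      using that by (simp add: leib_left_zero subspace_0[OF subspace_leib])
    ultimately have "(?D ^^ (i + j)) (x \<star> y) \<in> leib"
      using derivation_funpow_mult[OF left_leibniz left_mult_lin subspace_leib leib_ideal,
          of leib UNIV UNIV leib] leib_ideal by blast
    then show ?thesis by blast
  qed
  ultimately have "subalgebra ?K" by (simp add: subalgebra_def)
  moreover have "\<exists>k\<in>?K. \<exists>q\<in>frattini. x = k + q" for x
  proof -
    obtain j u v where uv: "x = u + p \<star> v" "(?D ^^ j) u = 0" by (rule fitting[OF left_mult_lin[of p]])
    \<comment> \<open>The Fitting image part p v equals this element of \<open>leib\<close> minus v
      p, and v p is a Frattini element by the left ideal property.\<close>
    let ?l = "p \<star> v + v \<star> p"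
    have "?l \<in> leib" by (rule leib_symmetric)
    then have "(?D ^^ j) ?l \<in> leib" using leib_ideal by (rule funpow_in[rotated])
    then have "(?D ^^ j) (u + ?l) \<in> leib" unfolding lin_simps(1)[OF lD, of j u] uv(2) by simp
    moreover have "- (v \<star> p) \<in> frattini"
      using subalgebraD(1)[OF subalgebra_frattini] frattini_left[OF p] subspace_neg by blast
    moreover have "x = (u + ?l) + (- (v \<star> p))" by (simp add: uv(1))
    ultimately show ?thesis by blast
  qed
  ultimately have "?K = UNIV" by (intro frattini_nongenerator) blast+
  then show ?thesis by blast
qed

subsection \<open>Traces on subquotients\<close>

text \<open>For a basis \<open>B\<close> of a space and \<open>B0 \<subseteq> B\<close> this is the
  trace on span B / span B0 of an operator preserving both spans, written without forming the
  quotient.\<close>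

definition tr :: "'b set \<Rightarrow> 'b set \<Rightarrow> ('b \<Rightarrow> 'b) \<Rightarrow> 'a" where
  "tr B B0 S = (\<Sum>b\<in>B - B0. representation B (S b) b)"

lemma finite_independent:
  assumes "independent S"
  shows "finite S"
proof -
  obtain B where "finite B" "independent B" "span B = UNIV" by (rule finite_basis)
  then interpret V: finite_dimensional_vector_space scale B by unfold_locales
  show ?thesis using assms by (rule V.finiteI_independent)
qed

text \<open>The basis is built along the filtration of I/N by the kernels of the powers of T.\<close>

lemma adapted_basis:
  assumes N: "subspace N" and I: "subspace I" and NI: "N \<subseteq> I" and T: "lin T"
    and TN: "\<And>v. v \<in> N \<Longrightarrow> T v \<in> N" and TI: "\<And>v. v \<in> I \<Longrightarrow> T v \<in> I"
    and nil: "\<And>v. v \<in> I \<Longrightarrow> (T ^^ k) v \<in> N"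
  obtains B B0 where "independent B" "B0 \<subseteq> B" "span B0 = N" "span B = I"
    "\<forall>b\<in>B - B0. representation B (T b) b = 0"
proof -
  let ?W = "\<lambda>j. {v \<in> I. (T ^^ j) v \<in> N}"
  obtain B0 where B0: "B0 \<subseteq> N" "independent B0" "N \<subseteq> span B0" by (rule maximal_independent_subset)
  have sB0: "span B0 = N" using B0 N span_subspace by blast
  have W: "subspace (?W j)" for j
    by (rule subspaceI)
      (auto simp: lin_simps[OF lin_funpow[OF T]] subspace_0[OF N] subspace_0[OF I]
        intro: subspace_add[OF N] subspace_add[OF I] subspace_scale[OF N] subspace_scale[OF I])
  have "\<exists>B. independent B \<and> B0 \<subseteq> B \<and> span B = ?W j \<and> (\<forall>b\<in>B - B0. representation B (T b) b = 0)" for j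
  proof (induction j)
    case 0
    then show ?case using B0(2) sB0 NI by (intro exI[of _ B0]) auto
  next
    case (Suc j)
    then obtain B where B: "independent B" "B0 \<subseteq> B" "span B = ?W j"
      and diag: "\<And>b. b \<in> B - B0 \<Longrightarrow> representation B (T b) b = 0" by blast
    have TW: "T v \<in> span B" if "v \<in> ?W (Suc j)" for v
      using that TI unfolding B(3) by (simp add: funpow_swap1)
    have WW: "?W j \<subseteq> ?W (Suc j)" using TN by auto
    then have "B \<subseteq> ?W (Suc j)" using B(3) span_superset[of B] by order
    then obtain C where C: "B \<subseteq> C" "C \<subseteq> ?W (Suc j)" "independent C" "?W (Suc j) \<subseteq> span C"
      by (rule maximal_independent_subset_extend[OF _ B(1)])
    have "span C = ?W (Suc j)" using C(2,4) W span_subspace by blast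
    moreover have "representation C (T b) b = 0" if b: "b \<in> C - B0" for b
    proof -
      have "T b \<in> span B" using b C(2) TW by blast
      then have r: "representation C (T b) = representation B (T b)"
        using representation_extend[OF C(3) _ C(1)] by blast
      show ?thesis
      proof (cases "b \<in> B")
        case True
        then show ?thesis using diag b r by simp
      next
        case False
        \<comment> \<open>A vector new at this stage is sent by T into the previous span, so its own
          coefficient there is zero.\<close>
        then show ?thesis using representation_ne_zero[of B "T b" b] r by auto
      qed
    qed
    ultimately show ?case using C B(2) by (intro exI[of _ C]) auto
  qed
  from this[of k] obtain B where "independent B" "B0 \<subseteq> B" "span B = ?W k"
    "\<forall>b\<in>B - B0. representation B (T b) b = 0" by blast
  moreover have "?W k = I" using nil by auto
  ultimately show ?thesis using sB0 by (intro that[of B B0]) auto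
qed

context
  fixes B B0 :: "'b set"
  assumes B: "independent B" and B0: "B0 \<subseteq> B"
begin

lemma finite_basis_subset: "finite B"
  by (rule finite_independent[OF B])

lemma tr_add: "(\<And>b. b \<in> B \<Longrightarrow> S b \<in> span B) \<Longrightarrow> (\<And>b. b \<in> B \<Longrightarrow> S' b \<in> span B)
    \<Longrightarrow> tr B B0 (\<lambda>v. S v + S' v) = tr B B0 S + tr B B0 S'"
  unfolding tr_def by (simp add: representation_add[OF B] sum.distrib)

lemma tr_scale: "(\<And>b. b \<in> B \<Longrightarrow> S b \<in> span B) \<Longrightarrow> tr B B0 (\<lambda>v. c *s S v) = c * tr B B0 S"
  unfolding tr_def by (simp add: representation_scale[OF B] sum_distrib_left)

lemma representation_span_B0: "v \<in> span B0 \<Longrightarrow> b \<in> B - B0 \<Longrightarrow> representation B v b = 0"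
  using representation_extend[OF B _ B0] representation_ne_zero[of B0 v b] by auto

lemma tr_cong:
  assumes "\<And>b. b \<in> B \<Longrightarrow> S b \<in> span B" "\<And>b. b \<in> B \<Longrightarrow> S' b \<in> span B"
    and "\<And>b. b \<in> B \<Longrightarrow> S b - S' b \<in> span B0"
  shows "tr B B0 S = tr B B0 S'"
  unfolding tr_def
proof (rule sum.cong)
  fix b assume b: "b \<in> B - B0"
  have "representation B (S b) b - representation B (S' b) b = representation B (S b - S' b) b"
    using assms b by (simp add: representation_diff[OF B])
  then show "representation B (S b) b = representation B (S' b) b"
    using representation_span_B0[OF assms(3) b] b by simp
qed simp

text \<open>The terms from \<open>B0\<close> drop out because S preserves its span; the coefficients
  on \<open>B - B0\<close> are thus the matrix of the operator induced on the quotient.\<close>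

lemma representation_lin:
  assumes S: "lin S" "\<And>v. v \<in> span B \<Longrightarrow> S v \<in> span B" "\<And>v. v \<in> span B0 \<Longrightarrow> S v \<in> span B0"
    and v: "v \<in> span B" and b: "b \<in> B - B0"
  shows "representation B (S v) b = (\<Sum>c\<in>B - B0. representation B v c * representation B (S c) b)"
proof -
  have "v = (\<Sum>c\<in>B. representation B v c *s c)"
    by (rule sum_representation_eq[OF B v finite_basis_subset order_refl, symmetric])
  then have "S v = (\<Sum>c\<in>B. representation B v c *s S c)"
    by (metis (no_types, lifting) lin_simps(3,6)[OF S(1)] sum.cong)
  then have "representation B (S v) b = (\<Sum>c\<in>B. representation B v c * representation B (S c) b)"
    using S(2) span_base by (simp add: representation_sum[OF B] representation_scale[OF B] span_scale)
  also have "\<dots> = (\<Sum>c\<in>B - B0. representation B v c * representation B (S c) b)"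
    using representation_span_B0[OF S(3)[OF span_base] b] finite_basis_subset
    by (intro sum.mono_neutral_right) auto
  finally show ?thesis .
qed

lemma tr_commute:
  assumes S: "lin S" "\<And>v. v \<in> span B \<Longrightarrow> S v \<in> span B" "\<And>v. v \<in> span B0 \<Longrightarrow> S v \<in> span B0"
    and S': "lin S'" "\<And>v. v \<in> span B \<Longrightarrow> S' v \<in> span B" "\<And>v. v \<in> span B0 \<Longrightarrow> S' v \<in> span B0"
  shows "tr B B0 (\<lambda>v. S (S' v)) = tr B B0 (\<lambda>v. S' (S v))"
proof -
  have "tr B B0 (\<lambda>v. S (S' v)) = (\<Sum>b\<in>B - B0. \<Sum>c\<in>B - B0. representation B (S' b) c * representation B (S c) b)"
    unfolding tr_def using S'(2) span_base by (intro sum.cong refl representation_lin[OF S]) auto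
  also have "\<dots> = (\<Sum>c\<in>B - B0. \<Sum>b\<in>B - B0. representation B (S' b) c * representation B (S c) b)"
    by (rule sum.swap)
  also have "\<dots> = (\<Sum>c\<in>B - B0. \<Sum>b\<in>B - B0. representation B (S c) b * representation B (S' b) c)"
    by (simp add: mult.commute)
  also have "\<dots> = tr B B0 (\<lambda>v. S' (S v))"
    unfolding tr_def using S(2) span_base
    by (intro sum.cong refl representation_lin[OF S', symmetric]) auto
  finally show ?thesis .
qed

lemma tr_id: "tr B B0 (\<lambda>v. v) = of_nat (card (B - B0))"
  by (simp add: tr_def representation_basis[OF B])

end

subsection \<open>Maximal subalgebras not containing the Leibniz kernel\<close>

context
  fixes M :: "'b set"
  assumes M: "maximal_subalgebra M" and nleib: "\<not> leib \<subseteq> M"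
begin

lemma maximal_subspace: "subspace M" and maximal_mult: "x \<in> M \<Longrightarrow> y \<in> M \<Longrightarrow> x \<star> y \<in> M"
  using maximal_subalgebraD(1)[OF M] by (auto simp: subalgebra_def)

lemma subspace_maximal_leib: "subspace (M \<inter> leib)"
  by (rule subspace_inter[OF maximal_subspace subspace_leib])

text \<open>Elements of \<open>leib\<close> annihilate from the left, so the only mixed products
  left are those of \<open>M\<close> with \<open>T\<close>.\<close>

lemma sum_subalgebra:
  assumes T: "subspace T" "T \<subseteq> leib" and stable: "\<And>m t. m \<in> M \<Longrightarrow> t \<in> T \<Longrightarrow> m \<star> t \<in> T"
  shows "subalgebra {m + t | m t. m \<in> M \<and> t \<in> T}"
  unfolding subalgebra_def
proof (intro conjI ballI)
  show "subspace {m + t | m t. m \<in> M \<and> t \<in> T}" by (rule subspace_sums[OF maximal_subspace T(1)])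
  fix x y assume "x \<in> {m + t | m t. m \<in> M \<and> t \<in> T}" "y \<in> {m + t | m t. m \<in> M \<and> t \<in> T}"
  then obtain m t n s where *: "x = m + t" "y = n + s" "m \<in> M" "n \<in> M" "t \<in> T" "s \<in> T" by blast
  have "t \<star> n = 0" "t \<star> s = 0" using * T(2) leib_left_zero by blast+
  then have "x \<star> y = m \<star> n + m \<star> s" by (simp add: *)
  then show "x \<star> y \<in> {m + t | m t. m \<in> M \<and> t \<in> T}" using * stable maximal_mult by blast
qed

lemma sum_eq_UNIV:
  assumes T: "subspace T" "T \<subseteq> leib" "\<And>m t. m \<in> M \<Longrightarrow> t \<in> T \<Longrightarrow> m \<star> t \<in> T" and "\<not> T \<subseteq> M"
  shows "\<exists>m\<in>M. \<exists>t\<in>T. x = m + t"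
proof -
  let ?S = "{m + t | m t. m \<in> M \<and> t \<in> T}"
  have "m \<in> ?S" if "m \<in> M" for m
    using that subspace_0[OF T(1)] by (intro CollectI exI[of _ m] exI[of _ 0]) simp
  moreover have tS: "t \<in> ?S" if "t \<in> T" for t
    using that subspace_0[OF maximal_subspace] by (intro CollectI exI[of _ 0] exI[of _ t]) simp
  moreover have "?S \<noteq> M" using tS assms(4) by blast
  ultimately have "?S = UNIV" by (intro maximal_subalgebraD(3)[OF M] sum_subalgebra T) auto
  then show ?thesis by blast
qed

lemma decompose: "\<exists>m\<in>M. \<exists>i\<in>leib. x = m + i"
  by (rule sum_eq_UNIV[OF subspace_leib]) (use leib_ideal nleib in auto)

text \<open>The algebra is M + leib and \<open>leib\<close> annihilates from the left, so every left
  multiplication is one by an element of \<open>M\<close>.\<close>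

lemma act_M: "\<exists>m\<in>M. \<forall>v. x \<star> v = m \<star> v"
  using decompose[of x] by (metis add.right_neutral leib_left_zero mult_simps(1))

lemma maximal_leib_stable: "v \<in> M \<inter> leib \<Longrightarrow> x \<star> v \<in> M \<inter> leib"
  using act_M[of x] maximal_mult leib_ideal by (metis IntD1 IntD2 IntI)

text \<open>If T is not inside M, then M + T is everything; the \<open>M\<close> component of an
  element of \<open>leib\<close> lies in \<open>M \<inter> leib\<close>, hence in T.\<close>

lemma irreducible:
  assumes T: "subspace T" "T \<subseteq> leib" "M \<inter> leib \<subseteq> T" and stable: "\<And>m t. m \<in> M \<Longrightarrow> t \<in> T \<Longrightarrow> m \<star> t \<in> T"
  shows "T = M \<inter> leib \<or> T = leib"
proof (cases "T \<subseteq> M")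
  case False
  have "i \<in> T" if i: "i \<in> leib" for i
  proof -
    obtain m t where mt: "m \<in> M" "t \<in> T" "i = m + t" using sum_eq_UNIV[OF T(1,2) stable False] by blast
    then have "m = i - t" by simp
    then have "m \<in> leib" using i mt(2) T(2) subspace_diff[OF subspace_leib] by blast
    then show ?thesis using mt T(3) subspace_add[OF T(1)] by blast
  qed
  then show ?thesis using T(2) by blast
qed (use T in blast)

lemma frattini_nilpotent_uniform:
  assumes p: "p \<in> frattini"
  obtains n where "\<forall>x. ((\<lambda>y. p \<star> y) ^^ n) x \<in> leib"
proof -
  let ?D = "\<lambda>y. p \<star> y"
  note lD = lin_funpow[OF left_mult_lin[of p]]
  obtain B where B: "finite B" "span B = UNIV" by (rule finite_basis)
  obtain n where n: "\<And>x. (?D ^^ n x) x \<in> leib" using frattini_nilpotent[OF p] by metis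
  let ?n = "\<Sum>b\<in>B. n b"
  have "b \<in> {x. (?D ^^ ?n) x \<in> leib}" if "b \<in> B" for b
  proof -
    have "n b \<le> ?n" using B(1) that by (intro member_le_sum) auto
    then have "(?D ^^ ?n) b = (?D ^^ (?n - n b)) ((?D ^^ n b) b)"
      by (metis comp_apply funpow_add le_add_diff_inverse2)
    moreover have "(?D ^^ (?n - n b)) ((?D ^^ n b) b) \<in> leib"
      using n leib_ideal by (rule funpow_in[rotated])
    ultimately show ?thesis by simp
  qed
  moreover have "subspace {x. (?D ^^ ?n) x \<in> leib}"
    by (rule subspaceI) (auto simp: lin_simps[OF lD] subspace_0[OF subspace_leib]
        intro: subspace_add[OF subspace_leib] subspace_scale[OF subspace_leib])
  ultimately have "span B \<subseteq> {x. (?D ^^ ?n) x \<in> leib}" by (intro span_minimal) auto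
  then show ?thesis using B(2) by (intro that) blast
qed

text \<open>The hypothesis is injectivity of \<open>p\<close> on leib / (M \<inter> leib). This
  space is nonzero, yet the trace of a unipotent operator on it will come out as 0.\<close>

lemma leib_action_not_injective:
  assumes p: "p \<in> frattini" and inj: "\<And>v. v \<in> leib \<Longrightarrow> p \<star> v \<in> M \<inter> leib \<Longrightarrow> v \<in> M \<inter> leib"
  shows False
proof -
  let ?D = "\<lambda>y. p \<star> y" and ?N = "M \<inter> leib"
  note lin = left_mult_lin[of p] and lD = lin_funpow[OF left_mult_lin[of p]]
  have pM: "p \<in> M" using p frattini_in_maximal[OF M] by blast
  have DN: "?D ` ?N \<subseteq> ?N" using maximal_leib_stable by blast
  have DI: "?D ` leib \<subseteq> leib" using leib_ideal by blast
  have DM: "?D ` M \<subseteq> M" using maximal_mult[OF pM] by blast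
  have papI: "polyop ?D r v \<in> leib" if "v \<in> leib" for r v by (rule polyop_in[OF lin subspace_leib DI that])
  have papN: "polyop ?D r v \<in> ?N" if "v \<in> ?N" for r v by (rule polyop_in[OF lin subspace_maximal_leib DN that])
  obtain n0 where n0: "\<forall>x. (?D ^^ n0) x \<in> leib" by (rule frattini_nilpotent_uniform[OF p])
  obtain B where B: "finite B" "span B = UNIV" by (rule finite_basis)
  obtain r where r: "r \<noteq> 0" "\<forall>x. polyop ?D r x = 0" by (rule annihilator[OF lin B])
  obtain q where rq: "r = [:- 0, 1:] ^ order 0 r * q" and q0: "\<not> [:- 0, 1:] dvd q"
    using order_decomp[OF r(1)] by blast
  have funpow_inj: "v \<in> ?N" if "v \<in> leib" "(?D ^^ j) v \<in> ?N" for j v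
    using that
  proof (induction j arbitrary: v)
    case (Suc j)
    then show ?case using leib_ideal inj by (simp add: funpow_swap1)
  qed simp
  \<comment> \<open>Injectivity on the quotient cancels the power of X in \<open>r\<close>, so
    \<open>q\<close> alone annihilates the quotient; as q(0) is nonzero, all eigenvalues there can
    be inverted.\<close>
  have qN: "polyop ?D q v \<in> ?N" if v: "v \<in> leib" for v
  proof (rule funpow_inj[OF papI[OF v]])
    have X: "[:- 0, 1:] ^ i = monom (1 :: 'a) i" for i by (simp add: monom_altdef)
    have "(?D ^^ order 0 r) (polyop ?D q v) = 0"
      using arg_cong[OF rq, of "\<lambda>s. polyop ?D s v"] r(2) unfolding X polyop_mult[OF lin] polyop_monom by simp
    then show "(?D ^^ order 0 r) (polyop ?D q v) \<in> ?N" using subspace_0[OF subspace_maximal_leib] by simp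
  qed
  let ?q = "map_poly to_ac q"
  have "q \<noteq> 0" using q0 by auto
  then have qK: "?q \<noteq> 0" by (auto simp: map_poly_eq_0_iff)
  define A where "A = {x. poly ?q x = 0}"
  have A: "finite A" unfolding A_def by (rule poly_roots_finite[OF qK])
  have "poly q 0 \<noteq> 0" using q0 unfolding poly_eq_0_iff_dvd .
  then have A0: "0 \<notin> A" by (simp add: A_def poly_0_coeff_0 coeff_map_poly)
  \<comment> \<open>Large enough both for the multiplicities in \<open>q\<close> and for the
    nilpotency exponent \<open>n0\<close> of \<open>p\<close> modulo \<open>leib\<close>.\<close>
  define k where "k = Suc (degree ?q + n0)"
  let ?P = "\<Prod>a\<in>A. [:-a, 1:] ^ k"
  have "?q dvd (\<Prod>a\<in>A. [:-a, 1:] ^ degree ?q)" unfolding A_def by (rule root_product_dvd[OF qK])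
  also have "\<dots> dvd ?P" unfolding k_def by (intro prod_dvd_prod le_imp_power_dvd) simp
  finally have qP: "?q dvd ?P" .
  have Dk: "(?D ^^ k) x \<in> leib" for x
  proof -
    have "(?D ^^ k) x = (?D ^^ n0) ((?D ^^ Suc (degree ?q)) x)"
      unfolding k_def by (metis add.commute add_Suc comp_apply funpow_add)
    then show ?thesis using n0 by metis
  qed
  \<comment> \<open>Inversion a \<mapsto> 1/a commutes with the Galois group, so this interpolation
    has coefficients in the base field.\<close>
  let ?u = "\<Sum>a\<in>A. idem A k a * smult (1 / a) 1"
  have "map_poly \<sigma> ?u = ?u" if "ac_hom \<sigma>" for \<sigma>
  proof (rule interpolation_equivariant)
    show "field_hom \<sigma>" by (rule ac_hom_field_hom[OF that])
    then show "map_poly \<sigma> (smult (1 / a) 1) = smult (1 / \<sigma> a) 1" for a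
      by (simp only: field_hom_map_poly(4,6) field_homD(3,9))
    show "\<sigma> ` A = A" unfolding A_def by (rule ac_hom_image_roots[OF that \<open>q \<noteq> 0\<close>])
  qed
  then obtain u where u: "?u = map_poly to_ac u" by (rule rational_poly)
  have u_loc: "[:-a, 1:] ^ k dvd map_poly to_ac u - smult (1 / a) 1" if "a \<in> A" for a
    unfolding u[symmetric] by (rule interpolation[OF A that])
  let ?U = "polyop ?D u"
  have lU: "lin ?U" by (rule polyop_linear[OF lin])

  text \<open>The operator U is the inverse of the semisimple part of p on the quotient; since p acts
    nilpotently on M, it commutes with the action of M.\<close>
  have commute: "?U (m \<star> v) - m \<star> ?U v \<in> ?N" if mv: "m \<in> M" "v \<in> leib" for m v
  proof (rule ccontr)
    assume "?U (m \<star> v) - m \<star> ?U v \<notin> ?N"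
    then obtain f where f: "linf f" "\<forall>w\<in>?N. f w = 0" "f (?U (m \<star> v) - m \<star> ?U v) \<noteq> 0"
      by (rule separating_functional[OF subspace_maximal_leib])
    let ?S = "{form f ?D x y | x y. x \<in> M \<and> y \<in> leib}"
    let ?J = "{g. \<forall>s\<in>?S. bivseq g s = 0}"
    have J: "is_ideal ?J" by (rule is_ideal_form[OF DM DI])
    have "ev varX (map_poly to_ac (monom 1 k)) \<in> ?J"
    proof clarify
      fix x y assume "x \<in> M" "y \<in> leib"
      have "bivseq (ev varX (map_poly to_ac (monom 1 k)) * 1) (form f ?D x y) = to_ac (f ((?D ^^ k) x \<star> y))"
        unfolding bivseq_evX[OF lin f(1)] bivseq_1[OF lin f(1)] polyop_monom ..
      then show "bivseq (ev varX (map_poly to_ac (monom 1 k))) (form f ?D x y) = 0"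
        using leib_left_zero[OF Dk] by (simp add: linf_simps[OF f(1)])
    qed
    moreover have "(\<Prod>a\<in>{0}. [:-a, 1:] ^ k) = map_poly to_ac (monom (1 :: 'a) k)"
      by (subst map_poly_monom) (simp_all add: monom_altdef)
    ultimately have PX: "ev varX (\<Prod>a\<in>{0}. [:-a, 1:] ^ k) \<in> ?J" by (simp only:)
    have "ev varY ?q \<in> ?J"
    proof clarify
      fix x y assume "x \<in> M" "y \<in> leib"
      have "bivseq (ev varY ?q * 1) (form f ?D x y) = to_ac (f (x \<star> polyop ?D q y))"
        unfolding bivseq_evY[OF lin f(1)] bivseq_1[OF lin f(1)] ..
      then show "bivseq (ev varY ?q) (form f ?D x y) = 0"
        using f(2) maximal_leib_stable[OF qN[OF \<open>y \<in> leib\<close>]] by simp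
    qed
    then have PY: "ev varY ?P \<in> ?J" using is_idealD(7)[OF J] ev_dvd[OF qP] by blast
    have "ev (varX + varY) ?q \<in> ?J"
    proof clarify
      fix x y assume "x \<in> M" "y \<in> leib"
      then show "bivseq (ev (varX + varY) ?q) (form f ?D x y) = 0"
        unfolding bivseq_evZ[OF lin f(1) left_leibniz] using f(2) qN leib_ideal by simp
    qed
    then have PZ: "ev (varX + varY) ?P \<in> ?J" using is_idealD(7)[OF J] ev_dvd[OF qP] by blast
    let ?G = "ev (varX + varY) (map_poly to_ac u) - ev varY (map_poly to_ac u)"
    \<comment> \<open>The k-th power of p maps into \<open>leib\<close>, which annihilates from the
      left, so X has only the eigenvalue 0. Hence Y and X + Y share the eigenvalue b, and both terms
      of \<open>?G\<close> are congruent to 1/b.\<close>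
    have "?G \<in> ?J"
    proof (rule ideal_local_sum[OF _ A A J PX PY PZ])
      fix a b I
      assume a: "a \<in> {0}" and b: "b \<in> A" and I: "is_ideal I"
        and *: "ev varY [:-b, 1:] ^ k \<in> I" "ev (varX + varY) [:-(a + b), 1:] ^ k \<in> I"
      have "ev z (map_poly to_ac u) - cst (1 / b) \<in> I" if "ev z [:-b, 1:] ^ k \<in> I" for z
      proof -
        have "ev z ([:-b, 1:] ^ k) \<in> I" using that by (simp add: ev_power)
        from is_idealD(7)[OF I this ev_dvd[OF u_loc[OF b]]]
        show ?thesis unfolding ev_diff ev_smult ev_1 mult_1_right .
      qed
      from is_idealD(6)[OF I this[of "varX + varY"] this[of varY]]
      show "?G \<in> I" using * a by simp
    qed simp
    then have "bivseq ?G (form f ?D m v) = 0" using mv by blast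
    then have "bivseq (ev (varX + varY) (map_poly to_ac u)) (form f ?D m v)
        = bivseq (ev varY (map_poly to_ac u) * 1) (form f ?D m v)"
      by (simp add: bivseq_diff)
    then have "to_ac (f (?U (m \<star> v))) = to_ac (f (m \<star> ?U v))"
      unfolding bivseq_evZ[OF lin f(1) left_leibniz] bivseq_evY[OF lin f(1)] bivseq_1[OF lin f(1)] .
    then show False using f(3) by (simp add: linf_simps[OF f(1)])
  qed
  have commute': "x \<star> ?U v - ?U (x \<star> v) \<in> ?N" if v: "v \<in> leib" for x v
  proof -
    obtain m where m: "m \<in> M" "\<forall>v. x \<star> v = m \<star> v" using act_M by blast
    have "- (?U (m \<star> v) - m \<star> ?U v) \<in> ?N" by (rule subspace_neg[OF subspace_maximal_leib commute[OF m(1) v]])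
    then show ?thesis using m(2) by simp
  qed
  \<comment> \<open>This polynomial is zero at every eigenvalue a because u(a) a = 1, so U p - 1 is
    nilpotent on the quotient.\<close>
  define w where "w = u * [:0, 1:] - 1"
  have T: "polyop ?D w v = ?U (p \<star> v) - v" for v
    by (simp only: w_def polyop_diff polyop_mult[OF lin] polyop_1) (simp add: polyop_pCons)
  have lT: "lin (polyop ?D w)" by (rule polyop_linear[OF lin])
  have nil: "(polyop ?D w ^^ k) v \<in> ?N" if v: "v \<in> leib" for v
  proof (rule ccontr)
    assume "(polyop ?D w ^^ k) v \<notin> ?N"
    then obtain f where f: "linf f" "\<forall>w\<in>?N. f w = 0" "f ((polyop ?D w ^^ k) v) \<noteq> 0"
      by (rule separating_functional[OF subspace_maximal_leib])
    have wK: "map_poly to_ac w = map_poly to_ac u * [:0, 1:] - 1"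
      unfolding w_def map_poly_to_ac by (simp add: map_poly_pCons)
    have pow: "map_poly to_ac (w ^ i) = map_poly to_ac w ^ i" for i
      by (induction i) (simp_all add: map_poly_to_ac)
    have "[:-a, 1:] ^ k dvd map_poly to_ac w ^ k" if a: "a \<in> A" for a
    proof (rule dvd_power_same)
      have "[:-a, 1:] dvd [:-a, 1:] ^ k" by (rule dvd_power) (simp add: k_def)
      then have "[:-a, 1:] dvd map_poly to_ac u - smult (1 / a) 1" using u_loc[OF a] dvd_trans by blast
      then have "poly (map_poly to_ac u) a = 1 / a" by (simp flip: poly_eq_0_iff_dvd)
      moreover have "a \<noteq> 0" using a A0 by blast
      ultimately have "poly (map_poly to_ac w) a = 0" by (simp add: wK)
      then show "[:-a, 1:] dvd map_poly to_ac w" by (simp only: poly_eq_0_iff_dvd)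
    qed
    then have "?P dvd map_poly to_ac (w ^ k)" unfolding pow by (rule prod_linear_power_dvd[OF A])
    with qP have "?q dvd map_poly to_ac (w ^ k)" by (rule dvd_trans)
    then obtain g where "map_poly to_ac (w ^ k) = ?q * g" by (rule dvdE)
    then have g: "1 * map_poly to_ac (w ^ k) = g * ?q" by (simp add: mult.commute)
    have "f ((?D ^^ i) (polyop ?D q v)) = 0" for i
      using f(2) funpow_in[of ?N ?D, OF maximal_leib_stable qN[OF v]] by blast
    then have "polyseq (g * ?q) (\<lambda>i. to_ac (f ((?D ^^ i) v))) = 0"
      unfolding polyseq_map_poly[OF lin f(1)] by (simp add: polyseq_def)
    then have "to_ac (f (polyop ?D (w ^ k) v)) = 0"
      unfolding g[symmetric] polyseq_map_poly[OF lin f(1)] by (simp add: polyseq_def)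
    then show False using f(3) by (simp add: polyop_power[OF lin])
  qed
  obtain B B0 where B: "independent B" "B0 \<subseteq> B" and sp: "span B0 = ?N" "span B = leib"
    and diag: "\<forall>b\<in>B - B0. representation B (polyop ?D w b) b = 0"
    by (rule adapted_basis[OF subspace_maximal_leib subspace_leib _ lT papN papI nil]) auto
  have inB: "b \<in> leib" if "b \<in> B" for b using that sp(2) span_base by blast
  have UB: "?U (x \<star> b) \<in> span B" "?U b \<in> span B" if "b \<in> B" for x b
    using papI leib_ideal inB[OF that] by (simp_all add: sp)
  \<comment> \<open>The trace on the quotient of U composed with left multiplication by z, a linear
    functional of z.\<close>
  let ?F = "\<lambda>z. tr B B0 (\<lambda>v. ?U (z \<star> v))"
  have F_add: "?F (y + z) = ?F y + ?F z" for y z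
    using tr_add[OF B, of "\<lambda>v. ?U (y \<star> v)" "\<lambda>v. ?U (z \<star> v)"] UB by (simp add: lin_simps[OF lU])
  have F_scale: "?F (c *s z) = c * ?F z" for c z
    using tr_scale[OF B, of "\<lambda>v. ?U (z \<star> v)"] UB by (simp add: lin_simps[OF lU])
  \<comment> \<open>A product x y acts as the commutator of the two left multiplications. U commutes
    with these on the quotient, and the trace is cyclic, so the two terms cancel.\<close>
  have F_mult: "?F (x \<star> y) = 0" for x y
  proof -
    have "x \<star> y \<star> v = x \<star> (y \<star> v) + (- 1) *s (y \<star> (x \<star> v))" for v
      by (subst left_leibniz[of x y v]) simp
    then have "?U (x \<star> y \<star> v) = ?U (x \<star> (y \<star> v)) + (- 1) *s ?U (y \<star> (x \<star> v))" for v
      by (simp only: lin_simps(1,3)[OF lU])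
    then have "?F (x \<star> y) = tr B B0 (\<lambda>v. ?U (x \<star> (y \<star> v)) + (- 1) *s ?U (y \<star> (x \<star> v)))"
      by (simp only:)
    also have "\<dots> = tr B B0 (\<lambda>v. ?U (x \<star> (y \<star> v))) + (- 1) * tr B B0 (\<lambda>v. ?U (y \<star> (x \<star> v)))"
      using papI leib_ideal inB by (subst tr_add[OF B], simp_all add: sp subspace_neg[OF subspace_leib])
        (subst tr_scale[OF B, of _ "- 1", simplified], simp_all add: sp)
    also have "tr B B0 (\<lambda>v. ?U (x \<star> (y \<star> v))) = tr B B0 (\<lambda>v. y \<star> ?U (x \<star> v))"
    proof (rule tr_commute[OF B])
      show "lin (\<lambda>v. ?U (x \<star> v))" by (rule linI) (simp_all add: lin_simps[OF lU])
      show "lin (\<lambda>v. y \<star> v)" by (rule left_mult_lin)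
    qed (unfold sp, (intro papI papN leib_ideal maximal_leib_stable; assumption)+)
    also have "\<dots> = tr B B0 (\<lambda>v. ?U (y \<star> (x \<star> v)))"
      using papI leib_ideal inB commute' by (intro tr_cong[OF B]) (simp_all add: sp)
    finally show ?thesis by simp
  qed
  have "subspace {z. ?F z = 0}"
  proof (rule subspaceI)
    show "0 \<in> {z. ?F z = 0}" using F_mult[of 0 0] by (simp only: mult_simps mem_Collect_eq)
  qed (simp_all only: mem_Collect_eq F_add F_scale add_0_left mult_zero_right)
  then have "span {x \<star> y | x y. True} \<subseteq> {z. ?F z = 0}"
    using F_mult by (intro span_minimal) auto
  \<comment> \<open>On the other hand U p is the identity plus a nilpotent operator, so its trace is
    the dimension of the quotient; characteristic 0 makes that dimension 0.\<close>
  then have "?F p = 0" using frattini_in_products p by blast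
  moreover have "?F p = tr B B0 (\<lambda>v. polyop ?D w v + v)" by (simp add: T)
  moreover have "\<dots> = tr B B0 (polyop ?D w) + tr B B0 (\<lambda>v. v)"
    using papI inB by (intro tr_add[OF B]) (simp_all add: sp)
  moreover have "tr B B0 (polyop ?D w) = 0" using diag by (simp add: tr_def)
  ultimately have "(of_nat (card (B - B0)) :: 'a) = 0" by (simp add: tr_id[OF B])
  then have "B - B0 = {}" using finite_basis_subset[OF B] by simp
  then have "span B0 = span B" using B(2) by (metis Diff_eq_empty_iff subset_antisym)
  then show False using sp nleib by blast
qed

text \<open>The Fitting null component of p on leib / (M \<inter> leib) is stable under
  \<open>M\<close>, since p acts nilpotently on \<open>M\<close> modulo \<open>leib\<close>. By
  irreducibility it is zero or everything, and zero would mean that p acts injectively.\<close>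

lemma leib_action_nilpotent:
  assumes p: "p \<in> frattini" and v: "v \<in> leib"
  shows "\<exists>n. ((\<lambda>y. p \<star> y) ^^ n) v \<in> M \<inter> leib"
proof -
  let ?D = "\<lambda>y. p \<star> y" and ?N = "M \<inter> leib"
  note lin = left_mult_lin[of p] and lD = lin_funpow[OF left_mult_lin[of p]]
  have pM: "p \<in> M" using p frattini_in_maximal[OF M] by blast
  obtain n0 where n0: "\<forall>x. (?D ^^ n0) x \<in> leib" by (rule frattini_nilpotent_uniform[OF p])
  have nM: "(?D ^^ n0) m \<in> ?N" if "m \<in> M" for m
    using n0 funpow_in[of M ?D, OF maximal_mult[OF pM] that] by blast
  let ?K = "{v \<in> leib. \<exists>n. (?D ^^ n) v \<in> ?N}"
  have mono: "(?D ^^ m) x \<in> ?N" if "(?D ^^ n) x \<in> ?N" "n \<le> m" for n m x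
  proof -
    have "(?D ^^ m) x = (?D ^^ (m - n)) ((?D ^^ n) x)" using that(2)
      by (metis comp_apply funpow_add le_add_diff_inverse2)
    moreover have "(?D ^^ (m - n)) ((?D ^^ n) x) \<in> ?N" using that(1) maximal_leib_stable by (rule funpow_in[rotated])
    ultimately show ?thesis by simp
  qed
  have subK: "subspace ?K"
  proof (rule subspaceI)
    show "0 \<in> ?K" using subspace_0[OF subspace_maximal_leib] subspace_0[OF subspace_leib] lin_simps(4)[OF lD] by simp
    show "x + y \<in> ?K" if xy: "x \<in> ?K" "y \<in> ?K" for x y
    proof -
      obtain n m where "(?D ^^ n) x \<in> ?N" "(?D ^^ m) y \<in> ?N" using xy by blast
      then have "(?D ^^ (max n m)) x \<in> ?N" "(?D ^^ (max n m)) y \<in> ?N"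
        using mono max.cobounded1 max.cobounded2 by metis+
      then have "(?D ^^ (max n m)) (x + y) \<in> ?N"
        unfolding lin_simps(1)[OF lD] by (rule subspace_add[OF subspace_maximal_leib])
      moreover have "x + y \<in> leib" using xy subspace_add[OF subspace_leib] by blast
      ultimately show ?thesis by blast
    qed
    show "c *s x \<in> ?K" if x: "x \<in> ?K" for c x
    proof -
      obtain n where "(?D ^^ n) x \<in> ?N" using x by blast
      then have "(?D ^^ n) (c *s x) \<in> ?N"
        unfolding lin_simps(3)[OF lD] by (rule subspace_scale[OF subspace_maximal_leib])
      moreover have "c *s x \<in> leib" using x subspace_scale[OF subspace_leib] by blast
      ultimately show ?thesis by blast
    qed
  qed
  have NK: "?N \<subseteq> ?K" by (auto intro: exI[of _ 0])
  have stable: "m \<star> x \<in> ?K" if m: "m \<in> M" and x: "x \<in> ?K" for m x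
  proof -
    obtain j where j: "(?D ^^ j) x \<in> ?N" and xl: "x \<in> leib" using x by blast
    have "(?D ^^ (n0 + j)) (m \<star> x) \<in> ?N"
    proof (rule derivation_funpow_mult[OF left_leibniz lin subspace_maximal_leib maximal_leib_stable _ _ maximal_mult[OF pM] leib_ideal m xl nM[OF m] j])
      show "a \<star> b \<in> ?N" if "a \<in> ?N" for a b
        using that leib_left_zero[of a b] subspace_0[OF subspace_maximal_leib] by simp
      show "a \<star> b \<in> ?N" if "b \<in> ?N" for a b using that by (rule maximal_leib_stable)
    qed assumption+
    then show ?thesis using leib_ideal[OF xl] by blast
  qed
  have "?K = ?N \<or> ?K = leib" by (rule irreducible[OF subK _ NK stable]) auto
  moreover have "?K \<noteq> ?N"
  proof
    assume K: "?K = ?N"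
    show False
    proof (rule leib_action_not_injective[OF p])
      fix v assume v: "v \<in> leib" "p \<star> v \<in> M \<inter> leib"
      then have "(?D ^^ 1) v \<in> ?N" by simp
      then have "v \<in> ?K" using v(1) by blast
      then show "v \<in> ?N" using K by blast
    qed
  qed
  ultimately show ?thesis using v by blast
qed

end

section \<open>Engel's theorem and the right ideal property\<close>

text \<open>The induction bottoms out at \<open>leib \<inter> frattini\<close>, which acts as zero.
  Requiring \<open>h\<close> to contain it makes products in \<open>h\<close> anticommutative modulo
  every intermediate \<open>k\<close>, as in a Lie algebra. \<open>U\<close> and \<open>V\<close>
  stay general because the induction also uses h / k as a module.\<close>

lemma engel:
  assumes "subalgebra h" "leib \<inter> frattini \<subseteq> h" "h \<subseteq> frattini"
    and "subspace U" "subspace V" "U \<subset> V"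
    and "\<forall>g\<in>h. \<forall>v\<in>V. g \<star> v \<in> V" "\<forall>g\<in>h. \<forall>v\<in>U. g \<star> v \<in> U"
    and "\<forall>g\<in>h. \<forall>v\<in>V. \<exists>n. ((\<lambda>y. g \<star> y) ^^ n) v \<in> U"
  shows "\<exists>v\<in>V - U. \<forall>g\<in>h. g \<star> v \<in> U"
  using assms
proof (induction "dim h" arbitrary: h U V rule: less_induct)
  case less
  note h = less.prems(1-3) and UV = less.prems(4-6) and hV = less.prems(7) and hU = less.prems(8)
    and nil = less.prems(9)
  let ?Z = "leib \<inter> frattini"
  have subh: "subspace h" by (rule subalgebraD[OF h(1)])
  show ?case
  proof (cases "h = ?Z")
    case True
    then show ?thesis using UV leib_left_zero subspace_0[OF UV(1)] by auto
  next
    case False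
    have "subspace ?Z" by (rule subspace_inter[OF subspace_leib subalgebraD(1)[OF subalgebra_frattini]])
    then have "subalgebra ?Z"
      unfolding subalgebra_def using leib_left_zero subspace_0 by auto
    then have "subalgebra ?Z \<and> ?Z \<subseteq> ?Z \<and> ?Z \<subset> h" using False h(2) by blast
    then obtain k where k: "subalgebra k \<and> ?Z \<subseteq> k \<and> k \<subset> h"
      and kmax: "\<forall>R. subalgebra R \<and> ?Z \<subseteq> R \<and> R \<subset> h \<longrightarrow> dim R \<le> dim k"
      by (rule maximal_dim_exists[of "\<lambda>k. subalgebra k \<and> ?Z \<subseteq> k \<and> k \<subset> h"])
    have subk: "subspace k" and multk: "\<And>x y. x \<in> k \<Longrightarrow> y \<in> k \<Longrightarrow> x \<star> y \<in> k"
      using k by (auto simp: subalgebra_def)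
    have multh: "\<And>x y. x \<in> h \<Longrightarrow> y \<in> h \<Longrightarrow> x \<star> y \<in> h" by (rule subalgebraD(2)[OF h(1)])
    have dk: "dim k < dim h" using k subh subk by (intro dim_less) auto
    have kh: "k \<subseteq> h" and kF: "k \<subseteq> frattini" using k h by blast+
    have "\<exists>n. ((\<lambda>y. g \<star> y) ^^ n) v \<in> k" if g: "g \<in> k" and v: "v \<in> h" for g v
    proof -
      obtain n where "((\<lambda>y. g \<star> y) ^^ n) v \<in> leib" using frattini_nilpotent[of g v] g kF by blast
      moreover have "((\<lambda>y. g \<star> y) ^^ n) v \<in> h" using multh g kh v by (intro funpow_in) auto
      ultimately show ?thesis using h(3) k by blast
    qed
    \<comment> \<open>Here \<open>k\<close> acts on h / k, nilpotently because Frattini elements are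
      nilpotent modulo \<open>leib\<close> and \<open>leib \<inter> frattini\<close> lies in
      \<open>k\<close>. The resulting x normalises \<open>k\<close>, so k + span {x} is a subalgebra
      and equals \<open>h\<close> by maximality.\<close>
    then have "\<exists>x\<in>h - k. \<forall>g\<in>k. g \<star> x \<in> k"
      using k kF kh subk subh multh multk by (intro less.hyps[OF dk]) auto
    then obtain x where x: "x \<in> h" "x \<notin> k" "\<forall>g\<in>k. g \<star> x \<in> k" by blast
    define k' where "k' = {y + c *s x | y c. y \<in> k}"
    have "subspace k'"
    proof (rule subspaceI)
      show "0 \<in> k'" unfolding k'_def using subspace_0[OF subk]
        by (intro CollectI exI[of _ 0]) simp
      show "a + b \<in> k'" if ab: "a \<in> k'" "b \<in> k'" for a b
      proof -
        obtain y c y' c' where "a = y + c *s x" "b = y' + c' *s x" "y \<in> k" "y' \<in> k"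
          using ab by (auto simp: k'_def)
        then show ?thesis unfolding k'_def using subspace_add[OF subk]
          by (intro CollectI exI[of _ "y + y'"] exI[of _ "c + c'"]) (simp add: scale_left_distrib)
      qed
      show "c *s a \<in> k'" if a: "a \<in> k'" for c a
      proof -
        obtain y d where "a = y + d *s x" "y \<in> k" using a by (auto simp: k'_def)
        then show ?thesis unfolding k'_def using subspace_scale[OF subk]
          by (intro CollectI exI[of _ "c *s y"] exI[of _ "c * d"]) (simp add: scale_right_distrib)
      qed
    qed
    moreover have kk': "k \<subseteq> k'"
    proof
      fix y assume "y \<in> k"
      then show "y \<in> k'" unfolding k'_def by (intro CollectI exI[of _ y] exI[of _ 0]) simp
    qed
    moreover have xk': "x \<in> k'" unfolding k'_def using subspace_0[OF subk]
      by (intro CollectI exI[of _ 0] exI[of _ 1]) simp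
    moreover have k'h: "k' \<subseteq> h" unfolding k'_def using x(1) kh
      by (auto intro!: subspace_add[OF subh] subspace_scale[OF subh])
    moreover have "a \<star> b \<in> k'" if ab: "a \<in> k'" "b \<in> k'" for a b
    proof -
      obtain y c y' c' where *: "a = y + c *s x" "b = y' + c' *s x" "y \<in> k" "y' \<in> k"
        using ab by (auto simp: k'_def)
      have sym: "u \<star> v + v \<star> u \<in> k" if "u \<in> h" "v \<in> h" for u v
        using leib_symmetric[of u v] multh[OF that] multh[OF that(2,1)] subspace_add[OF subh] h(3) k by blast
      have "x \<star> y' = (x \<star> y' + y' \<star> x) - y' \<star> x" by simp
      also have "\<dots> \<in> k" using sym[OF x(1)] * kh x(3) by (intro subspace_diff[OF subk]) auto
      finally have 1: "x \<star> y' \<in> k" .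
      have "(1 / 2) *s (x \<star> x + x \<star> x) \<in> k" by (rule subspace_scale[OF subk sym[OF x(1) x(1)]])
      then have 2: "x \<star> x \<in> k" by (simp flip: scale_left_distrib add: scale_right_distrib)
      have "a \<star> b = y \<star> y' + c' *s (y \<star> x) + c *s (x \<star> y') + (c * c') *s (x \<star> x)"
        by (simp add: * scale_right_distrib algebra_simps)
      also have "\<dots> \<in> k"
        using * multk x(3) 1 2 by (intro subspace_add[OF subk] subspace_scale[OF subk]) auto
      finally show ?thesis using kk' by blast
    qed
    ultimately have "subalgebra k'" by (simp add: subalgebra_def)
    have hk': "h = k'"
    proof (rule ccontr)
      assume "h \<noteq> k'"
      then have 1: "k' \<subset> h" using k'h by blast
      have 2: "?Z \<subseteq> k'" using k kk' by blast
      have "dim k' \<le> dim k"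
        by (rule kmax[THEN spec, THEN mp]) (intro conjI \<open>subalgebra k'\<close> 1 2)
      moreover have "dim k < dim k'"
        using subk \<open>subspace k'\<close> kk' xk' x(2) by (intro dim_less) auto
      ultimately show False by simp
    qed
    have "\<exists>w\<in>V - U. \<forall>g\<in>k. g \<star> w \<in> U"
      using k kF kh UV hV hU nil by (intro less.hyps[OF dk]) blast+
    then obtain w where w: "w \<in> V" "w \<notin> U" "\<forall>g\<in>k. g \<star> w \<in> U" by blast
    let ?D = "\<lambda>y. x \<star> y"
    \<comment> \<open>The last iterate of x on w outside \<open>U\<close> is the required vector: x
      sends it into \<open>U\<close>, and so does \<open>k\<close>, because g(xv) = (gx)v + x(gv)
      with gx in \<open>k\<close>.\<close>
    define n where "n = (LEAST n. (?D ^^ n) w \<in> U)"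
    have n: "(?D ^^ n) w \<in> U" unfolding n_def
      by (rule LeastI_ex[where P = "\<lambda>n. (?D ^^ n) w \<in> U"]) (use nil x(1) w(1) in blast)
    then have "n \<noteq> 0" using w(2) by (metis funpow_0)
    then obtain i where i: "n = Suc i" using not0_implies_Suc by blast
    let ?v = "(?D ^^ i) w"
    have vU: "?v \<notin> U" using not_less_Least[of i "\<lambda>n. (?D ^^ n) w \<in> U"] by (simp add: i flip: n_def)
    have "?v \<in> {v \<in> V. \<forall>g\<in>k. g \<star> v \<in> U}"
    proof (rule funpow_in)
      show "w \<in> {v \<in> V. \<forall>g\<in>k. g \<star> v \<in> U}" using w by blast
      fix v assume v: "v \<in> {v \<in> V. \<forall>g\<in>k. g \<star> v \<in> U}"
      have "g \<star> (x \<star> v) \<in> U" if g: "g \<in> k" for g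
        unfolding left_leibniz[of g x v] using v x g hU by (intro subspace_add[OF UV(1)]) auto
      then show "x \<star> v \<in> {v \<in> V. \<forall>g\<in>k. g \<star> v \<in> U}" using v hV x(1) by blast
    qed
    then have v: "?v \<in> V" "\<And>g. g \<in> k \<Longrightarrow> g \<star> ?v \<in> U" by blast+
    have xv: "x \<star> ?v \<in> U" using n by (simp add: i)
    have "g \<star> ?v \<in> U" if g: "g \<in> h" for g
    proof -
      obtain y c where "g = y + c *s x" "y \<in> k" using g by (auto simp: hk' k'_def)
      then show ?thesis using v(2) xv by (auto intro!: subspace_add[OF UV(1)] subspace_scale[OF UV(1)])
    qed
    then show ?thesis using v(1) vU by blast
  qed
qed

text \<open>The vectors of \<open>leib\<close> that all Frattini elements send into \<open>M\<close>
  form a submodule; Engel's theorem makes it larger than \<open>M \<inter> leib\<close>, so it is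
  \<open>leib\<close>.\<close>

lemma frattini_leib:
  assumes M: "maximal_subalgebra M" and nleib: "\<not> leib \<subseteq> M" and p: "p \<in> frattini" and i: "i \<in> leib"
  shows "p \<star> i \<in> M"
proof -
  let ?N = "M \<inter> leib"
  note left = maximal_leib_stable[OF M nleib] and N = subspace_maximal_leib[OF M nleib]
  have "\<exists>v\<in>leib - ?N. \<forall>g\<in>frattini. g \<star> v \<in> ?N"
    using nleib leib_ideal left leib_action_nilpotent[OF M nleib]
    by (intro engel[OF subalgebra_frattini _ _ N subspace_leib]) blast+
  then obtain v where v: "v \<in> leib" "v \<notin> ?N" "\<forall>g\<in>frattini. g \<star> v \<in> ?N" by blast
  let ?T = "{v \<in> leib. \<forall>g\<in>frattini. g \<star> v \<in> ?N}"
  have "?T = ?N \<or> ?T = leib"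
  proof (rule irreducible[OF M nleib])
    show "subspace ?T"
      by (rule subspaceI) (auto simp: subspace_0[OF subspace_leib] subspace_0[OF N, simplified]
          intro: subspace_add[OF subspace_leib] subspace_scale[OF subspace_leib]
            subspace_add[OF maximal_subspace[OF M nleib]] subspace_scale[OF maximal_subspace[OF M nleib]])
    show "?T \<subseteq> leib" by blast
    show "?N \<subseteq> ?T" using left by blast
    fix m t assume m: "m \<in> M" and t: "t \<in> ?T"
    have "g \<star> (m \<star> t) \<in> ?N" if g: "g \<in> frattini" for g
    proof -
      \<comment> \<open>Only the left ideal property is available for \<open>frattini\<close>. Since
        g m + m g lies in \<open>leib\<close> and acts as zero, g m acts as -(m g), and m g is a
        Frattini element.\<close>
      have "g \<star> m \<star> t = (g \<star> m + m \<star> g) \<star> t - m \<star> g \<star> t" by simp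
      also have "\<dots> = - (m \<star> g \<star> t)" using leib_left_zero[OF leib_symmetric] by simp
      also have "\<dots> \<in> ?N" using t frattini_left[OF g] by (intro subspace_neg[OF N]) blast
      finally have "g \<star> m \<star> t \<in> ?N" .
      moreover have "m \<star> (g \<star> t) \<in> ?N" using t g left by blast
      ultimately show ?thesis unfolding left_leibniz[of g m t] by (rule subspace_add[OF N])
    qed
    then show "m \<star> t \<in> ?T" using t leib_ideal by blast
  qed
  then have "?T = leib" using v by blast
  then show ?thesis using p i by blast
qed

text \<open>If \<open>M\<close> contains \<open>leib\<close>, then p x is -(x p) modulo
  \<open>M\<close> and the left ideal property suffices. Otherwise the algebra is M + leib, and only
  the action of p on \<open>leib\<close> is at issue.\<close>

theorem frattini_right:
  assumes p: "p \<in> frattini"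
  shows "p \<star> x \<in> frattini"
proof -
  have "p \<star> x \<in> M" if M: "maximal_subalgebra M" for M
  proof -
    have subM: "subspace M" using M by (simp add: maximal_subalgebra_def subalgebra_def)
    have pM: "p \<in> M" using frattini_in_maximal[OF M] p by blast
    show ?thesis
    proof (cases "leib \<subseteq> M")
      case True
      have "p \<star> x = (p \<star> x + x \<star> p) - x \<star> p" by simp
      also have "\<dots> \<in> M"
        using True leib_symmetric frattini_left[OF p] frattini_in_maximal[OF M]
        by (intro subspace_diff[OF subM]) blast+
      finally show ?thesis .
    next
      case False
      obtain m i where mi: "m \<in> M" "i \<in> leib" "x = m + i" using decompose[OF M False] by blast
      have "p \<star> m \<in> M" using M pM mi(1) by (simp add: maximal_subalgebra_def subalgebra_def)
      moreover have "p \<star> i \<in> M" by (rule frattini_leib[OF M False p mi(2)])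
      ultimately show ?thesis using subspace_add[OF subM] by (simp add: mi(3))
    qed
  qed
  then show ?thesis by (simp add: frattini_def)
qed

theorem ideal_frattini: "ideal frattini"
  unfolding ideal_def
  using subalgebraD(1)[OF subalgebra_frattini] frattini_left frattini_right by blast

end

theorem theorem1p14:
  fixes scale :: "'a::field_char_0 \<Rightarrow> 'b::ab_group_add \<Rightarrow> 'b"
    and mult :: "'b \<Rightarrow> 'b \<Rightarrow> 'b"
  assumes "leibniz_algebra scale mult"
    and "leibniz_algebra.finite_dim scale"
  shows "leibniz_algebra.ideal scale mult (leibniz_algebra.frattini scale mult)"
proof -
  interpret leibniz_algebra scale mult by fact
  interpret fd_leibniz scale mult by unfold_locales (rule assms(2))
  show ?thesis by (rule ideal_frattini)
qed

end
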